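(* Let $q$ be a power of an odd prime, let $\mathrm C$ be an irreducible conic in $PG(2,q)$, and let $\mathcal L$ be a line partition of the set of internal points to $\mathrm C$. Then at least one of the following holds: (1) $\#\mathcal L=q-1$, and there is an external point $P$ to $\mathrm C$ such that $\mathcal L$ consists of the $q-1$ lines through $P$ which are not tangent to $\mathrm C$; (2) $\#\mathcal L=q$, and there is a point $P\in\mathrm C$ such that $\mathcal L$ consists of the $q$ lines through $P$ distinct from the tangent to $\mathrm C$ at $P$; (3) $q$ is a square, $\#\mathcal L=q$, and there is a Baer subplane $PG(2,\sqrt q)$ of $PG(2,q)$ having exactly $\sqrt q+1$ points in common with $\mathrm C$ such that $\mathcal L$ consists of all lines belonging to this Baer subplane which are not tangent to $\mathrm C$.
   Context: $PG(2,q)$ is the Desarguesian projective plane over the finite field $\mathbb F_q$, with $q$ odd. An irreducible conic $\mathrm C$ of $PG(2,q)$ is regarded as its set of $q+1$ $\mathbb F_q$-rational points. A line is a secant, tangent or external line to $\mathrm C$ according to whether it meets $\mathrm C$ in $2$, $1$ or $0$ points. A point not on $\mathrm C$ is external if it lies on exactly two tangents to $\mathrm C$, and internal if it lies on no tangent to $\mathrm C$; every point not on $\mathrm C$ is either external or internal. A line partition of the set of internal points to $\mathrm C$ is a set $\mathcal L$ of lines of $PG(2,q)$ such that every internal point to $\mathrm C$ lies on exactly one line of $\mathcal L$, and every line of $\mathcal L$ contains at least one internal point (equivalently, no line of $\mathcal L$ is tangent to $\mathrm C$). For $q$ a square, a Baer subplane $PG(2,\sqrt q)$ of $PG(2,q)$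 is the image, under a projectivity of $PG(2,q)$, of the set of points having homogeneous coordinates in $\mathbb F_{\sqrt q}$. A line of $PG(2,q)$ belongs to the Baer subplane if it contains $\sqrt q+1$ points of it.
   Formalization: The case q = 3 is excluded: there the three sides of a triangle inscribed in the conic form a line partition of the three internal points with q lines that is of none of the types (1), (2), (3). *)

theory Defs
  imports
    "HOL-Analysis.Cartesian_Space"
    "HOL-Library.Poly_Mapping"
    "HOL-Algebra.Algebraic_Closure_Type"
begin

(* PG(2,q), where q = CARD('a): points and lines are the subspaces of dimension 1 and 2 of 'a^3,
   and the point P lies on the line L iff P \<subseteq> L. *)

definition pg_points :: "('a::{field,finite} ^ 3) set set" where
  "pg_points = {P. vec.subspace P \<and> vec.dim P = 1}"

definition pg_lines :: "('a::{field,finite} ^ 3) set set" where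
  "pg_lines = {L. vec.subspace L \<and> vec.dim L = 2}"

definition points_on :: "('a::{field,finite} ^ 3) set set \<Rightarrow> ('a ^ 3) set \<Rightarrow> ('a ^ 3) set set" where
  "points_on S L = {P \<in> S. P \<subseteq> L}"

(* Polynomials in three variables are finitely supported maps from exponent vectors to
   coefficients. *)

type_synonym 'a poly3 = "(3 \<Rightarrow>\<^sub>0 nat) \<Rightarrow>\<^sub>0 'a"

definition homogeneous3 :: "nat \<Rightarrow> 'a::zero poly3 \<Rightarrow> bool" where
  "homogeneous3 d F \<longleftrightarrow> (\<forall>m \<in> Poly_Mapping.keys F. (\<Sum>i\<in>UNIV. Poly_Mapping.lookup m i) = d)"

definition eval3 :: "'a::comm_semiring_1 poly3 \<Rightarrow> 'a ^ 3 \<Rightarrow> 'a" where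
  "eval3 F v = (\<Sum>m \<in> Poly_Mapping.keys F.
     Poly_Mapping.lookup F m * (\<Prod>i\<in>UNIV. (v $ i) ^ Poly_Mapping.lookup m i))"

(* Irreducibility is over the algebraic closure: a pair of conjugate lines is given by a form that
   is irreducible over 'a, but it is not an irreducible conic. *)

definition irreducible_conic :: "('a::{field,finite} ^ 3) set set \<Rightarrow> bool" where
  "irreducible_conic C \<longleftrightarrow>
     (\<exists>F :: 'a poly3. homogeneous3 2 F
        \<and> Factorial_Ring.irreducible (Poly_Mapping.map to_ac F :: 'a alg_closure poly3)
        \<and> C = {P \<in> pg_points. \<forall>v\<in>P. eval3 F v = 0})"

definition tangent_line :: "('a::{field,finite} ^ 3) set set \<Rightarrow> ('a ^ 3) set \<Rightarrow> bool" where
  "tangent_line C L \<longleftrightarrow> L \<in> pg_lines \<and> card (points_on C L) = 1"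

definition tangent_at :: "('a::{field,finite} ^ 3) set set \<Rightarrow> ('a ^ 3) set \<Rightarrow> ('a ^ 3) set" where
  "tangent_at C P = (THE L. tangent_line C L \<and> P \<subseteq> L)"

definition external_point :: "('a::{field,finite} ^ 3) set set \<Rightarrow> ('a ^ 3) set \<Rightarrow> bool" where
  "external_point C P \<longleftrightarrow> P \<in> pg_points \<and> P \<notin> C \<and> card {L. tangent_line C L \<and> P \<subseteq> L} = 2"

definition internal_point :: "('a::{field,finite} ^ 3) set set \<Rightarrow> ('a ^ 3) set \<Rightarrow> bool" where
  "internal_point C P \<longleftrightarrow> P \<in> pg_points \<and> P \<notin> C \<and> \<not> (\<exists>L. tangent_line C L \<and> P \<subseteq> L)"

definition internal_line_partition ::
    "('a::{field,finite} ^ 3) set set \<Rightarrow> ('a ^ 3) set set \<Rightarrow> bool" where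
  "internal_line_partition C \<L> \<longleftrightarrow>
     \<L> \<subseteq> pg_lines
     \<and> (\<forall>P. internal_point C P \<longrightarrow> (\<exists>!L. L \<in> \<L> \<and> P \<subseteq> L))
     \<and> (\<forall>L\<in>\<L>. \<exists>P. internal_point C P \<and> P \<subseteq> L)"

definition projectivity :: "'a::{field,finite} ^ 3 ^ 3 \<Rightarrow> ('a ^ 3) set \<Rightarrow> ('a ^ 3) set" where
  "projectivity A P = (\<lambda>v. A *v v) ` P"

definition subfield_points :: "'a set \<Rightarrow> ('a::{field,finite} ^ 3) set set" where
  "subfield_points K = {P \<in> pg_points. \<exists>v\<in>P. v \<noteq> 0 \<and> (\<forall>i. v $ i \<in> K)}"

definition baer_subplane :: "nat \<Rightarrow> ('a::{field,finite} ^ 3) set set \<Rightarrow> bool" where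
  "baer_subplane r B \<longleftrightarrow> r\<^sup>2 = CARD('a)
     \<and> (\<exists>(K :: 'a set) (A :: 'a ^ 3 ^ 3).
          subfield K (ring_of_type_algebra :: 'a ring) \<and> card K = r \<and> invertible A
          \<and> B = projectivity A ` subfield_points K)"

definition baer_lines :: "nat \<Rightarrow> ('a::{field,finite} ^ 3) set set \<Rightarrow> ('a ^ 3) set set" where
  "baer_lines r B = {L \<in> pg_lines. card (points_on B L) = r + 1}"

(* For q = 3 there are further line partitions of the internal points: the three sides of a triangle
   inscribed in the conic.  Indeed, if A, B, C, D are the four points of the conic, the three internal
   points are AB \<inter> CD, AC \<inter> BD and AD \<inter> BC, and each is on exactly one of AB, AC, BC.  The
   classification into pencils and Baer subplanes therefore needs q \<noteq> 3. *)

end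

theory Submission
  imports Defs "HOL-Computational_Algebra.Polynomial_Factorial" "HOL-Computational_Algebra.Nth_Powers"
    "HOL-Analysis.Determinants"
begin

text \<open>
  In suitable coordinates the conic is y^2 = x z, with the points (t^2, t, 1) and (1, 0, 0). A line
  a x + 2 b y + c z = 0 meets it in the roots of Q = a t^2 + 2 b t + c, so the line is tangent iff
  b^2 = a c, and the point (x, y, 1) is internal iff the quadratic t^2 - 2 y t + x is irreducible.
  The roots of that quadratic are conjugate elements u and u^q of GF(q^2), with u + u^q = 2 y and
  u u^q = x. Hence the internal point lies on the line iff u is a root of
  F = a t^(q+1) + b (t^q + t) + c: every element of GF(q^2) outside GF(q) is a root of F for exactly
  one line of the partition, and the elements of GF(q) are roots of F exactly when they are roots of Q.
  Counting internal points leaves two possibilities: q - 1 lines, half of them secants, or q lines,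
  all of them secants. A comparison of degrees then gives \<open>product_identity\<close>: the product of the
  polynomials F is a constant multiple of G D, where G is the product of the Q of the secants and
  D = (t^(q^2) - t) / (t^q - t) is the product of all irreducible monic quadratics.

  The decisive step makes this one-variable identity two-dimensional. The product of the F is the
  restriction to the curve y = t^q of the symmetric polynomial P(t, y), the product of the factors
  a t y + b (t + y) + c, whose degree in each variable is at most the number of lines. A symmetric
  or antisymmetric polynomial of degree at most q in each variable is determined by its restriction
  to that curve (\<open>frobenius_curve_vanishing\<close>), because the exponents j q + k expose its coefficients
  as digits in base q. So P is known explicitly. With L the product of the a t + b,
    (t - y) P = (t - y^q) L(t) + (t^q - y) L(y)  if there are q - 1 lines, some of them through (1, 0, 0),
    P = (y^q - t) L(t) + (t^q - y) L(y)  if there are q lines, at least two of them through (1, 0, 0),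
                                           and every conic point lies on one of them.

  Substituting y = w - t shows that the lines 2 b y + c z = 0 through (1, 0, 0) correspond to the w
  with L(w - t) = - L(t), respectively L(w - t) = L(t). These w form a coset of the group V of
  translations that fix L, so the number k of these lines divides q when it is not 0. Substituting
  y = z for a root z of L shows that all roots of L have the same multiplicity, k or k - 1. With q - 1
  lines, k also divides deg L = q - 1 - k. Then k = 1, L has q - 2 simple roots, and the two non-roots
  are the points of contact of the two tangents through a common point of all lines
  (\<open>half_case\<close>). With q lines, either L is constant and all lines pass through (1, 0, 0), or a root
  of L is the centre of k - 1 dilations that permute the roots. These act on V and make V a line over
  a subfield K with |K|^2 = q, the roots of L are a translate of V, and all lines have coordinates
  in K (\<open>full_case_at_inf\<close>).

  With q lines it remains to exclude a conic point on no line. Values and derivatives in the product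
  identity show that then no conic point lies on exactly one line. If a point lies on m > 1 lines,
  comparing coefficients of P and of G D gives (m choose j) = m for 0 < j < m and 2^m = 1 in the
  field, which leaves m = 2 in characteristic 3 and m = 3 in characteristic 7. Both contradict the
  number of incidences between lines and conic points (\<open>no_simple_point_impossible\<close>).

  Back in the plane, a pencil that contains the partition equals it up to tangents, because every
  nontangent line of the pencil has an internal point (\<open>pencil_partition\<close>). In the Baer case two lines over
  K meet in a point over K, and such a point is not internal since every element of K is a square in
  the large field. So no two nontangent lines of the subplane share an internal point, and all of
  them belong to the partition (\<open>baer_case\<close>).
\<close>

section \<open>Squares in a finite field of odd order\<close>

locale odd_field =
  fixes q :: nat and T :: "'a::{field,finite} itself"
  assumes q_card: "q = CARD('a)"
    and q_power: "\<exists>n. q = CHAR('a) ^ n"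
    and two_nonzero: "(2::'a) \<noteq> 0"
    and q_gt_3: "q > 3"
begin

lemma pow_q [simp]: "(x::'a) ^ q = x"
proof (cases "x = 0")
  case False
  have "x * (\<Prod>y\<in>UNIV-{0}. x * y) = x ^ Suc (card (UNIV - {0::'a})) * \<Prod>(UNIV-{0})"
    by (simp only: prod.distrib prod_constant power_Suc mult.assoc)
  also have "Suc (card (UNIV - {0::'a})) = q"
    using q_gt_3 q_card by (simp add: card_Diff_singleton)
  also have "(\<Prod>y\<in>UNIV-{0}. x * y) = (\<Prod>y\<in>UNIV-{0}. y)"
    by (rule prod.reindex_bij_witness[of _ "\<lambda>y. y / x" "\<lambda>y. x * y"]) (use False in auto)
  finally show ?thesis
    by simp
qed (use q_gt_3 in auto)

lemma prime_char: "prime CHAR('a)"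
  by (rule prime_CHAR_semidom) (simp add: finite_imp_CHAR_pos)

lemma frob_add: "(f + g :: 'a poly) ^ q = f ^ q + g ^ q"
  using q_power prime_char by (metis freshmans_dream' semiring_char_poly)

lemma frob_diff: "(f - g :: 'a poly) ^ q = f ^ q - g ^ q"
  using frob_add[of "f - g" g] by simp

lemma odd_q: "odd q"
proof
  assume "even q"
  then have "even CHAR('a)" using q_power by (auto simp: prime_dvd_power)
  then have "CHAR('a) = 2" using prime_char
    by (metis primes_dvd_imp_eq two_is_prime_nat)
  then have "(of_nat 2 :: 'a) = 0" by (metis of_nat_CHAR)
  then show False using two_nonzero by simp
qed

lemma of_nat_q [simp]: "(of_nat q :: 'a) = 0"
proof -
  obtain n where n: "q = CHAR('a) ^ n" using q_power by blast
  then have "n \<noteq> 0" using q_gt_3 by (cases n) auto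
  then show ?thesis using n by (simp add: zero_power)
qed

lemma roots_of_square: "card {v::'a. v\<^sup>2 = s} = (if s = 0 then 1 else if is_square s then 2 else 0)"
proof (cases "is_square s")
  case True
  then obtain w where w: "s = w\<^sup>2" by (auto simp: is_nth_power_def)
  then have "{v. v\<^sup>2 = s} = {w, -w}" by (auto simp: power2_eq_iff)
  moreover have "w = -w \<longleftrightarrow> w = 0"
    by (metis add_eq_0_iff mult_2 mult_eq_0_iff two_nonzero)
  ultimately show ?thesis using w True by (auto simp: card_insert_if)
next
  case False
  then have "{v. v\<^sup>2 = s} = {}" "s \<noteq> 0" by (auto simp: is_nth_power_def)
  then show ?thesis using False by simp
qed

lemma card_fibres: "(\<Sum>s\<in>UNIV. card {w::'a. f w = (s::'a)}) = q"
proof -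
  have "(\<Union>s. {w. f w = s}) = UNIV" by auto
  then have "q = card (\<Union>s. {w. f w = s})" using q_card by simp
  also have "\<dots> = (\<Sum>s\<in>UNIV. card {w. f w = s})"
    by (rule card_UN_disjoint) auto
  finally show ?thesis by simp
qed

lemma card_squares: "2 * card {s::'a. is_square s} = q + 1"
proof -
  let ?S = "{s::'a. is_square s}"
  have "q = (\<Sum>s\<in>(UNIV::'a set). if s = 0 then 1 else if is_square s then 2 else 0)"
    using card_fibres[of "\<lambda>w. w\<^sup>2"] unfolding roots_of_square by simp
  also have "\<dots> = (\<Sum>s\<in>?S. if s = 0 then 1 else 2)"
    by (rule sum.mono_neutral_cong_right) (auto simp: is_nth_power_def)
  also have "\<dots> = (\<Sum>s\<in>insert 0 (?S - {0}). if s = 0 then 1 else 2)"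
    by (rule sum.cong) (auto simp: is_nth_power_def)
  also have "\<dots> = 1 + (\<Sum>s\<in>?S - {0}. if s = 0 then 1 else 2)"
    by (subst sum.insert) auto
  also have "(\<Sum>s\<in>?S - {0}. if s = 0 then 1 else 2) = (\<Sum>s\<in>?S - {0}. 2::nat)"
    by (rule sum.cong) auto
  also have "\<dots> = 2 * card (?S - {0})" by simp
  also have "card (?S - {0}) = card ?S - 1"
    by (subst card_Diff_singleton) (auto simp: is_nth_power_def)
  finally show ?thesis
    using card_gt_0_iff[of ?S] by (auto simp: is_nth_power_def)
qed

lemma euler_nonsquare:
  assumes "\<not> is_square (d::'a)"
  shows "d ^ ((q - 1) div 2) = -1"
proof -
  let ?h = "(q - 1) div 2" and ?S = "{s::'a. is_square s} - {0}"
  have d0: "d \<noteq> 0" using assms by (metis is_nth_power_def zero_eq_power2)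
  have pow1: "x ^ (q - 1) = 1" if "x \<noteq> 0" for x :: 'a
  proof -
    have "x * x ^ (q - 1) = x ^ q" using q_gt_3 by (simp flip: power_Suc)
    then show ?thesis using that by simp
  qed
  have h2: "2 * ?h = q - 1" using odd_q by simp
  have "(d ^ ?h)\<^sup>2 = d ^ (2 * ?h)" by (simp only: power_mult[symmetric] mult.commute)
  then have "(d ^ ?h)\<^sup>2 = 1" using pow1[OF d0] h2 by simp
  then consider "d ^ ?h = 1" | "d ^ ?h = -1" using power2_eq_1_iff by blast
  then show ?thesis
  proof cases
    case 1
    let ?p = "monom 1 ?h - 1 :: 'a poly"
    have h0: "?h > 0" using q_gt_3 by simp
    have "coeff ?p ?h = 1" using h0 by (simp add: coeff_1)
    then have p0: "?p \<noteq> 0" by (metis coeff_0 zero_neq_one)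
    have deg: "degree ?p \<le> ?h" by (rule degree_diff_le) (auto simp: degree_monom_le)
    have "s ^ ?h = 1" if "s \<in> ?S" for s
    proof -
      obtain w where "s = w\<^sup>2" "w \<noteq> 0" using \<open>s \<in> ?S\<close> by (auto simp: is_nth_power_def)
      then have "s ^ ?h = w ^ (2 * ?h)" by (simp only: power_mult)
      then show ?thesis using pow1[of w] h2 \<open>w \<noteq> 0\<close> by simp
    qed
    then have "insert d ?S \<subseteq> {x. x ^ ?h = 1}" using 1 by blast
    also have "\<dots> = {x. poly ?p x = 0}" by (simp add: poly_monom)
    finally have sub: "insert d ?S \<subseteq> {x. poly ?p x = 0}" .
    have "card (insert d ?S) \<le> card {x. poly ?p x = 0}"
      by (rule card_mono[OF poly_roots_finite[OF p0] sub])
    also have "\<dots> \<le> ?h" using card_poly_roots_bound[OF p0] deg by simp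
    finally have "card (insert d ?S) \<le> ?h" .
    moreover have "card (insert d ?S) = Suc (card ?S)" using assms by (subst card_insert_disjoint) auto
    moreover have "card ?S = card {s::'a. is_square s} - 1"
      by (subst card_Diff_singleton) (auto simp: is_nth_power_def)
    ultimately show ?thesis using card_squares h2 by linarith
  qed
qed

text \<open>
  The hyperbola w^2 - v^2 = d has q - 1 points, parametrised by w + v. Sorting them by w counts
  the w for which w^2 - d is a square.
\<close>

lemma card_nonsquare_values:
  assumes "(d::'a) \<noteq> 0"
  shows "2 * card {w. \<not> is_square (w\<^sup>2 - d)} + card {w. w\<^sup>2 = d} = q + 1"
proof -
  let ?A = "{w. \<not> is_square (w\<^sup>2 - d)}" and ?B = "{w. w\<^sup>2 = d}"
    and ?C = "{w. is_square (w\<^sup>2 - d) \<and> w\<^sup>2 \<noteq> d}"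
  let ?X = "{(w, v). w\<^sup>2 - v\<^sup>2 = d}"
  have "card ?X = card (UNIV - {0::'a})"
  proof (rule bij_betw_same_card[OF bij_betwI[where g = "\<lambda>x. ((x + d / x) / 2, (x - d / x) / 2)"]])
    show "(\<lambda>(w, v). w + v) \<in> ?X \<rightarrow> UNIV - {0}"
      using assms by (auto simp: add_eq_0_iff)
    show "(\<lambda>x. ((x + d / x) / 2, (x - d / x) / 2)) \<in> UNIV - {0} \<rightarrow> ?X"
    proof (clarsimp, goal_cases)
      case (1 x)
      have "((x + d / x) / 2)\<^sup>2 - ((x - d / x) / 2)\<^sup>2
        = (((x + d / x) / 2) + ((x - d / x) / 2)) * (((x + d / x) / 2) - ((x - d / x) / 2))"
        by (simp only: power2_eq_square square_diff_square_factored)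
      also have "((x + d / x) / 2) + ((x - d / x) / 2) = x" using two_nonzero
        by (simp add: add_divide_distrib[symmetric])
      also have "((x + d / x) / 2) - ((x - d / x) / 2) = d / x" using two_nonzero
        by (simp add: diff_divide_distrib[symmetric])
      finally show ?case using 1 by simp
    qed
    fix z assume z: "z \<in> ?X"
    obtain w v where wv: "z = (w, v)" by (cases z)
    have e: "(w + v) * (w - v) = d" using z wv by (simp add: algebra_simps power2_eq_square)
    then have nz: "w + v \<noteq> 0" using assms by auto
    have dv: "d / (w + v) = w - v" using e nz by (metis nonzero_mult_div_cancel_left)
    have "(w + v + (w - v)) / 2 = w" "(w + v - (w - v)) / 2 = v"
      using two_nonzero by (simp_all add: mult_2[symmetric])
    then show "(\<lambda>x. ((x + d / x) / 2, (x - d / x) / 2)) ((\<lambda>(w, v). w + v) z) = z"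
      using wv dv by simp
  next
    fix x assume "x \<in> UNIV - {0::'a}"
    show "(\<lambda>(w, v). w + v) ((x + d / x) / 2, (x - d / x) / 2) = x"
      using two_nonzero by (simp add: add_divide_distrib[symmetric] mult_2[symmetric])
  qed
  then have "q = Suc (card ?X)" using q_card q_gt_3 by (simp add: card_Diff_singleton)
  moreover have "card ?X = (\<Sum>w\<in>UNIV. card {v. v\<^sup>2 = w\<^sup>2 - d})"
  proof -
    have "?X = Sigma UNIV (\<lambda>w. {v. v\<^sup>2 = w\<^sup>2 - d})" by (auto simp: algebra_simps)
    then show ?thesis by simp
  qed
  moreover have "\<dots> = (\<Sum>w\<in>UNIV. (if w \<in> ?B then 1 else 0) + (if w \<in> ?C then 2 else 0))"
    unfolding roots_of_square by (rule sum.cong) auto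
  moreover have "\<dots> = card ?B + 2 * card ?C"
    unfolding sum.distrib by (simp add: sum.If_cases)
  moreover have "q = card ?A + card ?B + card ?C"
  proof -
    have "UNIV = ?A \<union> (?B \<union> ?C)" by (auto simp: is_nth_power_def)
    then have "q = card (?A \<union> (?B \<union> ?C))" using q_card by simp
    also have "\<dots> = card ?A + card (?B \<union> ?C)"
      by (rule card_Un_disjoint) (auto simp: is_nth_power_def)
    also have "card (?B \<union> ?C) = card ?B + card ?C"
      by (rule card_Un_disjoint) auto
    finally show ?thesis by simp
  qed
  ultimately show ?thesis by linarith
qed

end

section \<open>The product of the irreducible monic quadratics\<close>

lemma prime_elem_dvd_prodD:
  assumes "prime_elem p" "p dvd prod f A"
  shows "\<exists>x\<in>A. p dvd f x"
  using assms(2)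
  by (induction A rule: infinite_finite_induct)
    (use assms(1) in \<open>auto simp: prime_elem_dvd_mult_iff dest: prime_elem_not_unit\<close>)

lemma lead_coeff_diff:
  fixes f g :: "'b::ab_group_add poly"
  assumes "degree g < degree f"
  shows "degree (f - g) = degree f" "lead_coeff (f - g) = lead_coeff f"
proof -
  show d: "degree (f - g) = degree f"
    using degree_add_eq_left[of "- g" f] assms by simp
  show "lead_coeff (f - g) = lead_coeff f" unfolding d using assms by (simp add: coeff_eq_0)
qed

lemma prod_primes_dvd:
  fixes f :: "'b \<Rightarrow> 'c::algebraic_semidom"
  assumes "finite A" "\<And>x. x \<in> A \<Longrightarrow> prime_elem (f x)" "\<And>x. x \<in> A \<Longrightarrow> f x dvd p"
    and "\<And>x y. x \<in> A \<Longrightarrow> y \<in> A \<Longrightarrow> x \<noteq> y \<Longrightarrow> \<not> f x dvd f y"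
  shows "prod f A dvd p"
  using assms
proof (induction A)
  case (insert x A)
  from insert have "prod f A dvd p" by blast
  then obtain r where r: "p = prod f A * r" ..
  have x: "prime_elem (f x)" "f x dvd prod f A * r" using insert.prems r by auto
  moreover have "\<not> f x dvd prod f A"
    using prime_elem_dvd_prodD[OF x(1)] insert by blast
  ultimately have "f x dvd r" using prime_elem_dvd_multD by blast
  then show ?case using insert r by (simp add: mult.commute mult_dvd_mono)
qed simp

lemma monic_dvd_imp_eq:
  fixes f g :: "'b::field poly"
  assumes "f dvd g" "lead_coeff f = 1" "lead_coeff g = 1" "degree f = degree g"
  shows "f = g"
proof -
  obtain r where r: "g = f * r" using assms(1) ..
  have nz: "f \<noteq> 0" "r \<noteq> 0" using assms(2,3) r by auto
  then have "degree r = 0" using assms(4) r by (simp add: degree_mult_eq)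
  then obtain e where "r = [:e:]" by (metis degree_eq_zeroE)
  moreover have "lead_coeff r = 1" using assms(2,3) r by (simp add: lead_coeff_mult)
  ultimately show ?thesis using r by simp
qed

lemma prime_elem_linear: "prime_elem [:-u, 1 :: 'b::field:]"
  by (rule field_poly_irreducible_imp_prime, rule irreducible_linear_field_poly) auto

lemma prime_elem_quadratic:
  fixes f :: "'b::field poly"
  assumes deg: "degree f = 2" and nr: "\<And>u. poly f u \<noteq> 0"
  shows "prime_elem f"
proof (rule field_poly_irreducible_imp_prime, rule irreducibleI)
  show "f \<noteq> 0" using deg by auto
  show "\<not> f dvd 1" using deg by (simp add: is_unit_iff_degree \<open>f \<noteq> 0\<close>)
  fix g h assume gh: "f = g * h"
  then have nz: "g \<noteq> 0" "h \<noteq> 0" using \<open>f \<noteq> 0\<close> by auto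
  have no1: "degree r \<noteq> 1" if "r dvd f" for r
  proof
    assume "degree r = 1"
    then obtain s t where r: "r = [:s, t:]" "t \<noteq> 0"
      by (metis degree1_coeffs)
    then have "poly r (- s / t) = 0" by simp
    then show False using that nr by (metis dvdE mult_zero_left poly_mult)
  qed
  have "degree g + degree h = 2" using gh deg nz by (simp add: degree_mult_eq)
  moreover have "degree g \<noteq> 1" "degree h \<noteq> 1" using no1 gh by auto
  ultimately have "degree g = 0 \<or> degree h = 0" by linarith
  then show "g dvd 1 \<or> h dvd 1" using nz by (simp add: is_unit_iff_degree)
qed

context odd_field
begin

text \<open>
  The polynomial whose roots are the elements of the field, each once.
\<close>

definition theta :: "'a poly" where "theta = monom 1 q - [:0, 1:]"

text \<open>
  The quotient (t^(q^2) - t) / (t^q - t), written as a geometric sum in t^(q-1).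
\<close>

definition Dpoly :: "'a poly" where "Dpoly = (\<Sum>i<Suc q. monom 1 (q - 1) ^ i)"

text \<open>
  The pair (x, y) stands for the internal point (x, y, 1) of the conic y^2 = x z. All internal points
  have this form, since y^2 - x z is a square when z = 0.
\<close>

definition J :: "('a \<times> 'a) set" where "J = {(x, y). \<not> is_square (y\<^sup>2 - x)}"

definition quad :: "'a \<times> 'a \<Rightarrow> 'a poly" where "quad = (\<lambda>(x, y). [:x, -2 * y, 1:])"

lemma lead_coeff_prod_linear:
  "lead_coeff (\<Prod>u\<in>A. [:-u, 1 :: 'a:]) = 1" "degree (\<Prod>u\<in>A. [:-u, 1 :: 'a:]) = card A"
  by (subst lead_coeff_prod, simp) (simp add: degree_prod_eq_sum_degree)

lemma degree_theta: "degree theta = q" and lead_coeff_theta: "lead_coeff theta = 1"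
proof -
  have "degree [:0, 1 :: 'a:] < degree (monom 1 q :: 'a poly)"
    using q_gt_3 by (simp add: degree_monom_eq)
  from lead_coeff_diff[OF this] show "degree theta = q" "lead_coeff theta = 1"
    unfolding theta_def by (simp_all add: degree_monom_eq lead_coeff_monom)
qed

lemma prod_linear: "(\<Prod>u\<in>UNIV. [:-u, 1:]) = theta"
proof (rule monic_dvd_imp_eq)
  show "(\<Prod>u\<in>UNIV. [:-u, 1 :: 'a:]) dvd theta"
  proof (rule prod_primes_dvd)
    fix u v :: 'a assume "u \<noteq> v"
    then show "\<not> [:-u, 1:] dvd [:-v, 1:]" by (simp add: poly_eq_0_iff_dvd[symmetric])
  qed (auto simp: prime_elem_linear poly_eq_0_iff_dvd[symmetric] theta_def poly_monom)
  show "degree (\<Prod>u\<in>UNIV. [:-u, 1 :: 'a:]) = degree theta"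
    by (simp only: lead_coeff_prod_linear degree_theta) (rule q_card[symmetric])
qed (fact lead_coeff_prod_linear lead_coeff_theta)+

lemma theta_dvdI:
  assumes "\<And>u. poly f u = 0"
  shows "theta dvd f"
  unfolding prod_linear[symmetric]
proof (rule prod_primes_dvd)
  fix u v :: 'a assume "u \<noteq> v"
  then show "\<not> [:-u, 1:] dvd [:-v, 1:]" by (simp add: poly_eq_0_iff_dvd[symmetric])
qed (auto simp: prime_elem_linear poly_eq_0_iff_dvd[symmetric] assms)

lemma degree_quad: "degree (quad s) = 2" and lead_coeff_quad: "lead_coeff (quad s) = 1"
  by (cases s; simp add: quad_def)+

lemma poly_quad: "poly (quad (x, y)) u = (u - y)\<^sup>2 - (y\<^sup>2 - x)"
  by (simp add: quad_def algebra_simps power2_eq_square)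

lemma quad_prime: assumes "s \<in> J" shows "prime_elem (quad s)"
proof (rule prime_elem_quadratic[OF degree_quad])
  fix u
  obtain x y where s: "s = (x, y)" by (cases s)
  have "y\<^sup>2 - x \<noteq> (u - y)\<^sup>2" using assms s by (auto simp: J_def is_nth_power_def)
  then show "poly (quad s) u \<noteq> 0" unfolding s poly_quad by simp
qed

lemma quad_not_dvd: assumes "s \<noteq> s'" shows "\<not> quad s dvd quad s'"
proof
  assume "quad s dvd quad s'"
  then have "quad s = quad s'"
    by (rule monic_dvd_imp_eq[OF _ lead_coeff_quad lead_coeff_quad]) (simp only: degree_quad)
  then show False using assms two_nonzero by (auto simp: quad_def split: prod.splits)
qed

text \<open>
  A root u of the quadratic satisfies u^q = 2 y - u: by Euler's criterion the Frobenius map exchanges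
  the two square roots of the nonsquare y^2 - x.
\<close>

lemma quad_dvd_frobenius:
  assumes "(x, y) \<in> J"
  shows "quad (x, y) dvd monom 1 q + [:0, 1:] - [:2 * y:]"
proof -
  define U h d where "U = [:-y, 1:]" and "h = (q - 1) div 2" and "d = y\<^sup>2 - x"
  have f: "quad (x, y) = U\<^sup>2 - [:d:]"
    by (simp add: quad_def U_def d_def power2_eq_square)
  have "U\<^sup>2 - [:d:] dvd (U\<^sup>2) ^ h - [:d:] ^ h"
    unfolding power_diff_sumr2 by (rule dvd_triv_left)
  moreover have "[:d:] ^ h = [:d ^ h:]" by (rule poly_const_pow)
  moreover have "d ^ h = -1"
    using euler_nonsquare[of d] assms by (simp add: J_def d_def h_def)
  moreover have "(U\<^sup>2) ^ h - [:-1:] = (U\<^sup>2) ^ h + 1" by (simp add: one_pCons)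
  ultimately have "quad (x, y) dvd (U\<^sup>2) ^ h + 1" unfolding f by (simp only:)
  then have "quad (x, y) dvd U * ((U\<^sup>2) ^ h + 1)" by (rule dvd_mult)
  also have "U * ((U\<^sup>2) ^ h + 1) = U ^ Suc (2 * h) + U"
    by (simp only: power_mult power_Suc distrib_left mult_1_right)
  also have "Suc (2 * h) = q" using odd_q by (simp add: h_def)
  also have "U ^ q = ([:0, 1:] - [:y:]) ^ q" by (simp add: U_def)
  also have "\<dots> = [:0, 1:] ^ q - [:y:] ^ q" by (rule frob_diff)
  also have "[:0, 1:] ^ q = monom (1::'a) q" by (simp add: monom_altdef)
  also have "[:y:] ^ q = [:y:]" by (simp add: poly_const_pow)
  also have "monom 1 q - [:y:] + U = monom 1 q + [:0, 1:] - [:2 * y:]" by (simp add: U_def)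
  finally show ?thesis .
qed

lemma theta_Dpoly: "theta * Dpoly = monom 1 (q * q) - [:0, 1:]"
proof -
  have t: "theta = [:0, 1:] * (monom 1 (q - 1) - 1)"
    using q_gt_3 by (simp add: theta_def algebra_simps flip: monom_Suc monom_altdef)
  have "(monom 1 (q - 1) - 1) * Dpoly = monom (1::'a) (q - 1) ^ Suc q - 1"
    unfolding Dpoly_def by (rule power_diff_1_eq[symmetric])
  also have "monom (1::'a) (q - 1) ^ Suc q = monom 1 ((q - 1) * Suc q)"
    by (simp only: monom_power power_one)
  finally have "theta * Dpoly = [:0, 1:] * (monom 1 ((q - 1) * Suc q) - 1)"
    unfolding t by (simp only: mult.assoc)
  also have "\<dots> = monom 1 (Suc ((q - 1) * Suc q)) - [:0, 1:]"
    by (simp add: algebra_simps monom_Suc)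
  also have "Suc ((q - 1) * Suc q) = q * q" using q_gt_3
    by (cases q) (auto simp: algebra_simps)
  finally show ?thesis .
qed

text \<open>
  The roots of the quadratic are fixed by the square of the Frobenius map but not by the map itself.
\<close>

lemma quad_dvd_Dpoly:
  assumes "s \<in> J" shows "quad s dvd Dpoly"
proof -
  obtain x y where s: "s = (x, y)" by (cases s)
  let ?f = "quad (x, y)"
  obtain r where r: "monom 1 q + [:0, 1:] - [:2 * y:] = ?f * r"
    using quad_dvd_frobenius assms s by blast
  have "monom 1 q = [:2 * y:] - [:0, 1:] + (monom 1 q + [:0, 1:] - [:2 * y:])"
    by (simp only: algebra_simps)
  then have e: "monom 1 q = [:2 * y:] - [:0, 1:] + ?f * r" unfolding r .
  have "monom 1 (q * q) = (monom 1 q :: 'a poly) ^ q" by (simp add: monom_power)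
  also have "\<dots> = [:2 * y:] ^ q - [:0, 1:] ^ q + (?f * r) ^ q"
    by (simp only: e frob_add frob_diff)
  also have "[:2 * y:] ^ q = [:2 * y:]" by (simp add: poly_const_pow)
  also have "[:0, 1:] ^ q = monom (1::'a) q" by (simp add: monom_altdef)
  finally have p: "monom 1 (q * q) = [:2 * y:] - monom 1 q + (?f * r) ^ q" .
  have "f1 - f2 = - (f3 + f2 - f4) + f5" if "f1 = f4 - f3 + f5" for f1 f2 f3 f4 f5 :: "'a poly"
    using that by simp
  from this[OF p] have "monom 1 (q * q) - [:0, 1:]
    = - (monom 1 q + [:0, 1:] - [:2 * y:]) + (?f * r) ^ q" .
  then have "theta * Dpoly = - (?f * r) + (?f * r) ^ q" unfolding theta_Dpoly r .
  moreover have "?f dvd (?f * r) ^ q" using q_gt_3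
    by (metis dvd_power dvd_trans dvd_triv_left gr_implies_not0 neq0_conv)
  ultimately have "?f dvd theta * Dpoly" by simp
  moreover have "\<not> ?f dvd theta"
  proof
    assume "?f dvd theta"
    then obtain u where "?f dvd [:-u, 1:]"
      using prime_elem_dvd_prodD[OF quad_prime[OF assms]] s unfolding prod_linear[symmetric] by blast
    then have "degree ?f \<le> degree [:-u, 1:]" by (rule dvd_imp_degree_le) simp
    then show False by (simp add: degree_quad)
  qed
  ultimately show ?thesis using quad_prime[OF assms] s by (metis prime_elem_dvd_multD)
qed

lemma card_nonsquares: "2 * card {s::'a. \<not> is_square s} = q - 1"
proof -
  have "{s::'a. \<not> is_square s} = UNIV - {s. is_square s}" by auto
  then have "card {s::'a. \<not> is_square s} = q - card {s::'a. is_square s}"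
    using q_card by (simp add: card_Diff_subset)
  then show ?thesis using card_squares by simp
qed

lemma card_nonsquare_shift: "card {x. \<not> is_square ((y::'a) - x)} = card {s::'a. \<not> is_square s}"
  by (rule bij_betw_same_card[of "\<lambda>x. y - x"], rule bij_betwI[where g = "\<lambda>x. y - x"]) auto

lemma card_J: "2 * card J = q * (q - 1)"
proof -
  let ?S = "SIGMA y:(UNIV::'a set). {x. \<not> is_square (y\<^sup>2 - x)}"
  have "card J = card ?S"
    by (rule bij_betw_same_card[of prod.swap], rule bij_betwI[where g = prod.swap])
      (auto simp: J_def)
  also have "\<dots> = q * card {s::'a. \<not> is_square s}"
    by (simp add: card_nonsquare_shift q_card)
  finally show ?thesis using card_nonsquares by simp
qed

lemma degree_Dpoly: "degree Dpoly = q * (q - 1)" and lead_coeff_Dpoly: "lead_coeff Dpoly = 1"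
proof -
  have mn: "theta * Dpoly = monom 1 (q * q) - [:0, 1:]" by (rule theta_Dpoly)
  have "degree [:0, 1 :: 'a:] < degree (monom 1 (q * q) :: 'a poly)"
    using q_gt_3 less_1_mult[of q q] by (simp add: degree_monom_eq)
  note ld = lead_coeff_diff[OF this]
  then have d: "degree (theta * Dpoly) = q * q" and l: "lead_coeff (theta * Dpoly) = 1"
    unfolding mn ld by (simp_all add: degree_monom_eq lead_coeff_monom)
  have "theta * Dpoly \<noteq> 0" using d q_gt_3 by auto
  then have "degree (theta * Dpoly) = q + degree Dpoly" using degree_theta
    by (simp add: degree_mult_eq)
  then show "degree Dpoly = q * (q - 1)" using d by (simp add: algebra_simps)
  from l show "lead_coeff Dpoly = 1" by (simp add: lead_coeff_mult lead_coeff_theta)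
qed

lemma prod_quad: "prod quad J = Dpoly"
proof (rule monic_dvd_imp_eq)
  show "prod quad J dvd Dpoly"
    by (rule prod_primes_dvd) (auto simp: quad_prime quad_dvd_Dpoly quad_not_dvd)
  have nz: "quad s \<noteq> 0" for s using degree_quad[of s] by auto
  show "degree (prod quad J) = degree Dpoly"
    using card_J by (simp add: degree_prod_eq_sum_degree nz degree_quad degree_Dpoly)
  show "lead_coeff (prod quad J) = 1" by (subst lead_coeff_prod) (simp only: lead_coeff_quad prod.neutral_const)
qed (rule lead_coeff_Dpoly)

lemma poly_Dpoly [simp]: "poly Dpoly u = 1"
proof (cases "u = 0")
  case True
  have "poly Dpoly u = (\<Sum>i<Suc q. 0 ^ i)"
    using True q_gt_3 by (simp add: Dpoly_def poly_sum poly_monom zero_power)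
  also have "\<dots> = 1" by (simp only: sum.lessThan_Suc_shift) simp
  finally show ?thesis .
next
  case False
  have "u * u ^ (q - 1) = u" using q_gt_3 pow_q[of u] by (simp flip: power_Suc)
  then have "u ^ (q - 1) = 1" using False by simp
  then show ?thesis by (simp add: Dpoly_def poly_sum poly_monom)
qed

end

section \<open>Symmetric polynomials on the Frobenius curve\<close>

text \<open>
  Symmetric for e = 1 and antisymmetric for e = -1. A polynomial of type \<open>'b poly poly\<close> is read as a
  polynomial in y whose coefficients are polynomials in t.
\<close>

definition eps_symmetric :: "'b::comm_ring_1 \<Rightarrow> 'b poly poly \<Rightarrow> bool" where
  "eps_symmetric e f \<longleftrightarrow> (\<forall>j k. coeff (coeff f j) k = e * coeff (coeff f k) j)"

text \<open>
  The polarisation a t y + b (t + y) + c of the quadratic a t^2 + 2 b t + c.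
\<close>

definition bilin :: "'b \<Rightarrow> 'b \<Rightarrow> 'b \<Rightarrow> 'b::comm_ring_1 poly poly" where
  "bilin a b c = [:[:c, b:], [:b, a:]:]"

lemma symmetric_bilin: "eps_symmetric 1 (bilin a b c)"
  by (auto simp: eps_symmetric_def bilin_def coeff_pCons split: nat.splits)

lemma symmetric_mult:
  fixes f g :: "'b::comm_ring_1 poly poly"
  assumes "eps_symmetric 1 f" "eps_symmetric 1 g"
  shows "eps_symmetric 1 (f * g)"
proof -
  have e: "coeff (coeff (f * g) j) k
    = (\<Sum>i\<le>j. \<Sum>l\<le>k. coeff (coeff f i) l * coeff (coeff g (j - i)) (k - l))" for j k
    by (simp add: coeff_mult coeff_sum)
  show ?thesis unfolding eps_symmetric_def e mult_1_left
  proof (intro allI)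
    fix j k
    have "(\<Sum>i\<le>j. \<Sum>l\<le>k. coeff (coeff f i) l * coeff (coeff g (j - i)) (k - l))
      = (\<Sum>i\<le>j. \<Sum>l\<le>k. coeff (coeff f l) i * coeff (coeff g (k - l)) (j - i))"
      using assms by (intro sum.cong refl) (simp add: eps_symmetric_def)
    also have "\<dots> = (\<Sum>l\<le>k. \<Sum>i\<le>j. coeff (coeff f l) i * coeff (coeff g (k - l)) (j - i))"
      by (rule sum.swap)
    finally show "(\<Sum>i\<le>j. \<Sum>l\<le>k. coeff (coeff f i) l * coeff (coeff g (j - i)) (k - l))
      = (\<Sum>l\<le>k. \<Sum>i\<le>j. coeff (coeff f l) i * coeff (coeff g (k - l)) (j - i))" .
  qed
qed

lemma symmetric_prod:
  fixes f :: "'i \<Rightarrow> 'b::comm_ring_1 poly poly"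
  assumes "\<And>i. i \<in> A \<Longrightarrow> eps_symmetric 1 (f i)"
  shows "eps_symmetric 1 (prod f A)"
  using assms
proof (induction A rule: infinite_finite_induct)
  case (insert x F)
  then show ?case by (simp add: symmetric_mult)
qed (auto simp: eps_symmetric_def coeff_1 coeff_pCons one_pCons split: nat.splits)

lemma coeff_poly_monom:
  fixes f :: "'b::comm_ring_1 poly poly"
  assumes "degree f \<le> m"
  shows "coeff (poly f (monom 1 n)) s = (\<Sum>j\<le>m. if s < n * j then 0 else coeff (coeff f j) (s - n * j))"
proof -
  have "poly f (monom 1 n) = (\<Sum>j\<le>degree f. coeff f j * monom 1 n ^ j)"
    by (rule poly_altdef)
  also have "\<dots> = (\<Sum>j\<le>m. coeff f j * monom 1 n ^ j)"
    by (rule sum.mono_neutral_left) (use assms in \<open>auto simp: coeff_eq_0\<close>)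
  also have "\<dots> = (\<Sum>j\<le>m. monom 1 (n * j) * coeff f j)"
    by (simp add: monom_power mult.commute)
  finally show ?thesis by (simp add: coeff_sum coeff_monom_mult if_distrib cong: if_cong)
qed

text \<open>
  If f has degree at most n in t, the coefficients of f(t, t^n) at exponents that are not divisible by n
  are coefficients of f, read off from the digits of the exponent in base n. At the exponent n (j + 1)
  two coefficients of f collide, which is the carry treated next.
\<close>

lemma coeff_poly_monom_mid:
  fixes f :: "'b::comm_ring_1 poly poly"
  assumes "\<And>j. degree (coeff f j) \<le> n" "0 < k" "k < n"
  shows "coeff (poly f (monom 1 n)) (n * j + k) = coeff (coeff f j) k"
proof -
  let ?g = "\<lambda>i. if n * j + k < n * i then 0 else coeff (coeff f i) (n * j + k - n * i)"
  have "coeff (poly f (monom 1 n)) (n * j + k) = (\<Sum>i\<le>degree f + j. ?g i)"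
    by (rule coeff_poly_monom) simp
  also have "\<dots> = (\<Sum>i\<in>{j}. ?g i)"
  proof (rule sum.mono_neutral_right)
    show "\<forall>i\<in>{..degree f + j} - {j}. ?g i = 0"
    proof
      fix i assume "i \<in> {..degree f + j} - {j}"
      then consider "i < j" | "Suc j \<le> i" by fastforce
      then show "?g i = 0"
      proof cases
        case 1
        then have "n * Suc i \<le> n * j" by (intro mult_le_mono) auto
        then have "n * j + k - n * i > n" using assms(2) by simp
        then have "coeff (coeff f i) (n * j + k - n * i) = 0"
          using assms(1)[of i] by (intro coeff_eq_0) linarith
        then show ?thesis by simp
      next
        case 2
        then have "n * Suc j \<le> n * i" by (intro mult_le_mono) auto
        then show ?thesis using assms(3) by simp
      qed
    qed
  qed auto
  finally show ?thesis by simp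
qed

lemma coeff_poly_monom_carry:
  fixes f :: "'b::comm_ring_1 poly poly"
  assumes "\<And>j. degree (coeff f j) \<le> n" "0 < n"
  shows "coeff (poly f (monom 1 n)) (n * Suc j) = coeff (coeff f (Suc j)) 0 + coeff (coeff f j) n"
proof -
  let ?g = "\<lambda>i. if n * Suc j < n * i then 0 else coeff (coeff f i) (n * Suc j - n * i)"
  have "coeff (poly f (monom 1 n)) (n * Suc j) = (\<Sum>i\<le>degree f + Suc j. ?g i)"
    by (rule coeff_poly_monom) simp
  also have "\<dots> = (\<Sum>i\<in>{j, Suc j}. ?g i)"
  proof (rule sum.mono_neutral_right)
    show "\<forall>i\<in>{..degree f + Suc j} - {j, Suc j}. ?g i = 0"
    proof
      fix i assume "i \<in> {..degree f + Suc j} - {j, Suc j}"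
      then consider "Suc i \<le> j" | "Suc (Suc j) \<le> i" by fastforce
      then show "?g i = 0"
      proof cases
        case 1
        then have "n * Suc i \<le> n * j" by (intro mult_le_mono) auto
        then have "n * Suc j - n * i > n" using assms(2) by simp
        then have "coeff (coeff f i) (n * Suc j - n * i) = 0"
          using assms(1)[of i] by (intro coeff_eq_0) linarith
        then show ?thesis by simp
      next
        case 2
        then have "n * Suc (Suc j) \<le> n * i" by (intro mult_le_mono) auto
        then show ?thesis using assms(2) by simp
      qed
    qed
  qed auto
  finally show ?thesis by (simp add: add.commute)
qed

lemma coeff_poly_monom_0:
  fixes f :: "'b::comm_ring_1 poly poly"
  assumes "0 < n"
  shows "coeff (poly f (monom 1 n)) 0 = coeff (coeff f 0) 0"
proof -
  have "coeff (poly f (monom 1 n)) 0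
    = (\<Sum>i\<le>degree f. if 0 < n * i then 0 else coeff (coeff f i) (0 - n * i))"
    by (rule coeff_poly_monom) simp
  also have "\<dots> = (\<Sum>i\<in>{0}. coeff (coeff f i) 0)"
    by (rule sum.mono_neutral_cong_right) (use assms in auto)
  finally show ?thesis by simp
qed

lemma inner_degree_le:
  fixes f :: "'b::comm_ring_1 poly poly"
  assumes "eps_symmetric e f" "degree f \<le> n"
  shows "degree (coeff f j) \<le> n"
  by (rule degree_le) (use assms in \<open>auto simp: eps_symmetric_def coeff_eq_0\<close>)

text \<open>
  Only the coefficients at exponents 0 and n of t are not read off directly on the curve y = t^n. Symmetry
  exchanges them with coefficients that are, except for the four corners, and there the carries at both
  ends of the range involve a single unknown coefficient.
\<close>

lemma frobenius_curve_vanishing: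
  fixes f :: "'b::comm_ring_1 poly poly"
  assumes eps_sym: "eps_symmetric e f"
    and deg: "degree f \<le> n" and n: "n > 1"
    and zero: "poly f (monom 1 n) = 0"
  shows "f = 0"
proof -
  note d = inner_degree_le[OF eps_sym deg]
  have sym: "coeff (coeff f j) k = e * coeff (coeff f k) j" for j k
    using eps_sym unfolding eps_symmetric_def by blast
  have mid: "coeff (coeff f j) k = 0" if "0 < k" "k < n" for j k
    using coeff_poly_monom_mid[OF d that, of j] zero by simp
  then have mid': "coeff (coeff f j) k = 0" if "0 < j" "j < n" for j k
    using sym[of j k] that by simp
  \<comment> \<open>At the multiples of n two coefficients share an exponent.\<close>
  have carry: "coeff (coeff f (Suc j)) 0 + coeff (coeff f j) n = 0" for j
    using coeff_poly_monom_carry[OF d, of j] zero n by simp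
  have "coeff (coeff f 0) 0 = 0" using coeff_poly_monom_0[of n f] zero n by simp
  moreover have "coeff (coeff f 0) n = 0" using carry[of 0] mid'[of 1 0] n by simp
  moreover have "coeff (coeff f n) 0 = 0" using sym[of n 0] \<open>coeff (coeff f 0) n = 0\<close> by simp
  moreover have "coeff (coeff f n) n = 0"
  proof -
    have "coeff f (Suc n) = 0" using deg by (intro coeff_eq_0) simp
    then show ?thesis using carry[of n] by simp
  qed
  moreover have "coeff (coeff f j) k = 0" if "n < j \<or> n < k" for j k
    using that sym[of j k] deg by (auto simp: coeff_eq_0)
  ultimately have "coeff (coeff f j) k = 0" for j k
    using mid[of k j] mid'[of j k] by (metis gr0I linorder_neqE_nat)
  then show ?thesis by (intro poly_eqI) simp
qed

section \<open>The product identity of a line partition\<close>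

context odd_field
begin

text \<open>
  Restricted to the line, the condition that y^2 - x is a nonsquare becomes, up to a square factor,
  the condition that w^2 minus the discriminant of the line is a nonsquare.
\<close>

lemma card_internal_on_line:
  fixes a b c :: 'a
  assumes nontangent: "b\<^sup>2 \<noteq> a * c"
  shows "2 * card {(x, y) \<in> J. a * x + 2 * b * y + c = 0} = (if is_square (b\<^sup>2 - a * c) then q - 1 else q + 1)"
proof (cases "a = 0")
  case True
  define y0 where "y0 = - c / (2 * b)"
  have nz: "2 * b \<noteq> 0" using assms True two_nonzero by auto
  have eq: "a * x + 2 * b * y + c = 0 \<longleftrightarrow> y = y0" for x y
    unfolding y0_def nonzero_eq_divide_eq[OF nz] eq_neg_iff_add_eq_0
    using True by (simp add: mult.commute)
  have "{(x, y) \<in> J. a * x + 2 * b * y + c = 0} = (\<lambda>x. (x, y0)) ` {x. \<not> is_square (y0\<^sup>2 - x)}"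
    unfolding eq J_def by auto
  moreover have "card ((\<lambda>x. (x, y0)) ` M) = card M" for M :: "'a set"
    by (rule card_image) (auto simp: inj_on_def)
  ultimately show ?thesis
    using card_nonsquares True by (simp add: card_nonsquare_shift)
next
  case False
  let ?d = "(b\<^sup>2 - a * c) / a\<^sup>2"
  let ?x = "\<lambda>y. - (2 * b * y + c) / a"
  have d0: "?d \<noteq> 0" using nontangent False by simp
  have disc: "y\<^sup>2 - ?x y = (y + b / a)\<^sup>2 - ?d" for y
    using False by (simp add: field_simps power2_eq_square)
  have "{(x, y) \<in> J. a * x + 2 * b * y + c = 0}
    = (\<lambda>y. (?x y, y)) ` {y. \<not> is_square ((y + b / a)\<^sup>2 - ?d)}"
  proof -
    have "a * x + 2 * b * y + c = 0 \<longleftrightarrow> x = ?x y" for x y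
      unfolding nonzero_eq_divide_eq[OF False] eq_neg_iff_add_eq_0 by (simp add: algebra_simps)
    then show ?thesis unfolding J_def disc[symmetric] by auto
  qed
  moreover have "card ((\<lambda>y. (?x y, y)) ` M) = card M" for M
    by (rule card_image) (auto simp: inj_on_def)
  moreover have "card {y. \<not> is_square ((y + b / a)\<^sup>2 - ?d)} = card {w. \<not> is_square (w\<^sup>2 - ?d)}"
    by (rule bij_betw_same_card[of "\<lambda>y. y + b / a"],
        rule bij_betwI[where g = "\<lambda>y. y - b / a"]) auto
  moreover have "is_square ?d \<longleftrightarrow> is_square (b\<^sup>2 - a * c)"
  proof
    assume "is_square ?d"
    then obtain w where "?d = w\<^sup>2" by (auto simp: is_nth_power_def)
    then have "b\<^sup>2 - a * c = (w * a)\<^sup>2" using False by (simp add: field_simps)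
    then show "is_square (b\<^sup>2 - a * c)" by (metis is_nth_power_nth_power)
  next
    assume "is_square (b\<^sup>2 - a * c)"
    then obtain w where "b\<^sup>2 - a * c = w\<^sup>2" by (auto simp: is_nth_power_def)
    then have "?d = (w / a)\<^sup>2" by (simp add: power_divide)
    then show "is_square ?d" by (metis is_nth_power_nth_power)
  qed
  ultimately show ?thesis
    using card_nonsquare_values[OF d0] roots_of_square[of ?d] d0 by auto
qed

end

text \<open>
  A line partition in coordinates: the conic is y^2 = x z, line i is a x + 2 b y + c z = 0, a line is
  tangent iff b^2 = a c, and the internal points are those for which y^2 - x z is a nonsquare. Incidence
  says that the binary forms (a, b, c) and (z, -y, x) are apolar. The three coefficient functions on an
  abstract index set make it easy to pass to other coordinates.
\<close>

locale apolar_partition = odd_field q T for q and T :: "'a::{field,finite} itself" +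
  fixes I :: "'i set" and a b c :: "'i \<Rightarrow> 'a"
  assumes finite_I: "finite I"
    and nontangent: "i \<in> I \<Longrightarrow> (b i)\<^sup>2 \<noteq> a i * c i"
    and partition: "\<not> is_square (y\<^sup>2 - x * z) \<Longrightarrow>
      \<exists>!i. i \<in> I \<and> a i * x + 2 * b i * y + c i * z = 0"
begin

text \<open>
  The secants, that is the lines whose quadratic form is hyperbolic.
\<close>

definition hyp :: "'i set" where "hyp = {i \<in> I. is_square ((b i)\<^sup>2 - a i * c i)}"

text \<open>
  The roots of Q i are the parameters t of the conic points (t^2, t, 1) on line i.
\<close>

definition Q :: "'i \<Rightarrow> 'a poly" where "Q i = [:c i, 2 * b i, a i:]"

text \<open>
  This is a t^(q+1) + b (t^q + t) + c.
\<close>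

definition F :: "'i \<Rightarrow> 'a poly" where "F i = [:c i, b i:] + monom 1 q * [:b i, a i:]"

definition P :: "'a poly poly" where "P = (\<Prod>i\<in>I. bilin (a i) (b i) (c i))"

definition G :: "'a poly" where "G = (\<Prod>i\<in>hyp. Q i)"

text \<open>
  The number of lines through the conic point (1, 0, 0), whose parameter is infinity.
\<close>

definition k_inf :: nat where "k_inf = card {i \<in> I. a i = 0}"

lemma finite_hyp: "finite hyp" using finite_I by (simp add: hyp_def)

lemma symmetric_P: "eps_symmetric 1 P" unfolding P_def by (rule symmetric_prod) (rule symmetric_bilin)

lemma degree_P: "degree P \<le> card I"
proof -
  have "degree P \<le> (\<Sum>i\<in>I. degree (bilin (a i) (b i) (c i)))"
    using degree_prod_sum_le[OF finite_I, of "\<lambda>i. bilin (a i) (b i) (c i)"] by (simp add: P_def comp_def)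
  also have "\<dots> \<le> (\<Sum>i\<in>I. 1)" by (rule sum_mono) (simp add: bilin_def)
  finally show ?thesis by simp
qed

lemma poly_P: "poly P r = (\<Prod>i\<in>I. [:c i, b i:] + r * [:b i, a i:])"
  by (simp add: P_def poly_prod bilin_def)

lemma poly_P_frob: "poly P (monom 1 q) = prod F I"
  by (simp add: poly_P F_def)

lemma Q_nonzero: "i \<in> I \<Longrightarrow> Q i \<noteq> 0"
  using nontangent[of i] two_nonzero by (auto simp: Q_def)

lemma a_zero_b_nonzero: "i \<in> I \<Longrightarrow> a i = 0 \<Longrightarrow> b i \<noteq> 0"
  using nontangent[of i] by auto

lemma a_zero_hyp: "i \<in> I \<Longrightarrow> a i = 0 \<Longrightarrow> i \<in> hyp"
  by (auto simp: hyp_def is_nth_power_def)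

lemma degree_Q: "i \<in> I \<Longrightarrow> degree (Q i) = (if a i = 0 then 1 else 2)"
  using a_zero_b_nonzero[of i] two_nonzero by (simp add: Q_def)

lemma Q_linear:
  assumes "i \<in> I" "a i = 0"
  shows "Q i = smult (2 * b i) [:- (- c i / (2 * b i)), 1:]"
  using assms a_zero_b_nonzero[of i] two_nonzero by (simp add: Q_def)

lemma Q_split:
  assumes "i \<in> hyp" "a i \<noteq> 0"
  obtains u v where "u \<noteq> v" "Q i = smult (a i) ([:-u, 1:] * [:-v, 1:])"
proof -
  obtain w where w: "(b i)\<^sup>2 - a i * c i = w\<^sup>2"
    using assms(1) by (auto simp: hyp_def is_nth_power_def)
  have w0: "w \<noteq> 0" using w assms(1) nontangent[of i] by (auto simp: hyp_def)
  define u v where "u = (- b i + w) / a i" and "v = (- b i - w) / a i"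
  have "u - v = 2 * w / a i" by (simp add: u_def v_def diff_divide_distrib[symmetric])
  then have "u \<noteq> v" using w0 two_nonzero assms(2) by auto
  moreover have "2 * b i = - (a i * (u + v))"
    using assms(2) by (simp add: u_def v_def add_divide_distrib[symmetric])
  moreover have "a i * (u * v) = c i"
  proof -
    have "a i * (a i * (u * v)) = (- b i + w) * (- b i - w)"
      using assms(2) by (simp add: u_def v_def)
    also have "\<dots> = (b i)\<^sup>2 - w\<^sup>2" by (simp add: algebra_simps power2_eq_square)
    also have "\<dots> = a i * c i" using w by (simp add: algebra_simps)
    finally show ?thesis using assms(2) by simp
  qed
  moreover have "smult (a i) ([:-u, 1:] * [:-v, 1:]) = [:a i * (u * v), - (a i * (u + v)), a i:]"
    by (simp add: algebra_simps)
  ultimately show ?thesis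
    by (intro that[of u v]) (simp_all only: Q_def not_False_eq_True)
qed

lemma F_minus_Q: "F i = Q i + theta * [:b i, a i:]"
  by (simp add: F_def Q_def theta_def algebra_simps monom_altdef)

lemma Q_dvd_theta: assumes "i \<in> hyp" shows "Q i dvd theta"
proof (cases "a i = 0")
  case True
  have "i \<in> I" using assms by (simp add: hyp_def)
  have "[:- (- c i / (2 * b i)), 1:] dvd theta"
    unfolding poly_eq_0_iff_dvd[symmetric] by (simp add: theta_def poly_monom)
  moreover have "2 * b i \<noteq> 0" using a_zero_b_nonzero[OF \<open>i \<in> I\<close> True] two_nonzero by simp
  ultimately show ?thesis
    unfolding Q_linear[OF \<open>i \<in> I\<close> True] by (simp only: smult_dvd_iff if_False)
next
  case False
  obtain u v where uv: "u \<noteq> v" "Q i = smult (a i) ([:-u, 1:] * [:-v, 1:])"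
    using Q_split[OF assms False] .
  have "(\<Prod>w\<in>{u, v}. [:-w, 1:]) dvd (\<Prod>w\<in>UNIV. [:-w, 1::'a:])"
    by (rule prod_dvd_prod_subset) auto
  moreover have "(\<Prod>w\<in>{u, v}. [:-w, 1:]) = [:-u, 1:] * [:-v, 1:]" using uv(1) by simp
  ultimately have "[:-u, 1:] * [:-v, 1:] dvd theta" by (simp only: prod_linear)
  then show ?thesis unfolding uv(2) using False by (simp only: smult_dvd_iff if_False)
qed

text \<open>
  Modulo the quadratic of an internal point, t^q equals 2 y - t, which turns F into a multiple of the
  incidence condition.
\<close>

lemma quad_dvd_F:
  assumes "(x, y) \<in> J" "a i * x + 2 * b i * y + c i = 0"
  shows "quad (x, y) dvd F i"
proof -
  obtain r where r: "monom 1 q + [:0, 1:] - [:2 * y:] = quad (x, y) * r"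
    using quad_dvd_frobenius assms by blast
  have "f1 = (f1 + f2 - f3) - f2 + f3" for f1 f2 f3 :: "'a poly" by simp
  from this[of "monom 1 q" "[:0, 1:]" "[:2 * y:]"]
  have "F i = [:c i, b i:] + ((monom 1 q + [:0, 1:] - [:2 * y:]) - [:0, 1:] + [:2 * y:]) * [:b i, a i:]"
    unfolding F_def by (simp only:)
  also have "\<dots> = (monom 1 q + [:0, 1:] - [:2 * y:]) * [:b i, a i:] +
     ([:c i, b i:] + ([:2 * y:] - [:0, 1:]) * [:b i, a i:])" by (simp only: algebra_simps)
  also have "[:c i, b i:] + ([:2 * y:] - [:0, 1:]) * [:b i, a i:] = - smult (a i) (quad (x, y))"
    using assms(2) by (simp add: quad_def algebra_simps eq_neg_iff_add_eq_0)
  finally show ?thesis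
    unfolding r by (simp only: dvd_add dvd_minus_iff dvd_mult2 dvd_triv_left dvd_smult dvd_refl)
qed

lemma count_one:
  assumes "i \<in> I"
  shows "2 * card {(x, y) \<in> J. a i * x + 2 * b i * y + c i = 0} = (if i \<in> hyp then q - 1 else q + 1)"
  using card_internal_on_line[OF nontangent[OF assms]] assms by (simp add: hyp_def)

lemma count_total: "card hyp * (q - 1) + card (I - hyp) * (q + 1) = q * (q - 1)"
proof -
  let ?K = "\<lambda>i. {(x, y) \<in> J. a i * x + 2 * b i * y + c i = 0}"
  have one: "\<exists>!i. i \<in> I \<and> a i * x + 2 * b i * y + c i = 0" if "(x, y) \<in> J" for x y
    using partition[of y x 1] that by (simp add: J_def)
  then have "J = (\<Union>i\<in>I. ?K i)" by fast
  moreover have "card (\<Union>i\<in>I. ?K i) = (\<Sum>i\<in>I. card (?K i))"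
    by (rule card_UN_disjoint) (use finite_I one in \<open>auto\<close>)
  ultimately have "2 * card J = (\<Sum>i\<in>I. 2 * card (?K i))" by (simp add: sum_distrib_left)
  also have "\<dots> = (\<Sum>i\<in>I. if i \<in> hyp then q - 1 else q + 1)"
    by (rule sum.cong) (simp_all only: count_one)
  also have "\<dots> = card hyp * (q - 1) + card (I - hyp) * (q + 1)"
  proof -
    have "I \<inter> hyp = hyp" "I \<inter> - hyp = I - hyp" by (auto simp: hyp_def)
    then show ?thesis using finite_I by (simp add: sum.If_cases)
  qed
  finally show ?thesis using card_J by simp
qed

text \<open>
  With r = q - 1, and with h secants and e external lines, counting internal points gives
  (h + e) r + 2 e = (r + 1) r. Hence r divides 2 e, and 2 e is 0 or r.
\<close>

lemma hyperbolic_count_cases: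
  obtains (full) "hyp = I" "card I = q"
    | (half) "2 * card hyp = q - 1" "card I = q - 1"
proof -
  let ?h = "card hyp" and ?e = "card (I - hyp)"
  have hi: "hyp \<subseteq> I" by (auto simp: hyp_def)
  have cI: "card I = ?h + ?e"
    using card_Diff_subset[OF finite_hyp hi] card_mono[OF finite_I hi] by simp
  obtain r where r: "q = Suc r" using q_gt_3 by (cases q) auto
  have e: "?h * r + ?e * (r + 2) = (r + 1) * r" using count_total r by simp
  then have "(?h + ?e) * r + 2 * ?e = (r + 1) * r" by (simp add: algebra_simps)
  then have "r dvd 2 * ?e" by (metis dvd_add_right_iff dvd_triv_right)
  then obtain s where s: "2 * ?e = r * s" ..
  have "s < 2"
  proof (rule ccontr)
    assume "\<not> s < 2"
    then have "2 * r \<le> 2 * ?e" using s by simp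
    then have "r * (r + 2) \<le> ?e * (r + 2)" by (intro mult_le_mono1) linarith
    then have "r * (r + 2) \<le> (r + 1) * r" using e by linarith
    then show False using r q_gt_3 by simp
  qed
  then consider "s = 0" | "s = 1" by linarith
  then show thesis
  proof cases
    case 1
    then have e0: "?e = 0" using s by simp
    have "?h * r = (r + 1) * r" using e unfolding e0 by simp
    then have h: "?h = r + 1" using r q_gt_3 by (simp only: mult_cancel2) simp
    have "hyp = I" by (rule card_subset_eq[OF finite_I hi]) (use cI e0 in linarith)
    moreover have "card I = q" using cI e0 h r by linarith
    ultimately show ?thesis by (rule full)
  next
    case 2
    then have s2: "2 * ?e = r" using s by simp
    have "(?h + ?e) * r + r = (r + 1) * r" using e s2 by (simp add: algebra_simps)
    then have "(?h + ?e) * r = r * r" by simp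
    then have "?h + ?e = r" using r q_gt_3 by simp
    then show ?thesis using cI r s2 by (intro half) linarith+
  qed
qed

lemma degree_prod_F: "degree (prod F I) + k_inf = (q + 1) * card I" and prod_F_nonzero: "prod F I \<noteq> 0"
proof -
  have deg: "degree (F i) = (if a i = 0 then q else q + 1) \<and> F i \<noteq> 0" if "i \<in> I" for i
  proof -
    have nz: "[:b i, a i:] \<noteq> 0" using a_zero_b_nonzero[OF that] by auto
    have "degree (monom 1 q * [:b i, a i:]) = q + degree [:b i, a i:]"
      using nz by (subst degree_mult_eq) (auto simp: degree_monom_eq)
    then have "degree (F i) = q + degree [:b i, a i:]" unfolding F_def
      by (subst degree_add_eq_right) (use q_gt_3 in auto)
    moreover have "degree (F i) \<noteq> 0" using calculation q_gt_3 by simp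
    ultimately show ?thesis by auto
  qed
  then show nz: "prod F I \<noteq> 0" using finite_I by simp
  have "degree (prod F I) = (\<Sum>i\<in>I. degree (F i))"
    by (rule degree_prod_eq_sum_degree) (use deg in auto)
  also have "\<dots> = (\<Sum>i\<in>I. if a i = 0 then q else q + 1)" using deg by (intro sum.cong) auto
  finally have "degree (prod F I) + k_inf = (\<Sum>i\<in>I. (if a i = 0 then q else q + 1) + (if a i = 0 then 1 else 0))"
    unfolding sum.distrib k_inf_def using finite_I by (simp add: sum.If_cases Int_def)
  also have "\<dots> = (\<Sum>i\<in>I. q + 1)" by (rule sum.cong) auto
  finally show "degree (prod F I) + k_inf = (q + 1) * card I" by simp
qed

lemma degree_G: "degree G + k_inf = 2 * card hyp" and G_nonzero: "G \<noteq> 0"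
proof -
  have hI: "i \<in> I" if "i \<in> hyp" for i using that by (simp add: hyp_def)
  then show "G \<noteq> 0" using finite_hyp Q_nonzero by (simp add: G_def)
  have k: "k_inf = card {i \<in> hyp. a i = 0}"
    unfolding k_inf_def using a_zero_hyp hI by (intro arg_cong[where f = card]) auto
  have "degree G = (\<Sum>i\<in>hyp. degree (Q i))"
    unfolding G_def by (rule degree_prod_eq_sum_degree) (use hI Q_nonzero in auto)
  also have "\<dots> = (\<Sum>i\<in>hyp. if a i = 0 then 1 else 2)" using hI by (intro sum.cong) (simp_all add: degree_Q)
  finally have "degree G + k_inf = (\<Sum>i\<in>hyp. (if a i = 0 then 1 else 2) + (if a i = 0 then 1 else 0))"
    unfolding sum.distrib k using finite_hyp by (simp add: sum.If_cases Int_def)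
  also have "\<dots> = (\<Sum>i\<in>hyp. 2)" by (rule sum.cong) auto
  finally show "degree G + k_inf = 2 * card hyp" by simp
qed

text \<open>
  G and D divide the product of the F and are coprime, since the irreducible quadratics do not divide
  t^q - t. In both cases of the line count the degrees agree.
\<close>

lemma product_identity:
  obtains \<kappa> where "\<kappa> \<noteq> 0" "prod F I = smult \<kappa> (G * Dpoly)"
proof -
  have hI: "hyp \<subseteq> I" by (auto simp: hyp_def)
  have "G dvd prod F hyp" unfolding G_def
    by (rule prod_dvd_prod) (simp only: F_minus_Q Q_dvd_theta dvd_add dvd_refl dvd_mult2)
  also have "prod F hyp dvd prod F I" by (rule prod_dvd_prod_subset[OF finite_I hI])
  finally obtain R where R: "prod F I = G * R" ..
  have "prod quad J dvd R"
  proof (rule prod_primes_dvd)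
    fix s assume s: "s \<in> J"
    obtain x y where xy: "s = (x, y)" by (cases s)
    have pr: "prime_elem (quad s)" by (rule quad_prime[OF s])
    obtain i where i: "i \<in> I" "a i * x + 2 * b i * y + c i = 0"
      using partition[of y x 1] s xy by (auto simp: J_def)
    have "quad s dvd F i" using quad_dvd_F i s xy by simp
    also have "F i dvd prod F I" using i finite_I by (simp add: dvd_prodI)
    finally have "quad s dvd G * R" using R by simp
    moreover have "\<not> quad s dvd G"
    proof
      assume "quad s dvd G"
      then obtain j where j: "j \<in> hyp" "quad s dvd Q j"
        unfolding G_def using prime_elem_dvd_prodD[OF pr] by blast
      then have "quad s dvd theta" using Q_dvd_theta dvd_trans by blast
      then obtain u where "quad s dvd [:-u, 1:]"
        using prime_elem_dvd_prodD[OF pr] unfolding prod_linear[symmetric] by blast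
      then have "degree (quad s) \<le> degree [:-u, 1:]" by (rule dvd_imp_degree_le) simp
      then show False by (simp add: degree_quad)
    qed
    ultimately show "quad s dvd R" using pr prime_elem_dvd_multD by blast
  qed (auto simp: quad_prime quad_not_dvd)
  then obtain r where r: "R = Dpoly * r" unfolding prod_quad ..
  have eq: "prod F I = G * Dpoly * r" using R r by (simp add: mult.assoc)
  have nz: "G \<noteq> 0" "Dpoly \<noteq> 0" "r \<noteq> 0" using eq prod_F_nonzero by auto
  have "degree (prod F I) = degree G + q * (q - 1) + degree r"
    unfolding eq using nz by (simp add: degree_mult_eq degree_Dpoly)
  moreover have "(q + 1) * card I = 2 * card hyp + q * (q - 1)"
  proof (cases rule: hyperbolic_count_cases)
    case full
    then show ?thesis using q_gt_3 by (cases q) (auto simp: algebra_simps)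
  next
    case half
    then show ?thesis using q_gt_3 by (cases q) (auto simp: algebra_simps)
  qed
  ultimately have "degree r = 0" using degree_prod_F degree_G by linarith
  then obtain k where k: "r = [:k:]" by (metis degree_eq_zeroE)
  then show ?thesis using that[of k] nz eq by (simp add: mult.commute)
qed

end

section \<open>Translations that permute the lines through a conic point\<close>

lemma additive_subgroup_card_dvd:
  fixes V :: "'b::{ab_group_add,finite} set"
  assumes "0 \<in> V" and diff: "\<And>x y. x \<in> V \<Longrightarrow> y \<in> V \<Longrightarrow> x - y \<in> V"
  shows "card V dvd CARD('b)"
proof -
  let ?r = "{(x, y). x - y \<in> V}"
  have "equiv UNIV ?r"
  proof (rule equivI)
    show "refl ?r" using assms(1) by (auto simp: refl_on_def)
    show "sym ?r" using diff[OF assms(1)] by (force simp: sym_def)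
    show "trans ?r"
    proof (rule transI, clarify)
      fix x y z assume "x - y \<in> V" "y - z \<in> V"
      moreover have "z - y \<in> V" using diff[OF assms(1) \<open>y - z \<in> V\<close>] by simp
      ultimately show "x - z \<in> V" using diff by fastforce
    qed
  qed auto
  with finite[of "UNIV :: 'b set"] show ?thesis
  proof (rule equiv_imp_dvd_card)
    fix K assume "K \<in> UNIV // ?r"
    then obtain x where "K = ?r `` {x}" by (rule quotientE)
    then have "K = (\<lambda>v. x - v) ` V" by (auto simp: image_iff) (metis diff_diff_eq2 add_diff_cancel_left')
    then have "card K = card V" by (simp add: card_image inj_on_def)
    then show "card V dvd card K" by simp
  qed
qed

definition lift :: "'b::comm_ring_1 poly \<Rightarrow> 'b poly poly" where "lift = map_poly (\<lambda>x. [:x:])"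

lemma coeff_lift [simp]: "coeff (lift g) j = [:coeff g j:]"
  by (simp add: lift_def coeff_map_poly)

lemma poly_lift: "poly (lift g) r = pcompose g r"
  by (simp add: lift_def pcompose_altdef)

lemma degree_lift: "degree (lift g) \<le> degree g"
  by (simp add: lift_def map_poly_degree_leq)

lemma coeff_const_poly: "coeff [:x:] n = (if n = 0 then x else 0)"
  by (simp add: coeff_pCons split: nat.splits)

text \<open>
  The candidate e (t - y^n) g(t) + (t^n - y) g(y) for the polynomial of a partition. If
  e^2 = 1 it is (-e)-symmetric, and on the curve y = t^n only e (t - t^(n^2)) g(t) remains.
\<close>

definition curve :: "nat \<Rightarrow> 'b::comm_ring_1 \<Rightarrow> 'b poly \<Rightarrow> 'b poly poly" where
  "curve n e g = smult [:e:] ([:[:0, 1:] * g:] - monom g n) + smult (monom 1 n) (lift g) - pCons 0 (lift g)"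

lemma poly_curve:
  "poly (curve n e g) r = smult e ([:0, 1:] * g - g * r ^ n) + (monom 1 n - r) * pcompose g r"
  by (simp add: curve_def poly_monom poly_lift smult_diff_right) (simp add: algebra_simps)

lemma coeff_curve:
  "coeff (coeff (curve n e g) j) k =
     e * ((if j = 0 \<and> k \<noteq> 0 then coeff g (k - 1) else 0) - (if j = n then coeff g k else 0))
     + (if k = n then coeff g j else 0) - (if k = 0 \<and> j \<noteq> 0 then coeff g (j - 1) else 0)"
  by (cases j; cases k) (auto simp: curve_def coeff_monom_mult coeff_const_poly)

lemma eps_symmetric_curve: "e * e = 1 \<Longrightarrow> eps_symmetric (- e) (curve n e g)"
  unfolding eps_symmetric_def coeff_curve by (auto simp: algebra_simps mult.assoc[symmetric])

lemma degree_curve: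
  assumes "degree g < n" shows "degree (curve n e g) \<le> n"
  unfolding curve_def
proof (intro degree_diff_le degree_add_le)
  show "degree (smult [:e:] ([:[:0, 1:] * g:] - monom g n)) \<le> n"
    by (rule order_trans[OF degree_smult_le], rule degree_diff_le) (auto simp: degree_monom_le)
  show "degree (smult (monom 1 n) (lift g)) \<le> n"
    using degree_lift[of g] assms by (intro order_trans[OF degree_smult_le]) simp
  show "degree (pCons 0 (lift g)) \<le> n"
    using degree_lift[of g] assms by (intro order_trans[OF degree_pCons_le]) simp
qed

definition t_minus_y :: "'b::comm_ring_1 poly poly" where "t_minus_y = [:[:0, 1:], [:-1:]:]"

lemma eps_symmetric_t_minus_y_mult:
  assumes "eps_symmetric 1 (f :: 'b::comm_ring_1 poly poly)"
  shows "eps_symmetric (-1) (t_minus_y * f)"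
  unfolding eps_symmetric_def
proof (intro allI)
  fix j k
  have e: "coeff (coeff (t_minus_y * f) j) k = (if k = 0 then 0 else coeff (coeff f j) (k - 1))
     - (if j = 0 then 0 else coeff (coeff f (j - 1)) k)" for j k
    by (cases j; cases k) (auto simp: t_minus_y_def)
  show "coeff (coeff (t_minus_y * f) j) k = - 1 * coeff (coeff (t_minus_y * f) k) j"
    unfolding e using assms by (auto simp: eps_symmetric_def)
qed

context apolar_partition
begin

text \<open>
  The coefficient of the top power of y in P. For a line that misses (1, 0, 0), the root - b / a is the
  midpoint of the two roots of Q.
\<close>

definition L :: "'a poly" where "L = (\<Prod>i\<in>I. [:b i, a i:])"

definition A :: "'a set" where "A = {z. poly L z = 0}"

lemma top_nonzero: "i \<in> I \<Longrightarrow> [:b i, a i:] \<noteq> 0"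
  using nontangent[of i] by auto

lemma L_nonzero: "L \<noteq> 0" using finite_I top_nonzero by (simp add: L_def)

lemma coeff_P_top: "coeff P (card I) = L"
proof -
  have d: "degree (bilin (a i) (b i) (c i)) = 1" "lead_coeff (bilin (a i) (b i) (c i)) = [:b i, a i:]"
    if "i \<in> I" for i using top_nonzero[OF that] by (auto simp: bilin_def)
  have "degree P = (\<Sum>i\<in>I. degree (bilin (a i) (b i) (c i)))"
    unfolding P_def by (rule degree_prod_eq_sum_degree) (use d(1) in force)
  also have "\<dots> = card I" using d(1) by simp
  finally have "degree P = card I" .
  moreover have "lead_coeff P = L" unfolding P_def L_def lead_coeff_prod
    by (rule prod.cong) (use d(2) in simp_all)
  ultimately show ?thesis by simp
qed

lemma degree_L: "degree L + k_inf = card I"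
proof -
  have "degree L = (\<Sum>i\<in>I. degree [:b i, a i:])"
    unfolding L_def by (rule degree_prod_eq_sum_degree) (use top_nonzero in auto)
  also have "\<dots> = (\<Sum>i\<in>I. if a i = 0 then 0 else 1)" by (rule sum.cong) auto
  finally have "degree L + k_inf = (\<Sum>i\<in>I. (if a i = 0 then 0 else 1) + (if a i = 0 then 1 else 0))"
    unfolding sum.distrib k_inf_def using finite_I by (simp add: sum.If_cases Int_def)
  also have "\<dots> = (\<Sum>i\<in>I. 1)" by (rule sum.cong) auto
  finally show ?thesis by simp
qed

lemma poly_P_const: "poly P [:z:] = (\<Prod>i\<in>I. [:b i * z + c i, a i * z + b i:])"
  by (simp add: poly_P algebra_simps)

lemma pole_nonzero: "i \<in> I \<Longrightarrow> [:b i * z + c i, a i * z + b i:] \<noteq> 0"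
proof
  assume i: "i \<in> I" "[:b i * z + c i, a i * z + b i:] = 0"
  then have "b i = - (a i * z)" "c i = - (b i * z)" by (auto simp: add_eq_0_iff)
  then have "(b i)\<^sup>2 = a i * c i" by (simp add: power2_eq_square)
  then show False using nontangent i by blast
qed

lemma degree_P_const: "degree (poly P [:z:]) + card {i \<in> I. a i * z + b i = 0} = card I"
proof -
  have "degree (poly P [:z:]) = (\<Sum>i\<in>I. degree [:b i * z + c i, a i * z + b i:])"
    unfolding poly_P_const by (rule degree_prod_eq_sum_degree) (use pole_nonzero in auto)
  also have "\<dots> = (\<Sum>i\<in>I. if a i * z + b i = 0 then 0 else 1)" by (rule sum.cong) auto
  finally have "degree (poly P [:z:]) + card {i \<in> I. a i * z + b i = 0}
    = (\<Sum>i\<in>I. (if a i * z + b i = 0 then 0 else 1) + (if a i * z + b i = 0 then 1 else 0))"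
    unfolding sum.distrib using finite_I by (simp add: sum.If_cases Int_def)
  also have "\<dots> = (\<Sum>i\<in>I. 1)" by (rule sum.cong) auto
  finally show ?thesis by simp
qed

text \<open>
  The factor at i vanishes iff line i passes through (t z, (t + z) / 2, 1), which is the meet of the
  tangents at the conic points with parameters t and z.
\<close>

lemma poly_P_point: "poly (poly P [:z:]) t = (\<Prod>i\<in>I. a i * t * z + b i * (t + z) + c i)"
  unfolding poly_P_const poly_prod by (rule prod.cong) (auto simp: algebra_simps)

lemma L_factorization:
  assumes n: "\<And>z. z \<in> A \<Longrightarrow> card {i \<in> I. a i * z + b i = 0} = n"
  obtains \<mu> where "\<mu> \<noteq> 0" "L = smult \<mu> ((\<Prod>z\<in>A. [:-z, 1:]) ^ n)"
proof -
  let ?I1 = "{i \<in> I. a i \<noteq> 0}" and ?s = "\<lambda>i. if a i = 0 then b i else a i"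
  let ?r = "\<lambda>i. - b i / a i"
  let ?f = "\<lambda>i. if a i = 0 then 1 else [:- ?r i, 1:]"
  have root: "a i * z + b i = 0 \<longleftrightarrow> a i \<noteq> 0 \<and> ?r i = z" if "i \<in> I" for i z
  proof (cases "a i = 0")
    case False
    have "?r i = z \<longleftrightarrow> - b i = z * a i" by (rule nonzero_divide_eq_eq[OF False])
    also have "\<dots> \<longleftrightarrow> a i * z + b i = 0" by (metis add.commute add_eq_0_iff mult.commute)
    finally show ?thesis using False by simp
  qed (use a_zero_b_nonzero[OF that] in simp)
  have "L = (\<Prod>i\<in>I. smult (?s i) (?f i))"
    unfolding L_def by (rule prod.cong) (auto simp: one_pCons)
  also have "\<dots> = smult (prod ?s I) (prod ?f I)" by (rule prod_smult)
  also have "prod ?f I = (\<Prod>i\<in>?I1. [:- ?r i, 1:])"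
    by (rule prod.mono_neutral_cong_right) (use finite_I in auto)
  also have "\<dots> = (\<Prod>z\<in>A. \<Prod>i\<in>{i \<in> ?I1. ?r i = z}. [:- ?r i, 1:])"
  proof (rule prod.group[symmetric])
    show "?r ` ?I1 \<subseteq> A"
    proof
      fix z assume "z \<in> ?r ` ?I1"
      then obtain i where i: "i \<in> I" "a i \<noteq> 0" "z = ?r i" by auto
      then have "poly [:b i, a i:] z = 0" by simp
      then have "(\<Prod>i\<in>I. poly [:b i, a i:] z) = 0" using i finite_I by (intro prod_zero) blast+
      then show "z \<in> A" by (simp only: A_def L_def poly_prod mem_Collect_eq)
    qed
  qed (use finite_I in auto)
  also have "\<dots> = (\<Prod>z\<in>A. [:-z, 1:] ^ n)"
  proof (rule prod.cong)
    fix z assume "z \<in> A"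
    have "(\<Prod>i\<in>{i \<in> ?I1. ?r i = z}. [:- ?r i, 1:]) = (\<Prod>i\<in>{i \<in> ?I1. ?r i = z}. [:-z, 1:])"
      by (rule prod.cong) auto
    also have "\<dots> = [:-z, 1:] ^ card {i \<in> ?I1. ?r i = z}" by simp
    also have "card {i \<in> ?I1. ?r i = z} = n"
    proof -
      have "{i \<in> ?I1. ?r i = z} = {i \<in> I. a i * z + b i = 0}" using root by auto
      then show ?thesis using n \<open>z \<in> A\<close> by simp
    qed
    finally show "(\<Prod>i\<in>{i \<in> ?I1. ?r i = z}. [:- ?r i, 1:]) = [:-z, 1:] ^ n" .
  qed simp
  finally have "L = smult (prod ?s I) ((\<Prod>z\<in>A. [:-z, 1:]) ^ n)" by (simp add: prod_power_distrib)
  moreover have "prod ?s I \<noteq> 0" using finite_I a_zero_b_nonzero by auto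
  ultimately show ?thesis using that by blast
qed

text \<open>
  A nontangent line has an internal point, which lies on one line only.
\<close>

lemma lines_distinct:
  assumes "i \<in> I" "j \<in> I" "a j = k * a i" "b j = k * b i" "c j = k * c i"
  shows "i = j"
proof -
  define K where "K = {(x, y) \<in> J. a i * x + 2 * b i * y + c i = 0}"
  have "2 * card K = (if i \<in> hyp then q - 1 else q + 1)"
    unfolding K_def by (rule count_one[OF assms(1)])
  then have "card K \<noteq> 0" using q_gt_3 by (auto split: if_splits)
  then have "K \<noteq> {}" by auto
  then obtain s where s: "s \<in> K" by blast
  obtain x y where "s = (x, y)" by (cases s)
  then have xy: "(x, y) \<in> J" "a i * x + 2 * b i * y + c i = 0" using s by (auto simp: K_def)
  have "a j * x + 2 * b j * y + c j = k * (a i * x + 2 * b i * y + c i)"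
    unfolding assms by (simp add: algebra_simps)
  then have "a j * x + 2 * b j * y + c j * 1 = 0" "a i * x + 2 * b i * y + c i * 1 = 0"
    using xy by simp_all
  then show ?thesis using partition[of y x 1] xy(1) assms(1,2) by (auto simp: J_def)
qed

text \<open>
  The line 2 b y + c z = 0 through (1, 0, 0) is recorded by w = - c / b, twice the constant value of y / z
  on it.
\<close>

definition N :: "'a set" where "N = {w. \<exists>i\<in>I. a i = 0 \<and> b i * w + c i = 0}"

lemma card_N: "card N = k_inf"
proof -
  have "N = (\<lambda>i. - c i / b i) ` {i \<in> I. a i = 0}"
    using a_zero_b_nonzero by (auto simp: N_def field_simps add_eq_0_iff image_iff)
  moreover have "inj_on (\<lambda>i. - c i / b i) {i \<in> I. a i = 0}"
  proof (rule inj_onI)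
    fix i j assume i: "i \<in> {i \<in> I. a i = 0}" and j: "j \<in> {i \<in> I. a i = 0}" and e: "- c i / b i = - c j / b j"
    have nz: "b i \<noteq> 0" "b j \<noteq> 0" using i j a_zero_b_nonzero by auto
    show "i = j"
      by (rule lines_distinct[where k = "b j / b i"]) (use i j e nz in \<open>auto simp: field_simps\<close>)
  qed
  ultimately show ?thesis by (simp add: card_image k_inf_def)
qed

text \<open>
  On the antidiagonal y = w - t the factor of a line through (1, 0, 0) is the constant b w + c, and
  the factor of any other line is a nonzero polynomial in t.
\<close>

lemma N_iff: "w \<in> N \<longleftrightarrow> poly P [:w, -1:] = 0"
proof -
  have "[:c i, b i:] + [:w, -1:] * [:b i, a i:] = 0 \<longleftrightarrow> a i = 0 \<and> b i * w + c i = 0" for i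
    by (auto simp: algebra_simps)
  then show ?thesis using finite_I by (auto simp: N_def poly_P)
qed

text \<open>
  The stabiliser of L in the group of translations.
\<close>

definition V :: "'a set" where "V = {v. pcompose L [:v, 1:] = L}"

lemma pcompose_linear_comp:
  "pcompose (pcompose f [:v, x:]) [:w, y:] = pcompose f [:v + x * w, x * (y :: 'a):]"
  by (simp add: pcompose_assoc[symmetric] pcompose_pCons mult.commute)

lemma V_subgroup: "0 \<in> V" "x \<in> V \<Longrightarrow> y \<in> V \<Longrightarrow> x - y \<in> V"
proof -
  show "0 \<in> V" by (simp add: V_def)
  assume xy: "x \<in> V" "y \<in> V"
  have "pcompose L [:x - y, 1:] = pcompose (pcompose L [:x, 1:]) [:- y, 1:]"
    unfolding pcompose_linear_comp by simp
  also have "\<dots> = pcompose (pcompose L [:y, 1:]) [:- y, 1:]" using xy by (simp add: V_def)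
  also have "\<dots> = L" unfolding pcompose_linear_comp by simp
  finally show "x - y \<in> V" by (simp add: V_def)
qed

text \<open>
  If the reflections t \<mapsto> w - t that multiply L by e are those with w in N, then N is a coset of V, since the
  composition of two reflections is a translation.
\<close>

lemma card_V:
  assumes N: "\<And>w. w \<in> N \<longleftrightarrow> pcompose L [:w, -1:] = smult e L" and "k_inf \<noteq> 0"
  shows "card V = k_inf"
proof -
  obtain w where w: "w \<in> N" using assms(2) card_N by (metis card.empty ex_in_conv)
  have "N = (\<lambda>v. w + v) ` V"
  proof -
    have "w + v \<in> N \<longleftrightarrow> v \<in> V" for v
    proof
      assume "w + v \<in> N"
      have "pcompose L [:v, 1:] = pcompose (pcompose L [:w + v, -1:]) [:w, -1:]"
        unfolding pcompose_linear_comp by simp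
      also have "\<dots> = smult e (pcompose L [:w, -1:])"
        using N[of "w + v"] \<open>w + v \<in> N\<close> by (simp add: pcompose_smult)
      also have "\<dots> = smult e (smult e L)" using N w by simp
      finally have 1: "pcompose L [:v, 1:] = smult e (smult e L)" .
      have "L = pcompose (pcompose L [:w, -1:]) [:w, -1:]" unfolding pcompose_linear_comp by simp
      also have "\<dots> = smult e (smult e L)" using N w by (simp add: pcompose_smult)
      finally show "v \<in> V" using 1 by (simp add: V_def)
    next
      assume "v \<in> V"
      then have "pcompose L [:- v, 1:] = L" using V_subgroup(2)[OF V_subgroup(1)] by (force simp: V_def)
      then have "pcompose L [:w + v, -1:] = pcompose (pcompose L [:- v, 1:]) [:w + v, -1:]" by simp
      also have "\<dots> = smult e L" using N w unfolding pcompose_linear_comp by simp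
      finally show "w + v \<in> N" using N by simp
    qed
    then show ?thesis by (auto simp: image_iff) (metis add.commute diff_add_cancel)
  qed
  then have "card N = card V" by (simp add: card_image inj_on_def)
  then show ?thesis using card_N by simp
qed

end

section \<open>Partitions with q - 1 lines\<close>

context apolar_partition
begin

text \<open>
  The projectivities that fix the conic are the symmetric squares of the substitutions of PGL(2, q).
  They multiply y^2 - x z and the discriminants of the lines by nonzero squares.
\<close>

lemma transform:
  assumes d: "\<alpha> * \<delta> - \<beta> * \<gamma> \<noteq> 0"
  shows "apolar_partition q I (\<lambda>i. a i * \<alpha>\<^sup>2 + 2 * b i * \<alpha> * \<gamma> + c i * \<gamma>\<^sup>2)
    (\<lambda>i. a i * \<alpha> * \<beta> + b i * (\<alpha> * \<delta> + \<beta> * \<gamma>) + c i * \<gamma> * \<delta>)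
    (\<lambda>i. a i * \<beta>\<^sup>2 + 2 * b i * \<beta> * \<delta> + c i * \<delta>\<^sup>2)"
    (is "apolar_partition q I ?a ?b ?c")
proof unfold_locales
  let ?d = "\<alpha> * \<delta> - \<beta> * \<gamma>"
  show "finite I" by (rule finite_I)
  show "(?b i)\<^sup>2 \<noteq> ?a i * ?c i" if "i \<in> I" for i
  proof -
    have "(?b i)\<^sup>2 - ?a i * ?c i = ?d\<^sup>2 * ((b i)\<^sup>2 - a i * c i)"
      by (simp add: power2_eq_square algebra_simps)
    then show ?thesis using nontangent[OF that] d by auto
  qed
  fix y x z :: 'a assume ns: "\<not> is_square (y\<^sup>2 - x * z)"
  define x' y' z' where "x' = \<alpha>\<^sup>2 * x + 2 * \<alpha> * \<beta> * y + \<beta>\<^sup>2 * z"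
    and "y' = \<alpha> * \<gamma> * x + (\<alpha> * \<delta> + \<beta> * \<gamma>) * y + \<beta> * \<delta> * z"
    and "z' = \<gamma>\<^sup>2 * x + 2 * \<gamma> * \<delta> * y + \<delta>\<^sup>2 * z"
  have inc: "?a i * x + 2 * ?b i * y + ?c i * z = a i * x' + 2 * b i * y' + c i * z'" for i
    by (simp add: x'_def y'_def z'_def algebra_simps)
  have "y'\<^sup>2 - x' * z' = ?d\<^sup>2 * (y\<^sup>2 - x * z)"
    by (simp add: x'_def y'_def z'_def power2_eq_square algebra_simps)
  then have disc: "y\<^sup>2 - x * z = (y'\<^sup>2 - x' * z') / ?d\<^sup>2" using d by simp
  have "\<not> is_square (y'\<^sup>2 - x' * z')"
  proof
    assume "is_square (y'\<^sup>2 - x' * z')"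
    then obtain w where "y'\<^sup>2 - x' * z' = w\<^sup>2" by (auto simp: is_nth_power_def)
    then have "y\<^sup>2 - x * z = (w / ?d)\<^sup>2" unfolding disc by (simp only: power_divide)
    then show False using ns by (metis is_nth_power_nth_power)
  qed
  from partition[OF this] show "\<exists>!i. i \<in> I \<and> ?a i * x + 2 * ?b i * y + ?c i * z = 0"
    unfolding inc .
qed

lemma point_value: "[:z :: 'a:] ^ q = [:z:]"
  by (simp add: poly_const_pow)

lemma pcompose_at_point: "pcompose f [:z:] = [:poly f (z :: 'a):]"
  by (induction f) (simp_all add: pcompose_pCons)

lemma reflect_value: "[:w :: 'a, -1:] ^ q = [:w:] - monom 1 q"
proof -
  have "[:w, -1:] ^ q = ([:w:] - [:0, 1:]) ^ q" by simp
  also have "\<dots> = [:w:] - monom 1 q" unfolding frob_diff point_value by (simp add: monom_altdef)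
  finally show ?thesis .
qed

lemma eps_symmetric_diff:
  assumes "eps_symmetric e f" "eps_symmetric e g"
  shows "eps_symmetric e (f - g)"
  unfolding eps_symmetric_def
proof (intro allI)
  fix j k
  have "coeff (coeff f j) k = e * coeff (coeff f k) j" "coeff (coeff g j) k = e * coeff (coeff g k) j"
    using assms unfolding eps_symmetric_def by blast+
  then show "coeff (coeff (f - g) j) k = e * coeff (coeff (f - g) k) j"
    by (simp only: coeff_diff right_diff_distrib)
qed

lemma frob_factor_nonzero: "monom 1 q + [:w, x :: 'a:] \<noteq> 0"
proof
  assume "monom 1 q + [:w, x:] = 0"
  then have "coeff (monom 1 q + [:w, x:]) q = 0" by (simp only: coeff_0)
  moreover have "coeff [:w, x:] q = 0" using q_gt_3 by (intro coeff_eq_0) auto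
  ultimately show False by simp
qed

lemma incidence_imp_root:
  assumes "i \<in> I" "a i * t * z + b i * (t + z) + c i = 0"
  shows "poly (poly P [:z:]) t = 0"
  unfolding poly_P_point using assms finite_I by (intro prod_zero) blast+

text \<open>
  The product t - y times P is antisymmetric of degree at most q, so \<open>frobenius_curve_vanishing\<close> applies
  to its difference from the curve polynomial. Comparing the coefficients of y^q identifies the
  multiple of G with L.
\<close>

lemma half_identity:
  assumes card: "card I = q - 1" and k: "k_inf \<noteq> 0"
  shows "t_minus_y * P = curve q 1 L" and "degree L + k_inf = q - 1"
    and "\<exists>\<kappa>. L = smult \<kappa> G"
proof -
  have h: "2 * card hyp = q - 1" using card q_gt_3 by (cases rule: hyperbolic_count_cases) auto
  obtain \<kappa> where \<kappa>: "\<kappa> \<noteq> 0" "prod F I = smult \<kappa> (G * Dpoly)" by (rule product_identity)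
  define g where "g = smult \<kappa> G"
  have dg: "degree g + k_inf = q - 1" using degree_G h \<kappa>(1) by (simp add: g_def)
  have pF: "prod F I = g * Dpoly" using \<kappa>(2) by (simp add: g_def)
  have "t_minus_y * P - curve q 1 g = 0"
  proof (rule frobenius_curve_vanishing[where e = "-1" and n = q])
    show "eps_symmetric (-1) (t_minus_y * P - curve q 1 g)"
      by (rule eps_symmetric_diff[OF eps_symmetric_t_minus_y_mult[OF symmetric_P]])
        (use eps_symmetric_curve[of 1 q g] in simp)
    show "degree (t_minus_y * P - curve q 1 g) \<le> q"
    proof (rule degree_diff_le)
      have "degree (t_minus_y * P) \<le> degree (t_minus_y :: 'a poly poly) + degree P" by (rule degree_mult_le)
      also have "\<dots> \<le> 1 + (q - 1)" using degree_P card by (intro add_mono) (auto simp: t_minus_y_def)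
      finally show "degree (t_minus_y * P) \<le> q" using q_gt_3 by simp
      show "degree (curve q 1 g) \<le> q" by (rule degree_curve) (use dg q_gt_3 in linarith)
    qed
    have "poly (t_minus_y * P) (monom 1 q) = - (theta * prod F I)"
      by (simp only: poly_mult poly_P_frob) (simp add: t_minus_y_def theta_def algebra_simps)
    also have "\<dots> = - (theta * Dpoly * g)" unfolding pF by (simp only: mult_ac)
    also have "\<dots> = [:0, 1:] * g - g * monom 1 q ^ q"
    proof -
      have "- ((f1 - f2) * f3) = f2 * f3 - f3 * f1" for f1 f2 f3 :: "'a poly"
        by (simp add: algebra_simps)
      then show ?thesis unfolding theta_Dpoly monom_power by (simp only: power_one)
    qed
    finally show "poly (t_minus_y * P - curve q 1 g) (monom 1 q) = 0"
      by (simp only: poly_diff poly_curve) simp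
  qed (use q_gt_3 in simp)
  then have id: "t_minus_y * P = curve q 1 g" by simp
  have "coeff (t_minus_y * P) q = - L"
  proof -
    obtain m where m: "q = Suc m" "card I = m" using card q_gt_3 by (cases q) auto
    have "coeff P q = 0" using degree_P m by (intro coeff_eq_0) simp
    then show ?thesis using coeff_P_top m by (simp add: t_minus_y_def)
  qed
  moreover have "coeff (curve q 1 g) q = - g"
  proof (rule poly_eqI)
    fix k
    have "coeff g q = 0" "coeff g (q - 1) = 0" using dg k q_gt_3 by (auto intro!: coeff_eq_0)
    then show "coeff (coeff (curve q 1 g) q) k = coeff (- g) k"
      unfolding coeff_curve using q_gt_3 by simp
  qed
  ultimately have "L = g" using id by simp
  then show "t_minus_y * P = curve q 1 L" "degree L + k_inf = q - 1" "\<exists>\<kappa>. L = smult \<kappa> G"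
    using id dg by (auto simp: g_def)
qed

text \<open>
  The number k of lines through (1, 0, 0) divides q and q - 1, so it is 1, and L has exactly two non-roots
  y1 and y2 in the field. Line i passes through the meet of the tangents at y1 and some t. Here t is not
  a root of L because P(t, z) = L(t) at the roots z of L, and it is not y1 because L is a multiple of G.
  So t = y2 for every line.
\<close>

lemma half_case_at_inf:
  assumes card: "card I = q - 1" and k: "k_inf \<noteq> 0"
  shows "\<exists>x y z w. w \<noteq> 0 \<and> y\<^sup>2 - x * z = w\<^sup>2 \<and> (\<forall>i\<in>I. a i * x + 2 * b i * y + c i * z = 0)"
proof -
  note id = half_identity[OF card k]
  have poly_id: "([:0, 1:] - r) * poly P r = [:0, 1:] * L - L * r ^ q + (monom 1 q - r) * pcompose L r" for r
  proof -
    have "poly (t_minus_y * P) r = poly (curve q 1 L) r" using id(1) by simp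
    then show ?thesis by (simp only: poly_mult poly_curve) (simp add: t_minus_y_def algebra_simps)
  qed
  \<comment> \<open>Setting y = z in the identity for P.\<close>
  have Pz: "poly P [:z:] = L" if "z \<in> A" for z
  proof -
    have "pcompose L [:z:] = 0"
      using that by (simp add: pcompose_at_point A_def)
    then have "([:0, 1:] - [:z:]) * poly P [:z:] = ([:0, 1:] - [:z:]) * L"
      using poly_id[of "[:z:]"] unfolding point_value by (simp add: algebra_simps)
    moreover have "[:0, 1:] - [:z:] \<noteq> 0" by simp
    ultimately show ?thesis by (metis mult_cancel_left)
  qed
  have nz: "card {i \<in> I. a i * z + b i = 0} = k_inf" if "z \<in> A" for z
    using degree_P_const[of z] Pz[OF that] id(2) card by simp
  obtain \<mu> where \<mu>: "\<mu> \<noteq> 0" "L = smult \<mu> ((\<Prod>z\<in>A. [:-z, 1:]) ^ k_inf)"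
    using L_factorization[OF nz] by blast
  have dL: "degree L = k_inf * card A"
    using \<mu> by (simp add: degree_power_eq lead_coeff_prod_linear prod_zero_iff)
  then have kd: "k_inf dvd q - 1" using id(2) by (metis dvd_add_triv_right_iff dvd_triv_left)
  \<comment> \<open>Setting y = w - t in the identity for P.\<close>
  have Niff: "w \<in> N \<longleftrightarrow> pcompose L [:w, -1:] = smult (-1) L" for w
  proof -
    have "([:0, 1:] - [:w, -1:]) * poly P [:w, -1:]
      = (monom 1 q + [:-w, 1:]) * (L + pcompose L [:w, -1:])"
      unfolding poly_id reflect_value by (simp add: algebra_simps)
    moreover have "[:0, 1:] - [:w, -1:] \<noteq> 0" using two_nonzero by simp
    ultimately have "poly P [:w, -1:] = 0 \<longleftrightarrow> L + pcompose L [:w, -1:] = 0"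
      using frob_factor_nonzero by (metis mult_eq_0_iff)
    then show ?thesis unfolding N_iff by (simp add: add_eq_0_iff)
  qed
  have "k_inf dvd q"
    using additive_subgroup_card_dvd[OF V_subgroup] card_V[OF Niff k] q_card by simp
  then have "k_inf dvd q - (q - 1)" using kd by (rule dvd_diff_nat)
  then have k1: "k_inf = 1" using q_gt_3 by simp
  have "card (UNIV - A) = 2"
    using dL id(2) k1 q_gt_3 q_card by (simp add: card_Diff_subset)
  then obtain y1 y2 where y: "UNIV - A = {y1, y2}" "y1 \<noteq> y2" by (auto simp: card_2_iff)
  have pair: "a i * (y1 * y2) + b i * (y1 + y2) + c i = 0" if i: "i \<in> I" for i
  proof -
    have "y1 \<notin> A" using y by auto
    have "poly [:b i, a i:] y1 \<noteq> 0"
    proof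
      assume "poly [:b i, a i:] y1 = 0"
      then have "(\<Prod>i\<in>I. poly [:b i, a i:] y1) = 0" using i finite_I by (intro prod_zero) blast+
      then have "poly L y1 = 0" by (simp only: L_def poly_prod)
      then show False using \<open>y1 \<notin> A\<close> by (simp add: A_def)
    qed
    then have d: "a i * y1 + b i \<noteq> 0" by (simp add: algebra_simps)
    \<comment> \<open>The parameter for which line i passes through the meet of the tangents at y1 and t.\<close>
    define t where "t = - (b i * y1 + c i) / (a i * y1 + b i)"
    have "t * (a i * y1 + b i) = - (b i * y1 + c i)" using d by (simp add: t_def)
    then have t: "a i * t * y1 + b i * (t + y1) + c i = 0"
      by (simp add: algebra_simps eq_neg_iff_add_eq_0)
    have "t \<notin> A"
    proof
      assume "t \<in> A"
      have "poly (poly P [:t:]) y1 = 0"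
        by (rule incidence_imp_root[OF i]) (use t in \<open>simp add: algebra_simps\<close>)
      then show False using Pz[OF \<open>t \<in> A\<close>] \<open>y1 \<notin> A\<close> by (simp add: A_def)
    qed
    moreover have "t \<noteq> y1"
    proof
      assume "t = y1"
      then have r: "a i * y1 * y1 + 2 * b i * y1 + c i = 0" using t by (simp add: algebra_simps)
      have "(b i)\<^sup>2 - a i * c i
          = (a i * y1 + b i)\<^sup>2 - a i * (a i * y1 * y1 + 2 * b i * y1 + c i)"
        by (simp add: power2_eq_square algebra_simps)
      then have "(b i)\<^sup>2 - a i * c i = (a i * y1 + b i)\<^sup>2" unfolding r by simp
      then have ih: "i \<in> hyp" using i by (auto simp: hyp_def is_nth_power_def)
      have "poly (Q i) y1 = 0" using r by (simp add: Q_def algebra_simps)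
      then have "(\<Prod>i\<in>hyp. poly (Q i) y1) = 0" using ih finite_hyp by (intro prod_zero) blast+
      then have "poly G y1 = 0" by (simp only: G_def poly_prod)
      then show False using id(3) \<open>y1 \<notin> A\<close> by (auto simp: A_def)
    qed
    ultimately have "t = y2" using y by auto
    then show ?thesis using t by (simp add: algebra_simps)
  qed
  \<comment> \<open>The meet of the tangents at y1 and y2 is (y1 y2, h, 1), with discriminant d^2.\<close>
  define h d where "h = (y1 + y2) / 2" and "d = (y1 - y2) / 2"
  have hd: "y1 = h + d" "y2 = h - d"
    using two_nonzero by (simp_all add: h_def d_def mult_2[symmetric]
        flip: add_divide_distrib diff_divide_distrib)
  show ?thesis
  proof (intro exI conjI ballI)
    show "d \<noteq> 0" using y hd by auto
    show "h\<^sup>2 - (y1 * y2) * 1 = d\<^sup>2" unfolding hd by (simp add: power2_eq_square algebra_simps)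
    fix i assume "i \<in> I"
    from pair[OF this] show "a i * (y1 * y2) + 2 * b i * h + c i * 1 = 0"
      unfolding hd by (simp add: algebra_simps)
  qed
qed

text \<open>
  Some secant exists, and one of its conic points can be moved to infinity.
\<close>

lemma half_case:
  assumes card: "card I = q - 1"
  shows "\<exists>x y z w. w \<noteq> 0 \<and> y\<^sup>2 - x * z = w\<^sup>2 \<and> (\<forall>i\<in>I. a i * x + 2 * b i * y + c i * z = 0)"
proof -
  have "card hyp \<noteq> 0" using card q_gt_3 by (cases rule: hyperbolic_count_cases) auto
  then have "hyp \<noteq> {}" by auto
  then obtain i where i: "i \<in> hyp" by blast
  then have iI: "i \<in> I" by (simp add: hyp_def)
  show ?thesis
  proof (cases "a i = 0")
    case True
    then have "{i \<in> I. a i = 0} \<noteq> {}" using iI by blast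
    then have "k_inf \<noteq> 0" using finite_I by (simp add: k_inf_def)
    then show ?thesis by (rule half_case_at_inf[OF card])
  next
    case False
    obtain u v where uv: "Q i = smult (a i) ([:-u, 1:] * [:-v, 1:])"
      using Q_split[OF i False] by blast
    have "poly (Q i) u = 0" unfolding uv poly_smult poly_mult by simp
    then have u: "a i * u\<^sup>2 + 2 * b i * u * 1 + c i * 1\<^sup>2 = 0"
      by (simp add: Q_def power2_eq_square algebra_simps)
    \<comment> \<open>The substitution t = u - 1 / s moves the conic point with parameter u to infinity.\<close>
    define a' b' c' where "a' = (\<lambda>i. a i * u\<^sup>2 + 2 * b i * u * 1 + c i * 1\<^sup>2)"
      and "b' = (\<lambda>i. a i * u * (-1) + b i * (u * 0 + (-1) * 1) + c i * 1 * 0)"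
      and "c' = (\<lambda>i. a i * (-1)\<^sup>2 + 2 * b i * (-1) * 0 + c i * 0\<^sup>2)"
    interpret t: apolar_partition q T I a' b' c'
      unfolding a'_def b'_def c'_def by (rule transform) simp
    have "{i \<in> I. a' i = 0} \<noteq> {}" using u iI unfolding a'_def by blast
    then have "t.k_inf \<noteq> 0" using finite_I by (simp add: t.k_inf_def)
    from t.half_case_at_inf[OF card this] obtain x y z w where
      w: "w \<noteq> 0" "y\<^sup>2 - x * z = w\<^sup>2" "\<forall>i\<in>I. a' i * x + 2 * b' i * y + c' i * z = 0"
      by blast
    show ?thesis
    proof (intro exI conjI ballI)
      show "w \<noteq> 0" by fact
      show "(u * x - y)\<^sup>2 - (u\<^sup>2 * x - 2 * u * y + z) * x = w\<^sup>2"
        unfolding w(2)[symmetric] by (simp add: power2_eq_square algebra_simps)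
      fix j assume "j \<in> I"
      then have "a' j * x + 2 * b' j * y + c' j * z = 0" using w(3) by blast
      then show "a j * (u\<^sup>2 * x - 2 * u * y + z) + 2 * b j * (u * x - y) + c j * x = 0"
        by (simp add: a'_def b'_def c'_def algebra_simps)
    qed
  qed
qed

end

section \<open>Partitions with q lines that cover the conic\<close>

definition subfield_set :: "'b::field set \<Rightarrow> bool" where
  "subfield_set K \<longleftrightarrow> 1 \<in> K \<and> (\<forall>x\<in>K. \<forall>y\<in>K. x - y \<in> K \<and> x * y \<in> K) \<and> (\<forall>x\<in>K. inverse x \<in> K)"

lemma subfield_setD:
  assumes "subfield_set K"
  shows "0 \<in> K" "1 \<in> K" "x \<in> K \<Longrightarrow> - x \<in> K" "x \<in> K \<Longrightarrow> y \<in> K \<Longrightarrow> x + y \<in> K"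
    "x \<in> K \<Longrightarrow> y \<in> K \<Longrightarrow> x - y \<in> K" "x \<in> K \<Longrightarrow> y \<in> K \<Longrightarrow> x * y \<in> K"
    "x \<in> K \<Longrightarrow> inverse x \<in> K" "x \<in> K \<Longrightarrow> y \<in> K \<Longrightarrow> x / y \<in> K"
proof -
  note d = assms[unfolded subfield_set_def]
  show 1: "1 \<in> K" "x \<in> K \<Longrightarrow> y \<in> K \<Longrightarrow> x - y \<in> K" "x \<in> K \<Longrightarrow> y \<in> K \<Longrightarrow> x * y \<in> K"
    "x \<in> K \<Longrightarrow> inverse x \<in> K" for x y using d by auto
  show 0: "0 \<in> K" using 1(2)[OF 1(1) 1(1)] by simp
  show m: "x \<in> K \<Longrightarrow> - x \<in> K" for x using 1(2)[OF 0, of x] by simp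
  show "x \<in> K \<Longrightarrow> y \<in> K \<Longrightarrow> x + y \<in> K" using 1(2)[of x "- y"] m[of y] by simp
  show "x \<in> K \<Longrightarrow> y \<in> K \<Longrightarrow> x / y \<in> K" using 1(3)[of x "inverse y"] 1(4)[of y] by (simp add: divide_inverse)
qed

context apolar_partition
begin

text \<open>
  Here G vanishes on the whole field, so t^q - t divides it. The product of the F is then t^(q^2) - t times a
  cofactor g, which is the restriction of the symmetric curve polynomial of g.
\<close>

lemma full_identity:
  assumes card: "card I = q" and k: "k_inf \<ge> 2" and all: "\<And>u. poly G u = 0"
  shows "P = curve q (-1) L"
proof -
  have h: "card hyp = q" using card q_gt_3 by (cases rule: hyperbolic_count_cases) auto
  have "theta dvd G" by (rule theta_dvdI) (rule all)
  then obtain r where r: "G = theta * r" ..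
  obtain \<kappa> where \<kappa>: "\<kappa> \<noteq> 0" "prod F I = smult \<kappa> (G * Dpoly)" by (rule product_identity)
  define g where "g = smult \<kappa> r"
  have nz: "theta \<noteq> 0" "r \<noteq> 0" using r G_nonzero by auto
  have "degree G = q + degree g" unfolding r g_def using nz \<kappa>(1) by (simp add: degree_mult_eq degree_theta)
  then have dg: "degree g + k_inf = q" using degree_G h by simp
  have pF: "prod F I = theta * Dpoly * g" unfolding \<kappa>(2) r g_def by (simp add: mult_ac)
  have "P - curve q (-1) g = 0"
  proof (rule frobenius_curve_vanishing[where e = 1 and n = q])
    show "eps_symmetric 1 (P - curve q (-1) g)"
      by (rule eps_symmetric_diff[OF symmetric_P]) (use eps_symmetric_curve[of "-1" q g] in simp)
    show "degree (P - curve q (-1) g) \<le> q"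
      by (rule degree_diff_le[OF _ degree_curve]) (use degree_P card dg k in auto)
    have "- ((f2 * f3) - f3 * f1) = (f1 - f2) * f3" for f1 f2 f3 :: "'a poly"
      by (simp add: algebra_simps)
    then have "smult (-1) ([:0, 1:] * g - g * monom 1 q ^ q) = theta * Dpoly * g"
      unfolding theta_Dpoly monom_power by (simp only: power_one smult_minus_left smult_1_left)
    then show "poly (P - curve q (-1) g) (monom 1 q) = 0"
      by (simp only: poly_diff poly_curve poly_P_frob pF) simp
  qed (use q_gt_3 in simp)
  then have id: "P = curve q (-1) g" by simp
  have "coeff (curve q (-1) g) q = g"
  proof (rule poly_eqI)
    fix l
    have "coeff g q = 0" "coeff g (q - 1) = 0" using dg k q_gt_3 by (auto intro!: coeff_eq_0)
    then show "coeff (coeff (curve q (-1) g) q) l = coeff g l"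
      unfolding coeff_curve using q_gt_3 by simp
  qed
  then have "L = g" using id coeff_P_top card by simp
  then show ?thesis using id by simp
qed

lemma V_translates: "v \<in> V \<Longrightarrow> z \<in> A \<Longrightarrow> z + v \<in> A"
proof -
  assume v: "v \<in> V" and z: "z \<in> A"
  have "poly L (z + v) = poly (pcompose L [:v, 1:]) z" by (simp add: poly_pcompose add.commute)
  also have "\<dots> = 0" using v z by (simp add: V_def A_def)
  finally show ?thesis by (simp add: A_def)
qed

lemma pcompose_power: "pcompose (f ^ n) (g :: 'a poly) = pcompose f g ^ n"
  by (induction n) (simp_all add: pcompose_mult pcompose_1)

lemma translates_V:
  assumes L: "L = smult \<mu> ((\<Prod>z\<in>A. [:-z, 1:]) ^ n)" and v: "\<And>z. z \<in> A \<Longrightarrow> z + v \<in> A"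
  shows "v \<in> V"
proof -
  have im: "(\<lambda>z. z + v) ` A = A"
    by (rule endo_inj_surj) (use v in \<open>auto simp: inj_on_def\<close>)
  have "pcompose (\<Prod>z\<in>A. [:-z, 1:]) [:v, 1:] = (\<Prod>z\<in>A. [:- z + v, 1:])"
    by (simp add: pcompose_prod pcompose_pCons)
  also have "\<dots> = (\<Prod>z\<in>(\<lambda>z. z + v) ` A. [:- z + v, 1:])" unfolding im ..
  also have "\<dots> = (\<Prod>z\<in>A. [:-z, 1:])"
    by (subst prod.reindex) (auto simp: inj_on_def)
  finally have "pcompose (smult \<mu> ((\<Prod>z\<in>A. [:-z, 1:]) ^ n)) [:v, 1:] = smult \<mu> ((\<Prod>z\<in>A. [:-z, 1:]) ^ n)"
    by (simp only: pcompose_smult pcompose_power)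
  then show ?thesis by (simp only: V_def L[symmetric] mem_Collect_eq)
qed

lemma top_root:
  assumes "i \<in> I" "a i \<noteq> 0"
  shows "- b i / a i \<in> A"
proof -
  have "\<exists>j\<in>I. poly [:b j, a j:] (- b i / a i) = 0" using assms by (intro bexI[of _ i]) auto
  then have "(\<Prod>j\<in>I. poly [:b j, a j:] (- b i / a i)) = 0" using finite_I by (intro prod_zero)
  then have "poly L (- b i / a i) = 0" by (simp only: L_def poly_prod)
  then show ?thesis by (simp add: A_def)
qed

text \<open>
  The dilations about a root a0 of L that permute the set A of roots act on the translation group V. They
  arise as quotients of the inversions x \<mapsto> a0 + g / (x - a0) that the lines with a a0 + b = 0 induce on A,
  and there are as many of them as nonzero elements of V. Hence V is a line over the subfield K of their
  ratios, and point reflections show that A is a single coset of V. In the affine coordinate a0 + v0 s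
  the set A becomes K, and each line pairs elements of K with elements of K through the meets of the tangents at them.
\<close>

lemma full_case_at_inf:
  assumes card: "card I = q" and k: "k_inf \<ge> 2" and all: "\<And>u. poly G u = 0"
  shows "(\<forall>i\<in>I. a i = 0) \<or> (\<exists>K \<alpha> \<beta>. \<alpha> \<noteq> 0 \<and> subfield_set K \<and> (card K)\<^sup>2 = q \<and>
    (\<forall>i\<in>I. \<exists>l. l \<noteq> 0 \<and> l * (a i * \<alpha>\<^sup>2) \<in> K \<and> l * (\<alpha> * (a i * \<beta> + b i)) \<in> K
       \<and> l * (a i * \<beta>\<^sup>2 + 2 * b i * \<beta> + c i) \<in> K))"
proof (cases "A = {}")
  case True
  then show ?thesis using top_root by blast
next
  case False
  note id = full_identity[OF card k all]
  have poly_id: "poly P r = (monom 1 q - r) * pcompose L r - ([:0, 1:] - r ^ q) * L" for r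
    by (subst id, subst poly_curve) (simp add: algebra_simps)
  \<comment> \<open>Setting y = z in the identity for P.\<close>
  have Pz: "poly P [:z:] = [:z, -1:] * L" if "z \<in> A" for z
  proof -
    have "pcompose L [:z:] = 0" using that by (simp add: pcompose_at_point A_def)
    then show ?thesis unfolding poly_id point_value by simp
  qed
  have root: "t \<in> A" if "i \<in> I" "z \<in> A" "a i * t * z + b i * (t + z) + c i = 0" for i t z
  proof -
    have "poly ([:z, -1:] * L) t = 0"
      using incidence_imp_root[OF that(1,3)] unfolding Pz[OF that(2)] .
    then have "z = t \<or> poly L t = 0" by auto
    then show ?thesis using that(2) by (auto simp: A_def)
  qed
  define k where "k = k_inf - 1"
  have k1: "k_inf = Suc k" "k \<ge> 1" using assms(2) by (auto simp: k_def)
  have dL: "degree L + Suc k = q" using degree_L card k1 by simp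
  have nz: "card {i \<in> I. a i * z + b i = 0} = k" if "z \<in> A" for z
  proof -
    have "degree (poly P [:z:]) = Suc (degree L)"
      unfolding Pz[OF that] using L_nonzero by (subst degree_mult_eq) auto
    then show ?thesis using degree_P_const[of z] card dL by simp
  qed
  obtain \<mu> where \<mu>: "\<mu> \<noteq> 0" "L = smult \<mu> ((\<Prod>z\<in>A. [:-z, 1:]) ^ k)"
    using L_factorization[OF nz] by blast
  have dL': "degree L = k * card A"
    using \<mu> by (simp add: degree_power_eq lead_coeff_prod_linear prod_zero_iff)
  \<comment> \<open>Setting y = w - t in the identity for P.\<close>
  have "w \<in> N \<longleftrightarrow> pcompose L [:w, -1:] = smult 1 L" for w
  proof -
    have "poly P [:w, -1:] = (monom 1 q + [:-w, 1:]) * (pcompose L [:w, -1:] - L)"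
      unfolding poly_id reflect_value by (simp add: algebra_simps)
    then show ?thesis unfolding N_iff using frob_factor_nonzero by simp
  qed
  then have cV: "card V = Suc k" using card_V[of 1] k1 by simp
  have V_iff: "v \<in> V \<longleftrightarrow> (\<forall>z\<in>A. z + v \<in> A)" for v
    using V_translates translates_V[OF \<mu>(2)] by blast
  have cV0: "card (V - {0}) = k" using cV V_subgroup(1) by (simp add: card_Diff_singleton)
  have "V - {0} \<noteq> {}"
  proof
    assume "V - {0} = {}"
    then have "card (V - {0}) = 0" by (simp only: card.empty)
    then show False using cV0 k1(2) by simp
  qed
  then obtain v0 where v0: "v0 \<in> V" "v0 \<noteq> 0" by blast
  \<comment> \<open>The ratios of the dilations about a0 that map A to itself.\<close>
  define M where "M = (\<lambda>a0. {m. m \<noteq> 0 \<and> (\<forall>x\<in>A. a0 + m * (x - a0) \<in> A)})"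
  have card_M: "k \<le> card (M a0)" if a0: "a0 \<in> A" for a0
  proof -
    \<comment> \<open>For these lines the incidence with the meet of the tangents at t and x reads (t - a0) (x - a0) = g.\<close>
    define S where "S = {i \<in> I. a i * a0 + b i = 0}"
    define g where "g = (\<lambda>i. - (a i * a0\<^sup>2 + 2 * b i * a0 + c i) / a i)"
    have S: "i \<in> I" "a i \<noteq> 0" "b i = - (a i * a0)" "c i = a i * a0\<^sup>2 - a i * g i" "g i \<noteq> 0"
      if "i \<in> S" for i
    proof -
      show i: "i \<in> I" using that by (simp add: S_def)
      show b: "b i = - (a i * a0)" using that by (simp add: S_def add_eq_0_iff2)
      show a: "a i \<noteq> 0" using a_zero_b_nonzero[OF i] b by auto
      show c: "c i = a i * a0\<^sup>2 - a i * g i" using a b by (simp add: g_def power2_eq_square)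
      show "g i \<noteq> 0"
      proof
        assume "g i = 0"
        then have "(b i)\<^sup>2 = a i * c i" using b c by (simp add: power2_eq_square)
        then show False using nontangent[OF i] by blast
      qed
    qed
    have inc: "a i * t * x + b i * (t + x) + c i = a i * ((t - a0) * (x - a0) - g i)" if "i \<in> S" for i t x
      unfolding S(3,4)[OF that] by (simp add: algebra_simps power2_eq_square)
    have inv: "a0 + g i / (x - a0) \<in> A" if "i \<in> S" "x \<in> A" "x \<noteq> a0" for i x
    proof (rule root)
      show "i \<in> I" "x \<in> A" using that S by auto
      show "a i * (a0 + g i / (x - a0)) * x + b i * (a0 + g i / (x - a0) + x) + c i = 0"
        unfolding inc[OF that(1)] using that(3) by simp
    qed
    have "card S = k" using nz[OF a0] by (simp add: S_def)
    then have "S \<noteq> {}" using k1(2) by auto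
    then obtain j where j: "j \<in> S" by blast
    have "(\<lambda>i. g i / g j) ` S \<subseteq> M a0"
    proof clarify
      fix i assume i: "i \<in> S"
      have "a0 + g i / g j * (x - a0) \<in> A" if "x \<in> A" for x
      proof (cases "x = a0")
        case False
        let ?t = "a0 + g j / (x - a0)"
        have "?t \<in> A" using inv[OF j that False] .
        moreover have "?t \<noteq> a0" using S(5)[OF j] False by simp
        ultimately have "a0 + g i / (?t - a0) \<in> A" by (rule inv[OF i])
        then show ?thesis by simp
      qed (use a0 in simp)
      then show "g i / g j \<in> M a0" using S(5)[OF i] S(5)[OF j] by (simp add: M_def)
    qed
    moreover have "inj_on (\<lambda>i. g i / g j) S"
    proof (rule inj_onI)
      fix i i' assume i: "i \<in> S" "i' \<in> S" "g i / g j = g i' / g j"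
      then have "g i = g i'" using S(5)[OF j] by simp
      then show "i = i'" using i S[OF i(1)] S[OF i(2)]
        by (intro lines_distinct[where k = "a i' / a i"]) (auto simp: right_diff_distrib)
    qed
    ultimately show ?thesis using \<open>card S = k\<close> by (metis card_image card_mono finite)
  qed
  have M_V: "m * v \<in> V" if a0: "a0 \<in> A" and m: "m \<in> M a0" and v: "v \<in> V" for a0 m v
    unfolding V_iff
  proof
    fix x assume "x \<in> A"
    have "(\<lambda>x. a0 + m * (x - a0)) ` A = A"
      by (rule endo_inj_surj) (use m in \<open>auto simp: inj_on_def M_def\<close>)
    then obtain x' where x': "x' \<in> A" "x = a0 + m * (x' - a0)" using \<open>x \<in> A\<close> by blast
    have "x' + v \<in> A" using v x'(1) V_iff by blast
    then have "a0 + m * (x' + v - a0) \<in> A" using m by (simp add: M_def)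
    then show "x + m * v \<in> A" unfolding x'(2) by (simp add: algebra_simps)
  qed
  have M_eq: "(\<lambda>m. m * v0) ` M a0 = V - {0}" if a0: "a0 \<in> A" for a0
  proof (rule card_seteq)
    show "(\<lambda>m. m * v0) ` M a0 \<subseteq> V - {0}" using M_V[OF a0 _ v0(1)] v0(2) by (auto simp: M_def)
    have "card ((\<lambda>m. m * v0) ` M a0) = card (M a0)"
      by (rule card_image) (use v0(2) in \<open>simp add: inj_on_def\<close>)
    then show "card (V - {0}) \<le> card ((\<lambda>m. m * v0) ` M a0)"
      using card_M[OF a0] cV0 by simp
  qed simp
  define K where "K = (\<lambda>v. v / v0) ` V"
  have K_iff: "x \<in> K \<longleftrightarrow> x * v0 \<in> V" for x
    using v0(2) by (auto simp: K_def image_iff intro!: bexI[of _ "x * v0"])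
  have M_K: "m \<in> M a0 \<longleftrightarrow> m \<in> K \<and> m \<noteq> 0" if a0: "a0 \<in> A" for a0 m
  proof -
    have "m \<in> M a0 \<longleftrightarrow> m * v0 \<in> (\<lambda>m. m * v0) ` M a0" using v0(2) by auto
    then show ?thesis unfolding M_eq[OF a0] using v0(2) by (simp add: K_iff)
  qed
  obtain a0 where a0: "a0 \<in> A" using False by blast
  have K_V: "x * v \<in> V" if "x \<in> K" "v \<in> V" for x v
    using that M_V[OF a0] M_K[OF a0] V_subgroup(1) by (cases "x = 0") auto
  have K_sub: "subfield_set K"
    unfolding subfield_set_def
  proof (intro conjI ballI)
    show "1 \<in> K" using v0 by (simp add: K_iff)
    fix x y assume xy: "x \<in> K" "y \<in> K"
    show "x - y \<in> K" using xy V_subgroup(2) by (simp add: K_iff left_diff_distrib)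
    show "x * y \<in> K" using K_V[of x "y * v0"] xy by (simp add: K_iff mult.assoc)
  next
    fix x assume x: "x \<in> K"
    show "inverse x \<in> K"
    proof (cases "x = 0")
      case False
      have "(\<lambda>v. x * v) ` V = V"
        by (rule endo_inj_surj) (use False K_V[OF x] in \<open>auto simp: inj_on_def\<close>)
      then obtain v where v: "v \<in> V" "x * v = v0" using v0(1) by (metis imageE)
      then have "inverse x * v0 = v" using False by auto
      then show ?thesis using v by (simp add: K_iff)
    qed (use V_subgroup(1) in \<open>simp add: K_iff\<close>)
  qed
  note Kc = subfield_setD[OF K_sub]
  have cK: "card K = Suc k"
    unfolding K_def using cV v0(2) by (subst card_image) (auto simp: inj_on_def)
  have A_diff: "a1 - a0 \<in> V" if a1: "a1 \<in> A" for a1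
  proof -
    have m1: "-1 \<in> M z" if "z \<in> A" for z using M_K[OF that] Kc(2,3) by simp
    \<comment> \<open>The product of the reflections in a0 and a1 is the translation by 2 (a1 - a0).\<close>
    have "x + 2 * (a1 - a0) \<in> A" if "x \<in> A" for x
    proof -
      have "a0 + (-1) * (x - a0) \<in> A" using m1[OF a0] that unfolding M_def by blast
      then have "a1 + (-1) * (a0 + (-1) * (x - a0) - a1) \<in> A" using m1[OF a1] unfolding M_def by blast
      then show ?thesis by (simp add: algebra_simps)
    qed
    then have "2 * (a1 - a0) \<in> V" using V_iff by blast
    moreover have "inverse 2 \<in> K" using Kc(7)[OF Kc(4)[OF Kc(2) Kc(2)]] by simp
    ultimately have "inverse 2 * (2 * (a1 - a0)) \<in> V" using K_V by blast
    then show ?thesis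
      using two_nonzero by (simp only: mult.assoc[symmetric] left_inverse not_False_eq_True mult_1_left)
  qed
  \<comment> \<open>The affine coordinate s identifies A with K.\<close>
  have A_iff: "a0 + v0 * s \<in> A \<longleftrightarrow> s \<in> K" for s
  proof
    assume "a0 + v0 * s \<in> A"
    from A_diff[OF this] show "s \<in> K" by (simp add: K_iff mult.commute)
  next
    assume "s \<in> K"
    then have "s * v0 \<in> V" by (simp add: K_iff)
    from V_translates[OF this a0] show "a0 + v0 * s \<in> A" by (simp add: mult.commute)
  qed
  have "A = (\<lambda>v. a0 + v) ` V"
  proof
    show "A \<subseteq> (\<lambda>v. a0 + v) ` V"
    proof
      fix x assume "x \<in> A"
      then show "x \<in> (\<lambda>v. a0 + v) ` V" using A_diff[of x] by (intro image_eqI[of _ _ "x - a0"]) auto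
    qed
    show "(\<lambda>v. a0 + v) ` V \<subseteq> A" using V_translates a0 by auto
  qed
  then have "card A = Suc k" using cV by (simp add: card_image inj_on_def)
  then have sq: "(card K)\<^sup>2 = q" using dL dL' cK by (simp add: power2_eq_square)
  have "\<exists>l. l \<noteq> 0 \<and> l * (a i * v0\<^sup>2) \<in> K \<and> l * (v0 * (a i * a0 + b i)) \<in> K
       \<and> l * (a i * a0\<^sup>2 + 2 * b i * a0 + c i) \<in> K" if i: "i \<in> I" for i
  proof -
    define a' b' c' where "a' = a i * v0\<^sup>2" and "b' = v0 * (a i * a0 + b i)"
      and "c' = a i * a0\<^sup>2 + 2 * b i * a0 + c i"
    have r: "s \<in> K" if "s' \<in> K" "a' * s * s' + b' * (s + s') + c' = 0" for s s'
    proof -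
      have "a' * s * s' + b' * (s + s') + c' =
        a i * (a0 + v0 * s) * (a0 + v0 * s') + b i * (a0 + v0 * s + (a0 + v0 * s')) + c i"
        by (simp add: a'_def b'_def c'_def algebra_simps power2_eq_square)
      then show ?thesis using root[OF i, of "a0 + v0 * s'" "a0 + v0 * s"] that A_iff by simp
    qed
    \<comment> \<open>The element that the line pairs with 0.\<close>
    have r0: "- c' / b' \<in> K" if "b' \<noteq> 0"
      by (rule r[OF Kc(1)]) (use that in simp)
    have "\<exists>l. l \<noteq> 0 \<and> l * a' \<in> K \<and> l * b' \<in> K \<and> l * c' \<in> K"
    proof (cases "a' = 0")
      case True
      then have "a i = 0" using v0(2) by (simp add: a'_def)
      then have "b' \<noteq> 0" using a_zero_b_nonzero[OF i] v0(2) by (simp add: b'_def)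
      then have "c' / b' \<in> K" using Kc(3)[OF r0] by simp
      then show ?thesis using True \<open>b' \<noteq> 0\<close> Kc(1,2)
        by (intro exI[of _ "inverse b'"]) (simp add: divide_inverse mult.commute)
    next
      case False
      then have "a i \<noteq> 0" by (auto simp: a'_def)
      then have "- b i / a i \<in> A" using top_root[OF i] by blast
      moreover have "a0 + v0 * (- (b' / a')) = - b i / a i"
        using \<open>a i \<noteq> 0\<close> v0(2) by (simp add: a'_def b'_def field_simps power2_eq_square)
      ultimately have "- (b' / a') \<in> K" using A_iff by metis
      from Kc(3)[OF this] have ba: "b' / a' \<in> K" by simp
      have "c' / a' \<in> K"
      proof (cases "b' = 0")
        case True
        have "- c' / a' \<in> K" by (rule r[OF Kc(2)]) (use False True in simp)
        from Kc(3)[OF this] show ?thesis by simp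
      next
        case False
        have "c' / b' \<in> K" using Kc(3)[OF r0[OF False]] by simp
        from Kc(6)[OF this ba] show ?thesis using False by simp
      qed
      then show ?thesis using False ba Kc(2)
        by (intro exI[of _ "inverse a'"]) (simp add: divide_inverse mult.commute)
    qed
    then show ?thesis unfolding a'_def b'_def c'_def .
  qed
  then show ?thesis using K_sub sq v0(2) by blast
qed

end

section \<open>How many lines pass through a conic point\<close>

text \<open>
  Summing the binomial coefficients gives m^2 - m + 1 = 0 in the field. If m > 2, then (m choose 2) = m
  gives m = 3 and hence 7 = 0, both in the field. If m > 3 as an integer, (m choose 3) = m adds 12 = 0, which is impossible in
  odd characteristic.
\<close>

lemma multiplicity_arith:
  fixes m :: nat
  assumes two: "(2::'b::field) \<noteq> 0" and m: "m \<ge> 2"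
    and mid: "\<And>j. 0 < j \<Longrightarrow> j < m \<Longrightarrow> (of_nat (m choose j) :: 'b) = of_nat m"
    and pow: "(2::'b) ^ m = 1"
  shows "m = 2 \<and> (3::'b) = 0 \<or> m = 3 \<and> (7::'b) = 0"
proof -
  define x where "x = (of_nat m :: 'b)"
  have x1: "of_nat (m - 1) = x - 1" using m by (simp add: x_def of_nat_diff)
  have x2: "of_nat (m - 2) = x - 2" using m by (simp add: x_def of_nat_diff)
  have "1 = (of_nat (\<Sum>j\<le>m. m choose j) :: 'b)" using pow by (simp add: choose_row_sum)
  also have "\<dots> = (\<Sum>j\<le>m. of_nat (m choose j))" by simp
  also have "{..m} = insert 0 (insert m {0<..<m})" using m by auto
  also have "(\<Sum>j\<in>insert 0 (insert m {0<..<m}). of_nat (m choose j))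
    = 2 + (\<Sum>j\<in>{0<..<m}. of_nat (m choose j) :: 'b)" using m by simp
  also have "(\<Sum>j\<in>{0<..<m}. of_nat (m choose j) :: 'b) = (\<Sum>j\<in>{0<..<m}. x)"
    by (rule sum.cong) (auto simp: mid x_def)
  also have "\<dots> = (x - 1) * x" using x1 by simp
  finally have quad: "x * x - x + 1 = 0" by (simp add: algebra_simps)
  show ?thesis
  proof (cases "m = 2")
    case True
    then have "x = 2" by (simp add: x_def)
    then show ?thesis using quad True by simp
  next
    case False
    have "2 * (m choose 2) = m * (m - 1)"
      using times_binomial_minus1_eq[of 2 m] by simp
    then have "of_nat (2 * (m choose 2)) = (of_nat (m * (m - 1)) :: 'b)" by simp
    then have c2: "2 * x = x * (x - 1)"
      using mid[of 2] m False x1 by (simp only: of_nat_mult) (simp add: x_def)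
    have x0: "x \<noteq> 0" using quad by auto
    have "x * 2 = x * (x - 1)" using c2 by (simp only: mult.commute)
    then have "2 = x - 1" using mult_left_cancel[OF x0] by blast
    then have x3: "x = 3" by (metis diff_add_cancel one_plus_numeral add.commute one_add_one numeral_plus_one semiring_norm(5))
    have seven: "(7::'b) = 0" using quad unfolding x3 by simp
    show ?thesis
    proof (cases "m = 3")
      case False
      have "3 * (m choose 3) = m * ((m - 1) choose 2)" "2 * ((m - 1) choose 2) = (m - 1) * (m - 2)"
        using times_binomial_minus1_eq[of 3 m] times_binomial_minus1_eq[of 2 "m - 1"]
        by (simp_all add: numeral_2_eq_2 numeral_3_eq_3)
      then have "2 * (3 * (m choose 3)) = m * ((m - 1) * (m - 2))" by (simp only: mult.left_commute)
      then have "of_nat (2 * (3 * (m choose 3))) = (of_nat (m * ((m - 1) * (m - 2))) :: 'b)" by simp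
      then have "2 * (3 * x) = x * ((x - 1) * (x - 2))"
        using mid[of 3] m \<open>m \<noteq> 2\<close> False x1 x2 by (simp only: of_nat_mult) (simp add: x_def)
      then have "(18::'b) = 6" unfolding x3 by simp
      then have "(18::'b) - 6 = 0" by simp
      then have "(12::'b) = 0" by simp
      moreover have "(2::'b) = 2 * 7 - 12" by simp
      ultimately have "(2::'b) = 0" using seven by simp
      then show ?thesis using two by simp
    qed (use seven in simp)
  qed
qed

context apolar_partition
begin

text \<open>
  The number of lines through the conic point with parameter u.
\<close>

definition mult :: "'a \<Rightarrow> nat" where "mult u = card {i \<in> I. poly (Q i) u = 0}"

lemma poly_theta [simp]: "poly theta u = 0" by (simp add: theta_def poly_monom)

lemma poly_F: "poly (F i) u = poly (Q i) u" unfolding F_minus_Q by simp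

lemma mult_0_iff: "hyp = I \<Longrightarrow> poly G u = 0 \<longleftrightarrow> mult u \<noteq> 0"
  using finite_I by (auto simp: G_def poly_prod mult_def)

lemma card_roots_Q:
  assumes "i \<in> hyp"
  shows "card {u. poly (Q i) u = 0} = (if a i = 0 then 1 else 2)"
proof (cases "a i = 0")
  case True
  have iI: "i \<in> I" using assms by (simp add: hyp_def)
  have "2 * b i \<noteq> 0" using a_zero_b_nonzero[OF iI True] two_nonzero by simp
  moreover have "poly (smult k [:- w, 1:]) u = 0 \<longleftrightarrow> u = w" if "k \<noteq> 0" for k w u :: 'a
    using that by auto
  ultimately have "{u. poly (Q i) u = 0} = {- c i / (2 * b i)}"
    unfolding Q_linear[OF iI True] by blast
  then show ?thesis using True by simp
next
  case False
  obtain u v where uv: "u \<noteq> v" "Q i = smult (a i) ([:-u, 1:] * [:-v, 1:])" using Q_split[OF assms False] .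
  have "{u. poly (Q i) u = 0} = {u, v}" unfolding uv(2) poly_smult poly_mult using False by auto
  then show ?thesis using False uv(1) by simp
qed

text \<open>
  Every secant contains two conic points.
\<close>

lemma sum_mult:
  assumes "hyp = I"
  shows "(\<Sum>u\<in>UNIV. mult u) + k_inf = 2 * card I"
proof -
  have "(\<Sum>u\<in>UNIV. mult u) = (\<Sum>u\<in>UNIV. \<Sum>i\<in>I. if poly (Q i) u = 0 then 1 else 0)"
    using finite_I by (simp add: mult_def sum.If_cases Int_def)
  also have "\<dots> = (\<Sum>i\<in>I. \<Sum>u\<in>UNIV. if poly (Q i) u = 0 then 1 else 0)" by (rule sum.swap)
  also have "\<dots> = (\<Sum>i\<in>I. card {u. poly (Q i) u = 0})" by (simp add: sum.If_cases)
  also have "\<dots> = (\<Sum>i\<in>I. if a i = 0 then 1 else 2)"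
    using card_roots_Q assms by (intro sum.cong) auto
  finally have "(\<Sum>u\<in>UNIV. mult u) + k_inf
    = (\<Sum>i\<in>I. (if a i = 0 then 1 else 2) + (if a i = 0 then 1 else 0))"
    unfolding sum.distrib k_inf_def using finite_I by (simp add: sum.If_cases Int_def)
  also have "\<dots> = (\<Sum>i\<in>I. 2)" by (rule sum.cong) auto
  finally show ?thesis by simp
qed

context
  fixes \<kappa>
  assumes hyp_I: "hyp = I" and \<kappa>: "\<kappa> \<noteq> 0" "prod F I = smult \<kappa> (G * Dpoly)"
begin

text \<open>
  D takes the value 1 on the field, and F and Q agree there.
\<close>

lemma kappa_one: "mult u = 0 \<Longrightarrow> \<kappa> = 1"
proof -
  assume "mult u = 0"
  then have nz: "poly G u \<noteq> 0" using mult_0_iff[OF hyp_I] by blast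
  have "poly (prod F I) u = poly G u" by (simp add: G_def poly_prod poly_F hyp_I)
  then have "\<kappa> * poly G u = poly G u" unfolding \<kappa>(2) by simp
  then show ?thesis using nz by simp
qed

text \<open>
  At a simple root of both sides the derivatives are compared. The derivative of t^q is 0, so F
  contributes a t + b and Q contributes 2 (a t + b).
\<close>

lemma kappa_half: "mult u = 1 \<Longrightarrow> 2 * \<kappa> = 1"
proof -
  assume "mult u = 1"
  then obtain i where i: "{i \<in> I. poly (Q i) u = 0} = {i}"
    unfolding mult_def by (auto simp: card_1_singleton_iff)
  then have iI: "i \<in> I" and Qi: "poly (Q i) u = 0" by auto
  define R where "R = (\<Prod>j\<in>I - {i}. poly (Q j) u)"
  have R0: "R \<noteq> 0" unfolding R_def using i finite_I by auto
  have d: "a i * u + b i \<noteq> 0"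
  proof
    assume "a i * u + b i = 0"
    then have bi: "b i = - (a i * u)" by (simp add: add_eq_0_iff2)
    then have "c i = a i * u * u" using Qi by (simp add: Q_def algebra_simps)
    then show False using nontangent[OF iI] bi by (simp add: power2_eq_square)
  qed
  have pF: "prod F I = F i * prod F (I - {i})" and pG: "G = Q i * prod Q (I - {i})"
    using iI finite_I by (simp_all add: prod.remove G_def hyp_I)
  have "pderiv (monom 1 q :: 'a poly) = 0" by (simp add: pderiv_monom)
  then have dF: "poly (pderiv (F i)) u = a i * u + b i"
    by (simp add: F_def pderiv_add pderiv_mult pderiv_smult poly_monom pderiv_pCons)
  have "poly (pderiv (prod F I)) u = (a i * u + b i) * R"
    unfolding pF using Qi by (simp add: pderiv_mult poly_F dF R_def poly_prod)
  moreover have "poly (pderiv (smult \<kappa> (G * Dpoly))) u = \<kappa> * (2 * (a i * u + b i) * R)"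
    unfolding pG using Qi
    by (simp add: pderiv_smult pderiv_mult R_def poly_prod) (simp add: Q_def pderiv_pCons algebra_simps)
  ultimately have "\<kappa> * (2 * (a i * u + b i) * R) = (a i * u + b i) * R" unfolding \<kappa>(2) by simp
  then have "(2 * \<kappa>) * ((a i * u + b i) * R) = 1 * ((a i * u + b i) * R)" by (simp add: mult_ac)
  then show ?thesis using d R0 by (simp only: mult_cancel_right) simp
qed

text \<open>
  The case of \<open>kappa_one\<close> for the point (1, 0, 0), where values become leading coefficients.
\<close>

lemma kappa_one_inf: "k_inf = 0 \<Longrightarrow> \<kappa> = 1"
proof -
  assume "k_inf = 0"
  then have a: "a i \<noteq> 0" if "i \<in> I" for i using that finite_I by (auto simp: k_inf_def)
  have "lead_coeff (F i) = a i" if "i \<in> I" for i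
  proof -
    have "degree (monom 1 q * [:b i, a i:]) = q + 1"
      using a[OF that] by (subst degree_mult_eq) (auto simp: degree_monom_eq)
    then have "degree [:c i, b i:] < degree (monom 1 q * [:b i, a i:])" using q_gt_3 by simp
    then have "lead_coeff (F i) = lead_coeff (monom 1 q * [:b i, a i:])"
      unfolding F_def by (rule lead_coeff_add_le)
    then show ?thesis using a[OF that] unfolding lead_coeff_mult by (simp add: lead_coeff_monom degree_monom_eq)
  qed
  then have "lead_coeff (prod F I) = prod a I" unfolding lead_coeff_prod by (intro prod.cong) auto
  moreover have "lead_coeff G = prod a I"
    unfolding G_def hyp_I lead_coeff_prod using a by (intro prod.cong) (auto simp: Q_def)
  ultimately have "\<kappa> * prod a I = prod a I"
    unfolding \<kappa>(2) lead_coeff_smult lead_coeff_mult lead_coeff_Dpoly by simp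
  moreover have "prod a I \<noteq> 0" using a finite_I by simp
  ultimately show ?thesis by simp
qed

end

lemma coeff_G_Dpoly:
  "coeff (G * Dpoly) n = (\<Sum>i<Suc q. if n < (q - 1) * i then 0 else coeff G (n - (q - 1) * i))"
proof -
  have "G * Dpoly = (\<Sum>i<Suc q. monom 1 ((q - 1) * i) * G)"
    unfolding Dpoly_def sum_distrib_left by (simp add: monom_power mult.commute)
  then show ?thesis by (simp only: coeff_sum coeff_monom_mult mult_1_left)
qed

text \<open>
  On the line y = s t through the origin, each line through the conic point (0, 0, 1) contributes the
  factor b (1 + s) t to lowest order.
\<close>

lemma coeff_P_line:
  "coeff (poly P [:0, s:]) (mult 0)
    = (\<Prod>i\<in>{i \<in> I. c i = 0}. b i) * (\<Prod>i\<in>{i \<in> I. c i \<noteq> 0}. c i) * (1 + s) ^ mult 0"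
proof -
  let ?Z = "{i \<in> I. c i = 0}" and ?N = "{i \<in> I. c i \<noteq> 0}"
  let ?f = "\<lambda>i. [:c i, b i * (1 + s), a i * s:]"
  have m: "mult 0 = card ?Z" by (simp add: mult_def Q_def)
  have "poly P [:0, s:] = prod ?f I"
    unfolding poly_P by (rule prod.cong) (auto simp: algebra_simps)
  also have "\<dots> = prod ?f ?Z * prod ?f ?N"
  proof -
    have "I = ?Z \<union> ?N" by auto
    then show ?thesis using finite_I by (metis (no_types, lifting) prod.union_disjoint
      Collect_disj_eq disjoint_iff finite_Un mem_Collect_eq)
  qed
  also have "prod ?f ?Z = (\<Prod>i\<in>?Z. monom 1 1 * [:b i * (1 + s), a i * s:])"
    by (rule prod.cong) (auto simp: monom_altdef)
  also have "\<dots> = monom 1 (mult 0) * (\<Prod>i\<in>?Z. [:b i * (1 + s), a i * s:])"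
    unfolding prod.distrib m by (simp add: monom_power)
  finally have "poly P [:0, s:] = monom 1 (mult 0) * ((\<Prod>i\<in>?Z. [:b i * (1 + s), a i * s:]) * prod ?f ?N)"
    by (simp only: mult.assoc)
  then have "coeff (poly P [:0, s:]) (mult 0) = coeff ((\<Prod>i\<in>?Z. [:b i * (1 + s), a i * s:]) * prod ?f ?N) 0"
    by (simp add: coeff_monom_mult)
  also have "\<dots> = poly ((\<Prod>i\<in>?Z. [:b i * (1 + s), a i * s:]) * prod ?f ?N) 0"
    by (simp only: poly_0_coeff_0)
  also have "\<dots> = (\<Prod>i\<in>?Z. b i * (1 + s)) * (\<Prod>i\<in>?N. c i)" by (simp add: poly_prod)
  also have "\<dots> = (\<Prod>i\<in>?Z. b i) * (\<Prod>i\<in>?N. c i) * (1 + s) ^ mult 0"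
    by (simp add: prod.distrib m mult_ac)
  finally show ?thesis .
qed

lemma coeff_poly_line:
  fixes f :: "'a poly poly"
  shows "coeff (poly f [:0, s:]) m = (\<Sum>j\<le>m. coeff (coeff f j) (m - j) * s ^ j)"
proof -
  have l: "[:0, s:] = monom s 1" by (simp add: monom_altdef)
  have "poly f [:0, s:] = (\<Sum>j\<le>degree f. coeff f j * [:0, s:] ^ j)" by (rule poly_altdef)
  also have "\<dots> = (\<Sum>j\<le>degree f + m. coeff f j * [:0, s:] ^ j)"
    by (rule sum.mono_neutral_left) (auto simp: coeff_eq_0)
  also have "\<dots> = (\<Sum>j\<le>degree f + m. monom (s ^ j) j * coeff f j)"
    unfolding l by (simp add: monom_power mult.commute)
  finally have "coeff (poly f [:0, s:]) m
    = (\<Sum>j\<le>degree f + m. if m < j then 0 else s ^ j * coeff (coeff f j) (m - j))"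
    by (simp only: coeff_sum coeff_monom_mult)
  also have "\<dots> = (\<Sum>j\<le>m. coeff (coeff f j) (m - j) * s ^ j)"
    by (rule sum.mono_neutral_cong_right) (auto simp: mult.commute)
  finally show ?thesis .
qed

text \<open>
  The lowest form of P at the origin is a multiple of (t + y)^m. The identity of polynomials in s
  follows from its values, since m < q.
\<close>

lemma mult_pos_imp_coeffs:
  assumes m: "mult 0 < q"
  obtains k0 where "k0 \<noteq> 0"
    "\<And>j. j \<le> mult 0 \<Longrightarrow> coeff (coeff P j) (mult 0 - j) = k0 * of_nat (mult 0 choose j)"
    "coeff (poly P [:0, 1:]) (mult 0) = k0 * 2 ^ mult 0"
proof -
  define k0 where "k0 = (\<Prod>i\<in>{i \<in> I. c i = 0}. b i) * (\<Prod>i\<in>{i \<in> I. c i \<noteq> 0}. c i)"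
  let ?m = "mult 0"
  have "b i \<noteq> 0" if "i \<in> I" "c i = 0" for i using nontangent[OF that(1)] that(2) by auto
  then have "k0 \<noteq> 0" unfolding k0_def using finite_I by auto
  moreover have "coeff (coeff P j) (?m - j) = k0 * of_nat (?m choose j)" if j: "j \<le> ?m" for j
  proof -
    let ?f = "(\<Sum>j\<le>?m. monom (coeff (coeff P j) (?m - j)) j) - smult k0 ([:1, 1:] ^ ?m)"
    have roots: "poly ?f s = 0" for s
      using coeff_poly_line[of P s ?m] coeff_P_line[of s]
      by (simp add: poly_sum poly_monom k0_def)
    have deg: "degree ?f \<le> ?m"
    proof (rule degree_diff_le)
      show "degree (\<Sum>j\<le>?m. monom (coeff (coeff P j) (?m - j)) j) \<le> ?m"
        by (rule degree_sum_le) (auto intro: order_trans[OF degree_monom_le])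
      have "degree ([:1, 1::'a:] ^ ?m) \<le> ?m" using degree_power_le[of "[:1, 1::'a:]" ?m] by simp
      then show "degree (smult k0 ([:1, 1:] ^ ?m)) \<le> ?m" using order_trans[OF degree_smult_le] by blast
    qed
    have "?f = 0"
    proof (rule ccontr)
      assume nz: "?f \<noteq> 0"
      have "card {s. poly ?f s = 0} \<le> degree ?f" by (rule card_poly_roots_bound[OF nz])
      then show False using deg m roots q_card by simp
    qed
    then have "coeff ?f j = 0" by simp
    then show ?thesis using j by (simp add: coeff_sum coeff_linear_poly_power)
  qed
  moreover have "coeff (poly P [:0, 1:]) ?m = k0 * 2 ^ ?m"
    using coeff_P_line[of 1] by (simp add: k0_def)
  ultimately show ?thesis by (rule that)
qed

end

section \<open>Every conic point lies on a line when there are q lines\<close>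

context apolar_partition
begin

lemma translate:
  fixes u :: 'a
  defines "b' \<equiv> \<lambda>i. a i * u + b i" and "c' \<equiv> \<lambda>i. a i * u\<^sup>2 + 2 * b i * u + c i"
  shows "apolar_partition q I a b' c'" "apolar_partition.mult I a b' c' s = mult (u + s)"
proof -
  have "apolar_partition q I (\<lambda>i. a i * 1\<^sup>2 + 2 * b i * 1 * 0 + c i * 0\<^sup>2)
    (\<lambda>i. a i * 1 * u + b i * (1 * 1 + u * 0) + c i * 0 * 1)
    (\<lambda>i. a i * u\<^sup>2 + 2 * b i * u * 1 + c i * 1\<^sup>2)"
    by (rule transform) simp
  then show c: "apolar_partition q I a b' c'" by (simp add: b'_def c'_def)
  interpret t: apolar_partition q T I a b' c' by (rule c)
  have "poly (t.Q i) s = poly (Q i) (u + s)" for i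
    unfolding t.Q_def Q_def by (simp add: b'_def c'_def power2_eq_square algebra_simps)
  then show "apolar_partition.mult I a b' c' s = mult (u + s)" by (simp add: t.mult_def mult_def)
qed

text \<open>
  The substitution t = u - 1 / s moves the parameter u to infinity and infinity to 0.
\<close>

lemma move_to_inf:
  fixes u :: 'a
  defines "a' \<equiv> \<lambda>i. a i * u\<^sup>2 + 2 * b i * u + c i" and "b' \<equiv> \<lambda>i. - (a i * u + b i)"
  shows "apolar_partition q I a' b' a" "apolar_partition.k_inf I a' = mult u"
    "apolar_partition.mult I a' b' a s = (if s = 0 then k_inf else mult (u - 1 / s))"
proof -
  have "apolar_partition q I (\<lambda>i. a i * u\<^sup>2 + 2 * b i * u * 1 + c i * 1\<^sup>2)
    (\<lambda>i. a i * u * (-1) + b i * (u * 0 + (-1) * 1) + c i * 1 * 0)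
    (\<lambda>i. a i * (-1)\<^sup>2 + 2 * b i * (-1) * 0 + c i * 0\<^sup>2)"
    by (rule transform) simp
  then show c: "apolar_partition q I a' b' a" by (simp add: b'_def a'_def)
  interpret t: apolar_partition q T I a' b' a by (rule c)
  have "poly (Q i) u = a' i" for i by (simp add: Q_def a'_def power2_eq_square algebra_simps)
  then show "apolar_partition.k_inf I a' = mult u" by (simp add: t.k_inf_def mult_def)
  show "apolar_partition.mult I a' b' a s = (if s = 0 then k_inf else mult (u - 1 / s))"
  proof (cases "s = 0")
    case True
    then show ?thesis by (simp add: t.mult_def k_inf_def t.Q_def)
  next
    case False
    have "poly (t.Q i) s = s\<^sup>2 * poly (Q i) (u - 1 / s)" for i
      using False unfolding t.Q_def Q_def by (simp add: a'_def b'_def power2_eq_square field_simps)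
    then show ?thesis using False by (simp add: t.mult_def mult_def)
  qed
qed

text \<open>
  The lines through a conic point meet the conic again in distinct points. Each of these lies on a
  second line, and there are 2 q incidences in total.
\<close>

lemma mult_bound:
  assumes h: "hyp = I" and card: "card I = q" and k: "k_inf = 0" and no1: "\<And>u. mult u \<noteq> 1"
  shows "3 * mult 0 \<le> 2 * q"
proof -
  define S where "S = {i \<in> I. c i = 0}"
  have m: "mult 0 = card S" by (simp add: mult_def Q_def S_def)
  define e where "e = (\<lambda>i. - (2 * b i) / a i)"
  have nz: "a i \<noteq> 0" "b i \<noteq> 0" if "i \<in> S" for i
    using that k finite_I nontangent[of i] by (auto simp: S_def k_inf_def)
  have "inj_on e S"
  proof (rule inj_onI)
    fix i j assume ij: "i \<in> S" "j \<in> S" "e i = e j"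
    have "2 * (b i / a i) = 2 * (b j / a j)" using ij(3) by (simp add: e_def)
    then have "b i / a i = b j / a j" using mult_left_cancel[OF two_nonzero] by blast
    then show "i = j" using ij nz[OF ij(1)] nz[OF ij(2)]
      by (intro lines_distinct[where k = "a j / a i"]) (auto simp: S_def field_simps)
  qed
  then have cE: "card (e ` S) = mult 0" by (simp add: card_image m)
  have two: "2 \<le> mult w" if w: "w \<in> e ` S" for w
  proof -
    obtain i where i: "i \<in> S" "w = e i" using w by (elim imageE)
    have "poly (Q i) w = 0" using i nz[OF i(1)]
      by (simp add: Q_def S_def e_def field_simps)
    then have "{i \<in> I. poly (Q i) w = 0} \<noteq> {}" using i by (auto simp: S_def)
    then have "mult w \<noteq> 0" using finite_I by (simp add: mult_def)
    then show ?thesis using no1[of w] by linarith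
  qed
  have "0 \<notin> e ` S" using nz two_nonzero by (auto simp: e_def)
  then have "(\<Sum>w\<in>insert 0 (e ` S). mult w) = mult 0 + (\<Sum>w\<in>e ` S. mult w)" by simp
  moreover have "(\<Sum>w\<in>e ` S. 2) \<le> (\<Sum>w\<in>e ` S. mult w)" by (rule sum_mono) (rule two)
  moreover have "(\<Sum>w\<in>e ` S. 2) = 2 * card (e ` S)" by simp
  ultimately have "3 * mult 0 \<le> (\<Sum>w\<in>insert 0 (e ` S). mult w)" using cE by linarith
  also have "\<dots> \<le> (\<Sum>w\<in>UNIV. mult w)" by (rule sum_mono2) auto
  also have "\<dots> = 2 * q" using sum_mult[OF h] k card by simp
  finally show ?thesis .
qed

lemma G_Dpoly_coeff:
  assumes "0 < k" "k < q" "card I = q" "prod F I = G * Dpoly"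
  shows "coeff (coeff P j) k = coeff (G * Dpoly) (q * j + k)"
proof -
  have "degree (coeff P j) \<le> q" for j
    by (rule inner_degree_le[OF symmetric_P]) (use degree_P assms(3) in simp)
  from coeff_poly_monom_mid[OF this assms(1,2), of j] show ?thesis
    unfolding poly_P_frob assms(4) by simp
qed

text \<open>
  The exponent is m + (q - 1) j, so the terms t^((q-1) i) of D with i = j and i = j - 1 contribute, and
  the value is the same for all j between 1 and m - 1.
\<close>

lemma antidiagonal_coeff:
  assumes "j < m" "m < q - 1" "degree G \<le> 2 * q"
  shows "coeff (G * Dpoly) (q * j + (m - j)) = coeff G m + (if j = 0 then 0 else coeff G (m + (q - 1)))"
proof -
  let ?t = "\<lambda>i. if q * j + (m - j) < (q - 1) * i then 0 else coeff G (q * j + (m - j) - (q - 1) * i)"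
  have "q * j = (q - 1) * j + j" using q_gt_3 by (cases q) auto
  then have n: "q * j + (m - j) = m + (q - 1) * j" using assms(1) by simp
  let ?A = "if j = 0 then {0} else {j - 1, j}"
  have "(\<Sum>i<Suc q. ?t i) = (\<Sum>i\<in>?A. ?t i)"
  proof (rule sum.mono_neutral_right)
    show "?A \<subseteq> {..<Suc q}" using assms by auto
    show "\<forall>i\<in>{..<Suc q} - ?A. ?t i = 0"
    proof
      fix i assume "i \<in> {..<Suc q} - ?A"
      then consider "Suc j \<le> i" | "Suc (Suc i) \<le> j" by (auto split: if_splits) fastforce
      then show "?t i = 0"
      proof cases
        case 1
        then have "(q - 1) * Suc j \<le> (q - 1) * i" by (intro mult_le_mono) auto
        then have "q * j + (m - j) < (q - 1) * i" unfolding n using assms(2) by simp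
        then show ?thesis by simp
      next
        case 2
        then have "(q - 1) * Suc (Suc i) \<le> (q - 1) * j" by (intro mult_le_mono) auto
        moreover have "m \<ge> 3" using 2 assms(1) by linarith
        ultimately have "q * j + (m - j) - (q - 1) * i > 2 * q" unfolding n using q_gt_3 by simp
        then have "coeff G (q * j + (m - j) - (q - 1) * i) = 0" using assms(3) by (intro coeff_eq_0) linarith
        then show ?thesis by simp
      qed
    qed
  qed simp
  also have "\<dots> = coeff G m + (if j = 0 then 0 else coeff G (m + (q - 1)))"
  proof (cases j)
    case (Suc l)
    have "m + (q - 1) * Suc l - (q - 1) * l = m + (q - 1)" by simp
    moreover have "\<not> m + (q - 1) * Suc l < (q - 1) * l" by simp
    ultimately show ?thesis unfolding n unfolding Suc by simp
  qed (simp add: n)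
  finally show ?thesis unfolding coeff_G_Dpoly .
qed

text \<open>
  The coefficients of t^(m-j) y^j in P are multiples of (m choose j) by \<open>mult_pos_imp_coeffs\<close> and do not
  depend on j, for 0 < j < m, by \<open>antidiagonal_coeff\<close>. The case j = 0 and the identity P(t, t) = G give
  2^m = 1.
\<close>

lemma mult_classification:
  assumes h: "hyp = I" and card: "card I = q" and k: "k_inf = 0" and no1: "\<And>u. mult u \<noteq> 1"
    and m: "mult 0 \<ge> 2"
  shows "mult 0 = 2 \<and> (3::'a) = 0 \<or> mult 0 = 3 \<and> (7::'a) = 0"
proof -
  let ?m = "mult 0"
  obtain \<kappa> where \<kappa>: "\<kappa> \<noteq> 0" "prod F I = smult \<kappa> (G * Dpoly)" by (rule product_identity)
  have pF: "prod F I = G * Dpoly" using kappa_one_inf[OF h \<kappa> k] \<kappa>(2) by simp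
  have dG: "degree G \<le> 2 * q" using degree_G h card by simp
  have mb: "?m < q - 1" using mult_bound[OF h card k no1] q_gt_3 by linarith
  obtain k0 where k0: "k0 \<noteq> 0"
    "\<And>j. j \<le> ?m \<Longrightarrow> coeff (coeff P j) (?m - j) = k0 * of_nat (?m choose j)"
    "coeff (poly P [:0, 1:]) ?m = k0 * 2 ^ ?m"
    using mult_pos_imp_coeffs[of thesis] mb by fastforce
  have co: "k0 * of_nat (?m choose j) = coeff G ?m + (if j = 0 then 0 else coeff G (?m + (q - 1)))"
    if "j < ?m" for j
    using k0(2)[of j] G_Dpoly_coeff[OF _ _ card pF, of "?m - j" j] antidiagonal_coeff[OF that mb dG] that mb
    by simp
  have c0: "k0 = coeff G ?m" using co[of 0] m by simp
  have "k0 * of_nat (?m choose j) = k0 * of_nat ?m" if "0 < j" "j < ?m" for j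
    using co[OF that(2)] co[of 1] that m by simp
  then have mid: "of_nat (?m choose j) = (of_nat ?m :: 'a)" if "0 < j" "j < ?m" for j
    using that k0(1) by simp
  have "poly P [:0, 1:] = G"
    unfolding poly_P G_def h by (rule prod.cong) (auto simp: Q_def)
  then have "k0 * 2 ^ ?m = k0 * 1" using k0(3) c0 by simp
  then have "(2::'a) ^ ?m = 1" using mult_left_cancel[OF k0(1)] by blast
  from multiplicity_arith[OF two_nonzero m mid this] show ?thesis .
qed

text \<open>
  Here G is a multiple of (t^q - t)^2. The coefficients of G D then show that P(t, 0) has degree at most
  2, while every line with b not 0 raises this degree by 1.
\<close>

lemma all_double:
  assumes h: "hyp = I" and card: "card I = q" and k: "k_inf = 0" and two: "\<And>u. mult u = 2"
  shows "q - 2 \<le> card {i \<in> I. b i = 0}"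
proof -
  obtain \<kappa> where \<kappa>: "\<kappa> \<noteq> 0" "prod F I = smult \<kappa> (G * Dpoly)" by (rule product_identity)
  have pF: "prod F I = G * Dpoly" using kappa_one_inf[OF h \<kappa> k] \<kappa>(2) by simp
  \<comment> \<open>Both lines through the conic point u contribute a factor t - u to G.\<close>
  have sq: "[:-u, 1:] * [:-u, 1:] dvd G" for u
  proof -
    obtain i j where ij: "{i \<in> I. poly (Q i) u = 0} = {i, j}" "i \<noteq> j"
      using two[of u] unfolding mult_def by (auto simp: card_2_iff)
    then have i: "i \<in> I" "[:-u, 1:] dvd Q i" and j: "j \<in> I - {i}" "[:-u, 1:] dvd Q j"
      by (auto simp: poly_eq_0_iff_dvd)
    have "prod Q I = Q i * (Q j * prod Q (I - {i} - {j}))"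
      using i(1) j(1) finite_I by (simp only: prod.remove[of I i] prod.remove[of "I - {i}" j] finite_Diff)
    moreover have "[:-u, 1:] * [:-u, 1:] dvd Q i * Q j" by (rule mult_dvd_mono[OF i(2) j(2)])
    ultimately show ?thesis unfolding G_def h by (simp only: mult.assoc[symmetric] dvd_mult2)
  qed
  have "theta dvd G"
    by (rule theta_dvdI) (use sq dvd_mult_left in \<open>simp only: poly_eq_0_iff_dvd, blast\<close>)
  then obtain r where r: "G = theta * r" ..
  have "theta dvd r"
  proof (rule theta_dvdI)
    fix u :: 'a
    define f where "f = (\<Prod>v\<in>UNIV - {u}. [:-v, 1:])"
    have th: "theta = [:-u, 1:] * f" unfolding f_def prod_linear[symmetric] by (rule prod.remove) auto
    have "[:-u, 1:] * [:-u, 1:] dvd [:-u, 1:] * (f * r)" using sq[of u] unfolding r th by (simp only: mult.assoc)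
    then have "[:-u, 1:] dvd f * r" by (subst (asm) dvd_mult_cancel_left) auto
    moreover have "poly f u \<noteq> 0" by (simp add: f_def poly_prod)
    ultimately show "poly r u = 0" unfolding poly_eq_0_iff_dvd[symmetric] by simp
  qed
  then obtain s where s: "r = theta * s" ..
  have nz: "theta \<noteq> 0" "s \<noteq> 0" using r s G_nonzero by auto
  have "degree G = 2 * q" using degree_G h card k by simp
  then have "degree s = 0" unfolding r s using nz by (simp add: degree_mult_eq degree_theta)
  then obtain l where l: "s = [:l:]" by (metis degree_eq_zeroE)
  have th: "theta = monom 1 q - monom 1 1" by (simp add: theta_def monom_altdef)
  have "smult 2 f = f + f" for f :: "'a poly" by (metis one_add_one smult_1_left smult_add_left)
  then have "(f - g) * (f - g) = f * f - smult 2 (f * g) + g * g" for f g :: "'a poly"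
    by (simp add: algebra_simps)
  from this[of "monom 1 q" "monom 1 1"]
  have "theta * theta = monom 1 (2 * q) - smult 2 (monom 1 (q + 1)) + monom 1 2"
    unfolding th mult_monom mult_2 one_add_one by simp
  then have G: "G = smult l (monom 1 (2 * q) - smult 2 (monom 1 (q + 1)) + monom 1 2)"
    unfolding r s l mult.assoc[symmetric] by simp
  have g0: "coeff G n = 0" if "n \<le> q" "n \<noteq> 2" for n
    unfolding G using that q_gt_3 by simp
  have GD: "coeff (G * Dpoly) n = 0" if "n \<le> q" "n \<noteq> 2" for n
    unfolding coeff_G_Dpoly
  proof (rule sum.neutral, rule ballI)
    fix i
    show "(if n < (q - 1) * i then 0 else coeff G (n - (q - 1) * i)) = 0"
    proof (cases "i = 0")
      case False
      then have "q - 1 \<le> (q - 1) * i" by simp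
      then have "n - (q - 1) * i \<le> 1" using that by linarith
      then have "coeff G (n - (q - 1) * i) = 0" using q_gt_3 by (intro g0) linarith+
      then show ?thesis by simp
    qed (use g0 that in simp)
  qed
  have sm: "coeff (coeff P j) n = 1 * coeff (coeff P n) j" for j n using symmetric_P by (simp add: eps_symmetric_def)
  have dP: "degree (coeff P j) \<le> q" for j
    by (rule inner_degree_le[OF symmetric_P]) (use degree_P card in simp)
  have mid: "coeff (coeff P 0) n = 0" if "0 < n" "n < q" "n \<noteq> 2" for n
    using G_Dpoly_coeff[OF that(1,2) card pF, of 0] GD that by simp
  have top: "coeff (coeff P 0) q = 0"
  proof -
    have "coeff (G * Dpoly) (q * Suc 0) = coeff (coeff P (Suc 0)) 0 + coeff (coeff P 0) q"
      using coeff_poly_monom_carry[OF dP, of 0] q_gt_3 unfolding poly_P_frob pF by simp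
    moreover have "coeff (coeff P (Suc 0)) 0 = 0" using sm[of 1 0] mid[of 1] q_gt_3 by simp
    ultimately show ?thesis using GD[of q] q_gt_3 by simp
  qed
  have "degree (coeff P 0) \<le> 2"
  proof (rule degree_le, intro allI impI)
    fix n :: nat assume "2 < n"
    then show "coeff (coeff P 0) n = 0"
      using mid[of n] top dP[of 0] by (cases n q rule: linorder_cases) (auto simp: coeff_eq_0)
  qed
  then have "degree (poly P [:0:]) \<le> 2" by (simp add: poly_0_coeff_0)
  then show ?thesis using degree_P_const[of 0] card by simp
qed

text \<open>
  If 3 is not 0 in the field, all multiplicities are 0 or 3, so 3 divides their sum 2 q, which is impossible. In
  characteristic 3 all multiplicities are 2. Then \<open>all_double\<close> at the parameters 0 and 1 yields two
  disjoint families of q - 2 lines each, more than there are.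
\<close>

lemma no_simple_point_impossible:
  assumes card: "card I = q" and k: "k_inf = 0" and no1: "\<And>u. mult u \<noteq> 1"
  shows False
proof -
  have h: "hyp = I" using card q_gt_3 by (cases rule: hyperbolic_count_cases) auto
  have hyp_cong: "apolar_partition.hyp I a (\<lambda>i. a i * u + b i) (\<lambda>i. a i * u\<^sup>2 + 2 * b i * u + c i) = I" for u
  proof -
    interpret t: apolar_partition q T I a "\<lambda>i. a i * u + b i" "\<lambda>i. a i * u\<^sup>2 + 2 * b i * u + c i"
      by (rule translate)
    show ?thesis using card q_gt_3 by (cases rule: t.hyperbolic_count_cases) auto
  qed
  have cl: "mult u = 2 \<and> (3::'a) = 0 \<or> mult u = 3 \<and> (7::'a) = 0" if "mult u \<noteq> 0" for u
  proof -
    interpret t: apolar_partition q T I a "\<lambda>i. a i * u + b i" "\<lambda>i. a i * u\<^sup>2 + 2 * b i * u + c i"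
      by (rule translate)
    have m: "t.mult s = mult (u + s)" for s by (rule translate)
    have "2 \<le> t.mult 0" using that no1[of u] m[of 0] by simp
    moreover have "t.k_inf = 0" using k by (simp add: t.k_inf_def k_inf_def)
    moreover have "t.mult s \<noteq> 1" for s using m no1 by simp
    ultimately show ?thesis using t.mult_classification[OF hyp_cong card] m[of 0] by simp
  qed
  have sum: "(\<Sum>u\<in>UNIV. mult u) = 2 * q" using sum_mult[OF h] card k by simp
  show False
  proof (cases "(3::'a) = 0")
    case False
    then have "\<forall>u. 3 dvd mult u" using cl by (metis dvd_0_right dvd_refl)
    then have "3 dvd (\<Sum>u\<in>UNIV. mult u)" by (intro dvd_sum) auto
    then have "3 dvd 2 * q" using sum by simp
    then have "3 dvd q" by presburger
    obtain n where n: "q = CHAR('a) ^ n" using q_power by blast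
    have p3: "prime (3::nat)" by (simp add: prime_nat_numeral_eq)
    have "3 dvd CHAR('a)" by (rule prime_dvd_power[OF p3]) (use \<open>3 dvd q\<close> n in simp)
    then have "CHAR('a) = 3" using primes_dvd_imp_eq[OF p3 prime_char] by simp
    then have "(of_nat 3 :: 'a) = 0" by (metis of_nat_CHAR)
    then show False using False by simp
  next
    case True
    have "(7::'a) = 2 * 3 + 1" by simp
    then have "(7::'a) \<noteq> 0" using True by simp
    then have le: "mult u \<le> 2" for u using cl[of u] by (cases "mult u = 0") auto
    have all: "mult u = 2" for u
    proof (rule ccontr)
      assume "mult u \<noteq> 2"
      then have "mult u < 2" using le[of u] by simp
      then have "(\<Sum>u\<in>UNIV. mult u) < (\<Sum>u\<in>(UNIV::'a set). 2)" by (intro sum_strict_mono_ex1) (auto simp: le)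
      then show False using sum q_card by simp
    qed
    have 1: "q - 2 \<le> card {i \<in> I. b i = 0}" by (rule all_double[OF h card k all])
    interpret t: apolar_partition q T I a "\<lambda>i. a i * 1 + b i" "\<lambda>i. a i * 1\<^sup>2 + 2 * b i * 1 + c i"
      by (rule translate)
    have "t.mult s = 2" for s using all by (subst translate) simp
    moreover have "t.k_inf = 0" using k by (simp add: t.k_inf_def k_inf_def)
    ultimately have 2: "q - 2 \<le> card {i \<in> I. a i * 1 + b i = 0}"
      by (intro t.all_double[OF hyp_cong card])
    have "{i \<in> I. b i = 0} \<inter> {i \<in> I. a i * 1 + b i = 0} = {}"
      using k finite_I by (auto simp: k_inf_def)
    then have "card ({i \<in> I. b i = 0} \<union> {i \<in> I. a i * 1 + b i = 0})
      = card {i \<in> I. b i = 0} + card {i \<in> I. a i * 1 + b i = 0}"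
      using finite_I by (intro card_Un_disjoint) auto
    moreover have "card ({i \<in> I. b i = 0} \<union> {i \<in> I. a i * 1 + b i = 0}) \<le> card I"
      using finite_I by (intro card_mono) auto
    ultimately have "2 * (q - 2) \<le> q" using 1 2 card by linarith
    then have "q = 4" using q_gt_3 by linarith
    then show False using odd_q by simp
  qed
qed

text \<open>
  A conic point on no line gives \<kappa> = 1. A further point on exactly one line would give 2 \<kappa> = 1, and
  without such a point \<open>no_simple_point_impossible\<close> applies.
\<close>

lemma full_case_multiple_inf:
  assumes card: "card I = q" and k: "k_inf \<ge> 2"
  shows "(\<forall>i\<in>I. a i = 0) \<or> (\<exists>K \<alpha> \<beta>. \<alpha> \<noteq> 0 \<and> subfield_set K \<and> (card K)\<^sup>2 = q \<and>
    (\<forall>i\<in>I. \<exists>l. l \<noteq> 0 \<and> l * (a i * \<alpha>\<^sup>2) \<in> K \<and> l * (\<alpha> * (a i * \<beta> + b i)) \<in> K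
       \<and> l * (a i * \<beta>\<^sup>2 + 2 * b i * \<beta> + c i) \<in> K))"
proof -
  have h: "hyp = I" using card q_gt_3 by (cases rule: hyperbolic_count_cases) auto
  obtain \<kappa> where \<kappa>: "\<kappa> \<noteq> 0" "prod F I = smult \<kappa> (G * Dpoly)" by (rule product_identity)
  have "mult v \<noteq> 0" for v
  proof
    assume v: "mult v = 0"
    show False
    proof (cases "\<exists>u. mult u = 1")
      case True
      then have "2 * \<kappa> = 1" "\<kappa> = 1" using kappa_half[OF h \<kappa>] kappa_one[OF h \<kappa> v] by auto
      then have "(2::'a) - 1 = 0" by simp
      then show False by simp
    next
      case False
      interpret t: apolar_partition q T I "\<lambda>i. a i * v\<^sup>2 + 2 * b i * v + c i" "\<lambda>i. - (a i * v + b i)" a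
        by (rule move_to_inf)
      have "t.k_inf = 0" using move_to_inf(2)[of v] v by simp
      moreover have "t.mult s \<noteq> 1" for s
        using False k by (subst move_to_inf(3)) auto
      ultimately show False by (rule t.no_simple_point_impossible[OF card])
    qed
  qed
  then show ?thesis using full_case_at_inf[OF card k] mult_0_iff[OF h] by blast
qed

text \<open>
  By counting incidences, some conic point lies on two lines and can be moved to infinity.
\<close>

lemma full_case:
  assumes card: "card I = q"
  shows "(\<exists>x y z. (x, y, z) \<noteq> (0, 0, 0) \<and> y\<^sup>2 = x * z \<and> (\<forall>i\<in>I. a i * x + 2 * b i * y + c i * z = 0))
    \<or> (\<exists>K \<alpha> \<beta> \<gamma> \<delta>. \<alpha> * \<delta> - \<beta> * \<gamma> \<noteq> 0 \<and> subfield_set K \<and> (card K)\<^sup>2 = q \<and>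
      (\<forall>i\<in>I. \<exists>l. l \<noteq> 0 \<and> l * (a i * \<alpha>\<^sup>2 + 2 * b i * \<alpha> * \<gamma> + c i * \<gamma>\<^sup>2) \<in> K
       \<and> l * (a i * \<alpha> * \<beta> + b i * (\<alpha> * \<delta> + \<beta> * \<gamma>) + c i * \<gamma> * \<delta>) \<in> K
       \<and> l * (a i * \<beta>\<^sup>2 + 2 * b i * \<beta> * \<delta> + c i * \<delta>\<^sup>2) \<in> K))"
    (is "?point \<or> ?baer")
proof (cases "k_inf \<ge> 2")
  case True
  from full_case_multiple_inf[OF card True] show ?thesis
  proof
    assume "\<forall>i\<in>I. a i = 0"
    then have ?point by (intro exI[of _ 1] exI[of _ 0]) auto
    then show ?thesis ..
  next
    assume "\<exists>K \<alpha> \<beta>. \<alpha> \<noteq> 0 \<and> subfield_set K \<and> (card K)\<^sup>2 = q \<and>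
    (\<forall>i\<in>I. \<exists>l. l \<noteq> 0 \<and> l * (a i * \<alpha>\<^sup>2) \<in> K \<and> l * (\<alpha> * (a i * \<beta> + b i)) \<in> K
       \<and> l * (a i * \<beta>\<^sup>2 + 2 * b i * \<beta> + c i) \<in> K)"
    then obtain K \<alpha> \<beta> where K: "\<alpha> \<noteq> 0" "subfield_set K" "(card K)\<^sup>2 = q"
      and l: "\<And>i. i \<in> I \<Longrightarrow> \<exists>l. l \<noteq> 0 \<and> l * (a i * \<alpha>\<^sup>2) \<in> K \<and> l * (\<alpha> * (a i * \<beta> + b i)) \<in> K
       \<and> l * (a i * \<beta>\<^sup>2 + 2 * b i * \<beta> + c i) \<in> K" by blast
    have ?baer
    proof (rule exI[of _ K], rule exI[of _ \<alpha>], rule exI[of _ \<beta>], rule exI[of _ 0], rule exI[of _ 1],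
        intro conjI ballI)
      fix i assume "i \<in> I"
      have e: "a i * \<alpha>\<^sup>2 + 2 * b i * \<alpha> * 0 + c i * 0\<^sup>2 = a i * \<alpha>\<^sup>2"
        "a i * \<alpha> * \<beta> + b i * (\<alpha> * 1 + \<beta> * 0) + c i * 0 * 1 = \<alpha> * (a i * \<beta> + b i)"
        "a i * \<beta>\<^sup>2 + 2 * b i * \<beta> * 1 + c i * 1\<^sup>2 = a i * \<beta>\<^sup>2 + 2 * b i * \<beta> + c i"
        by (simp_all add: algebra_simps)
      show "\<exists>l. l \<noteq> 0 \<and> l * (a i * \<alpha>\<^sup>2 + 2 * b i * \<alpha> * 0 + c i * 0\<^sup>2) \<in> K
       \<and> l * (a i * \<alpha> * \<beta> + b i * (\<alpha> * 1 + \<beta> * 0) + c i * 0 * 1) \<in> K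
       \<and> l * (a i * \<beta>\<^sup>2 + 2 * b i * \<beta> * 1 + c i * 1\<^sup>2) \<in> K"
        unfolding e by (rule l) fact
    qed (use K in auto)
    then show ?thesis ..
  qed
next
  case False
  have h: "hyp = I" using card q_gt_3 by (cases rule: hyperbolic_count_cases) auto
  \<comment> \<open>Otherwise there are at most q + 1 incidences between conic points and lines instead of 2 q.\<close>
  have "\<exists>u. mult u \<ge> 2"
  proof (rule ccontr)
    assume "\<not> ?thesis"
    then have "mult u \<le> 1" for u by (metis not_less_eq_eq numeral_2_eq_2 One_nat_def)
    then have "(\<Sum>u\<in>UNIV. mult u) \<le> (\<Sum>u\<in>(UNIV::'a set). 1)" by (intro sum_mono) auto
    then show False using sum_mult[OF h] card False q_card q_gt_3 by simp
  qed
  then obtain u where u: "mult u \<ge> 2" ..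
  interpret t: apolar_partition q T I "\<lambda>i. a i * u\<^sup>2 + 2 * b i * u + c i" "\<lambda>i. - (a i * u + b i)" a
    by (rule move_to_inf)
  have "t.k_inf \<ge> 2" using move_to_inf(2)[of u] u by simp
  from t.full_case_multiple_inf[OF card this] show ?thesis
  proof
    assume "\<forall>i\<in>I. a i * u\<^sup>2 + 2 * b i * u + c i = 0"
    then have ?point by (intro exI[of _ "u\<^sup>2"] exI[of _ u] exI[of _ 1]) auto
    then show ?thesis ..
  next
    assume "\<exists>K \<alpha> \<beta>. \<alpha> \<noteq> 0 \<and> subfield_set K \<and> (card K)\<^sup>2 = q \<and>
      (\<forall>i\<in>I. \<exists>l. l \<noteq> 0 \<and> l * ((a i * u\<^sup>2 + 2 * b i * u + c i) * \<alpha>\<^sup>2) \<in> K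
       \<and> l * (\<alpha> * ((a i * u\<^sup>2 + 2 * b i * u + c i) * \<beta> + - (a i * u + b i))) \<in> K
       \<and> l * ((a i * u\<^sup>2 + 2 * b i * u + c i) * \<beta>\<^sup>2 + 2 * - (a i * u + b i) * \<beta> + a i) \<in> K)"
    then obtain K \<alpha> \<beta> where K: "\<alpha> \<noteq> 0" "subfield_set K" "(card K)\<^sup>2 = q"
      and l: "\<And>i. i \<in> I \<Longrightarrow> \<exists>l. l \<noteq> 0 \<and> l * ((a i * u\<^sup>2 + 2 * b i * u + c i) * \<alpha>\<^sup>2) \<in> K
       \<and> l * (\<alpha> * ((a i * u\<^sup>2 + 2 * b i * u + c i) * \<beta> + - (a i * u + b i))) \<in> K
       \<and> l * ((a i * u\<^sup>2 + 2 * b i * u + c i) * \<beta>\<^sup>2 + 2 * - (a i * u + b i) * \<beta> + a i) \<in> K"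
      by blast
    let ?al = "u * \<alpha>" and ?be = "u * \<beta> - 1"
    have ?baer
    proof (rule exI[of _ K], rule exI[of _ ?al], rule exI[of _ ?be], rule exI[of _ \<alpha>], rule exI[of _ \<beta>],
        intro conjI ballI)
      show "?al * \<beta> - ?be * \<alpha> \<noteq> 0" using K(1) by (simp add: algebra_simps)
      fix i assume "i \<in> I"
      have e: "a i * ?al\<^sup>2 + 2 * b i * ?al * \<alpha> + c i * \<alpha>\<^sup>2 = (a i * u\<^sup>2 + 2 * b i * u + c i) * \<alpha>\<^sup>2"
        "a i * ?al * ?be + b i * (?al * \<beta> + ?be * \<alpha>) + c i * \<alpha> * \<beta>
          = \<alpha> * ((a i * u\<^sup>2 + 2 * b i * u + c i) * \<beta> + - (a i * u + b i))"
        "a i * ?be\<^sup>2 + 2 * b i * ?be * \<beta> + c i * \<beta>\<^sup>2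
          = (a i * u\<^sup>2 + 2 * b i * u + c i) * \<beta>\<^sup>2 + 2 * - (a i * u + b i) * \<beta> + a i"
        by (simp_all add: algebra_simps power2_eq_square)
      show "\<exists>l. l \<noteq> 0 \<and> l * (a i * ?al\<^sup>2 + 2 * b i * ?al * \<alpha> + c i * \<alpha>\<^sup>2) \<in> K
       \<and> l * (a i * ?al * ?be + b i * (?al * \<beta> + ?be * \<alpha>) + c i * \<alpha> * \<beta>) \<in> K
       \<and> l * (a i * ?be\<^sup>2 + 2 * b i * ?be * \<beta> + c i * \<beta>\<^sup>2) \<in> K"
        unfolding e by (rule l) fact
    qed (use K in auto)
    then show ?thesis ..
  qed
qed

end

section \<open>Points, lines and quadratic forms\<close>

definition dot3 :: "'b::comm_ring_1 ^ 3 \<Rightarrow> 'b ^ 3 \<Rightarrow> 'b" where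
  "dot3 u v = u $ 1 * v $ 1 + u $ 2 * v $ 2 + u $ 3 * v $ 3"

lemma dot3_simps [simp]:
  "dot3 u (v + w) = dot3 u v + dot3 u w" "dot3 (u + v) w = dot3 u w + dot3 v w"
  "dot3 u (s *s v) = s * dot3 u v" "dot3 (s *s u) v = s * dot3 u v"
  "dot3 u 0 = 0" "dot3 0 v = 0"
  by (simp_all add: dot3_def algebra_simps)

lemma dot3_commute: "dot3 u v = dot3 v u"
  by (simp add: dot3_def mult.commute)

lemma vec_eq_3: "v = w \<longleftrightarrow> v $ 1 = w $ 1 \<and> v $ 2 = w $ 2 \<and> v $ (3::3) = w $ 3"
  by (auto simp: vec_eq_iff forall_3)

lemma matrix_vector_3: "(A *v v) $ i = dot3 (A $ i) v"
  by (simp add: matrix_vector_mult_def sum_3 dot3_def)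

lemma dot3_transpose: "dot3 u (A *v v) = dot3 (transpose A *v u) v"
  by (simp add: matrix_vector_3 dot3_def transpose_def algebra_simps)

lemma dot3_nondegenerate: assumes "u \<noteq> 0" obtains v where "dot3 u v \<noteq> 0"
proof -
  obtain i where "u $ i \<noteq> 0" using assms by (auto simp: vec_eq_iff)
  then have "dot3 u (axis i 1) \<noteq> 0" using exhaust_3[of i] by (auto simp: dot3_def axis_def)
  then show ?thesis by (rule that)
qed

lemma singular_kernel:
  fixes A :: "'b::field ^ 3 ^ 3"
  assumes "det A = 0" obtains v where "v \<noteq> 0" "A *v v = 0"
  using assms invertible_det_nz[of A] matrix_left_invertible_ker[of A] invertible_left_inverse[of A] by blast

lemma ex_perp:
  fixes r s :: "'b::field ^ 3"
  obtains v where "v \<noteq> 0" "dot3 r v = 0" "dot3 s v = 0"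
proof -
  let ?A = "vector [r, s, 0] :: 'b ^ 3 ^ 3"
  have "det ?A = 0" by (simp add: det_3 vector_3)
  then obtain v where v: "v \<noteq> 0" "?A *v v = 0" by (rule singular_kernel)
  have "(?A *v v) $ 1 = dot3 r v" "(?A *v v) $ 2 = dot3 s v"
    by (simp_all add: matrix_vector_3 vector_3)
  then show ?thesis using v that by simp
qed

lemma pg_points_iff: "P \<in> pg_points \<longleftrightarrow> (\<exists>v\<noteq>0. P = vec.span {v})"
proof
  assume "P \<in> pg_points"
  then have P: "vec.subspace P" "vec.dim P = 1" by (auto simp: pg_points_def)
  obtain B where B: "B \<subseteq> P" "vec.independent B" "P \<subseteq> vec.span B" "card B = vec.dim P"
    by (rule vec.basis_exists)
  obtain v where v: "B = {v}" using B(4) P(2) by (auto simp: card_1_singleton_iff)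
  have "vec.span {v} \<subseteq> P" using B(1) v P(1) by (intro vec.span_minimal) auto
  then have "P = vec.span {v}" using B(3) unfolding v by (rule antisym[rotated])
  moreover have "v \<noteq> 0" using B(2) vec.dependent_zero[of B] unfolding v by auto
  ultimately show "\<exists>v\<noteq>0. P = vec.span {v}" by (intro exI[of _ v] conjI)
next
  assume "\<exists>v\<noteq>0. P = vec.span {v}"
  then obtain v where v: "v \<noteq> 0" "P = vec.span {v}" by blast
  have "vec.dim (vec.span {v}) = 1"
    using v(1) by (simp add: vec.dim_eq_card_independent)
  then show "P \<in> pg_points" using v(2) by (simp add: pg_points_def)
qed

lemma subspace_perp: "vec.subspace {v. dot3 n v = 0}"
  by (rule vec.subspaceI) auto

lemma independent_pair:
  fixes u v :: "'b::field ^ 3"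
  assumes "u \<noteq> 0" "v \<notin> vec.span {u}"
  shows "vec.dim (vec.span {u, v}) = 2"
proof -
  have "vec.independent {v, u}" using assms by (simp add: vec.independent_insert)
  moreover have "u \<noteq> v" using assms(2) vec.span_base by blast
  ultimately show ?thesis by (simp add: vec.dim_eq_card_independent insert_commute)
qed

lemma dim_perp:
  fixes n :: "'b::field ^ 3"
  assumes "n \<noteq> 0"
  shows "vec.dim {v. dot3 n v = 0} = 2"
proof (rule antisym)
  let ?L = "{v. dot3 n v = 0}"
  obtain u where u: "u \<noteq> 0" "dot3 n u = 0" using ex_perp[of n n] by blast
  obtain r where r: "dot3 u r \<noteq> 0" using u(1) by (rule dot3_nondegenerate)
  obtain v where v: "v \<noteq> 0" "dot3 n v = 0" "dot3 r v = 0" by (rule ex_perp)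
  have "v \<notin> vec.span {u}"
  proof
    assume "v \<in> vec.span {u}"
    then obtain k where k: "v = k *s u" by (auto simp: vec.span_singleton)
    have "dot3 u r = dot3 r u" by (simp add: dot3_def mult.commute)
    then have "k = 0" using v(3) r k by simp
    then show False using v(1) k by simp
  qed
  then have "2 = vec.dim (vec.span {u, v})" using independent_pair u(1) by metis
  also have "\<dots> \<le> vec.dim ?L"
  proof (rule vec.dim_subset)
    show "vec.span {u, v} \<subseteq> ?L" using u v subspace_perp by (intro vec.span_minimal) auto
  qed
  finally show "2 \<le> vec.dim ?L" .
  show "vec.dim ?L \<le> 2"
  proof (rule ccontr)
    assume "\<not> vec.dim ?L \<le> 2"
    then have "vec.dim (UNIV :: ('b ^ 3) set) \<le> vec.dim ?L" unfolding vec_dim_card by simp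
    then have "?L = UNIV" using vec.subspace_dim_equal[OF subspace_perp vec.subspace_UNIV] by blast
    then show False using dot3_nondegenerate[OF assms] by blast
  qed
qed

lemma pg_lines_iff: "L \<in> pg_lines \<longleftrightarrow> (\<exists>n\<noteq>0. L = {v. dot3 n v = 0})"
proof
  assume "L \<in> pg_lines"
  then have L: "vec.subspace L" "vec.dim L = 2" by (auto simp: pg_lines_def)
  obtain B where B: "B \<subseteq> L" "vec.independent B" "L \<subseteq> vec.span B" "card B = vec.dim L"
    by (rule vec.basis_exists)
  obtain u v where uv: "B = {u, v}" using B(4) L(2) by (auto simp: card_2_iff)
  obtain n where n: "n \<noteq> 0" "dot3 u n = 0" "dot3 v n = 0" by (rule ex_perp)
  have "L \<subseteq> {v. dot3 n v = 0}"
    using B(3) n unfolding uv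
    by (intro order_trans[OF B(3)[unfolded uv]] vec.span_minimal subspace_perp)
      (auto simp: dot3_def mult.commute)
  then have "L = {v. dot3 n v = 0}"
    using vec.subspace_dim_equal[OF L(1) subspace_perp] L(2) dim_perp[OF n(1)] by simp
  then show "\<exists>n\<noteq>0. L = {v. dot3 n v = 0}" using n(1) by blast
next
  assume "\<exists>n\<noteq>0. L = {v. dot3 n v = 0}"
  then show "L \<in> pg_lines" using subspace_perp dim_perp by (auto simp: pg_lines_def)
qed

lemma span_subset_perp: "vec.span {v} \<subseteq> {x. dot3 n x = 0} \<longleftrightarrow> dot3 n v = 0"
  using vec.span_minimal[OF _ subspace_perp, of "{v}" n] vec.span_base[of v "{v}"] by auto

lemma line_unique:
  assumes "L \<in> pg_lines" "L' \<in> pg_lines" "P \<in> pg_points" "R \<in> pg_points" "P \<noteq> R"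
    and "P \<subseteq> L" "R \<subseteq> L" "P \<subseteq> L'" "R \<subseteq> L'"
  shows "L = L'"
proof -
  obtain u where u: "u \<noteq> 0" "P = vec.span {u}" using assms(3) by (auto simp: pg_points_iff)
  obtain v where v: "v \<noteq> 0" "R = vec.span {v}" using assms(4) by (auto simp: pg_points_iff)
  have "v \<notin> vec.span {u}"
  proof
    assume "v \<in> vec.span {u}"
    then have "R \<subseteq> P" unfolding u v by (intro vec.span_minimal) auto
    then have "R = P"
      using assms(3,4) vec.subspace_dim_equal[of R P] by (auto simp: pg_points_def)
    then show False using assms(5) by simp
  qed
  then have d: "vec.dim (vec.span {u, v}) = 2" using u(1) by (rule independent_pair[rotated])
  have uvin: "u \<in> P" "v \<in> R" using u v vec.span_base by auto
  have "M = vec.span {u, v}" if M: "M \<in> pg_lines" "P \<subseteq> M" "R \<subseteq> M" for M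
  proof -
    have s: "vec.subspace M" "vec.dim M = 2" using M(1) by (auto simp: pg_lines_def)
    have "vec.span {u, v} \<subseteq> M" using M uvin s by (intro vec.span_minimal) auto
    then have "vec.span {u, v} = M"
      by (rule vec.subspace_dim_equal[OF vec.subspace_span s(1)]) (use d s in linarith)
    then show ?thesis by (rule sym)
  qed
  from this[OF assms(1,6,7)] this[OF assms(2,8,9)] show ?thesis by simp
qed

definition bform :: "'b::comm_ring_1 ^ 3 ^ 3 \<Rightarrow> 'b ^ 3 \<Rightarrow> 'b ^ 3 \<Rightarrow> 'b" where
  "bform A u v = dot3 u (A *v v)"

lemma bform_simps [simp]:
  "bform A u (v + w) = bform A u v + bform A u w" "bform A (u + v) w = bform A u w + bform A v w"
  "bform A u (s *s v) = s * bform A u v" "bform A (s *s u) v = s * bform A u v"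
  "bform A u (v - w) = bform A u v - bform A u w" "bform A (u - v) w = bform A u w - bform A v w"
  "bform A u 0 = 0" "bform A 0 v = 0"
  by (simp_all add: bform_def matrix_vector_3 dot3_def algebra_simps)

lemma bform_sym: "transpose A = A \<Longrightarrow> bform A u v = bform A v u"
  unfolding bform_def using dot3_transpose[of u A v] by (simp add: dot3_commute)

lemma bform_perp:
  fixes A :: "'b::field ^ 3 ^ 3"
  obtains v where "v \<noteq> 0" "bform A u v = 0" "bform A w v = 0"
proof -
  obtain v where "v \<noteq> 0" "dot3 (transpose A *v u) v = 0" "dot3 (transpose A *v w) v = 0"
    by (rule ex_perp)
  then show ?thesis using that by (simp add: bform_def dot3_transpose)
qed

context odd_field
begin

text \<open>
  The values of f y^2 and of - h - g z^2 are two sets of (q + 1) / 2 elements each, so they intersect.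
\<close>

lemma diagonal_conic_point:
  assumes "(f :: 'a) \<noteq> 0" "g \<noteq> 0"
  obtains y z where "f * y\<^sup>2 + g * z\<^sup>2 + h = 0"
proof -
  let ?S = "{s::'a. is_square s}"
  let ?f = "\<lambda>s. f * s" and ?g = "\<lambda>s. - h - g * s"
  have "card (?f ` ?S) = card ?S" "card (?g ` ?S) = card ?S"
    using assms by (auto intro!: card_image simp: inj_on_def)
  moreover have "card (?f ` ?S \<union> ?g ` ?S) \<le> q"
    unfolding q_card by (intro card_mono) auto
  ultimately have "?f ` ?S \<inter> ?g ` ?S \<noteq> {}"
    using card_squares card_Un_disjoint[of "?f ` ?S" "?g ` ?S"] by (intro notI) simp
  then obtain s t where "is_square s" "is_square t" "f * s = - h - g * t" by blast
  then obtain y z where "f * y\<^sup>2 = - h - g * z\<^sup>2" by (auto simp: is_nth_power_def)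
  then show ?thesis by (intro that[of y z]) simp
qed

text \<open>
  On three pairwise orthogonal vectors the form is diagonal, and \<open>diagonal_conic_point\<close> yields a zero.
\<close>

lemma isotropic_vector:
  fixes A :: "'a ^ 3 ^ 3"
  assumes sym: "transpose A = A"
  obtains v where "v \<noteq> 0" "bform A v v = 0"
proof -
  note sy = bform_sym[OF sym]
  obtain v1 :: "'a ^ 3" where v1: "v1 \<noteq> 0" by (rule ex_perp)
  obtain v2 where v2: "v2 \<noteq> 0" "bform A v1 v2 = 0" by (rule bform_perp)
  obtain v3 where v3: "v3 \<noteq> 0" "bform A v1 v3 = 0" "bform A v2 v3 = 0" by (rule bform_perp)
  consider "bform A v1 v1 = 0" | "bform A v2 v2 = 0" | "bform A v3 v3 = 0"
    | "bform A v1 v1 \<noteq> 0" "bform A v2 v2 \<noteq> 0" "bform A v3 v3 \<noteq> 0" by blast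
  then show ?thesis
  proof cases
    case 4
    obtain y z where yz: "bform A v1 v1 * y\<^sup>2 + bform A v2 v2 * z\<^sup>2 + bform A v3 v3 = 0"
      using diagonal_conic_point[OF 4(1,2)] by blast
    let ?v = "y *s v1 + z *s v2 + v3"
    have "bform A ?v ?v = bform A v1 v1 * y\<^sup>2 + bform A v2 v2 * z\<^sup>2 + bform A v3 v3"
      using v2 v3 sy[of v2 v1] sy[of v3 v1] sy[of v3 v2]
      by (simp add: power2_eq_square algebra_simps)
    moreover have e: "bform A ?v v3 = bform A v3 v3" using v3 by simp
    have "?v \<noteq> 0"
    proof
      assume z: "?v = 0"
      show False using e 4(3) unfolding z by simp
    qed
    ultimately show ?thesis using that yz by simp
  qed (use v1 v2 v3 that in blast)+
qed

text \<open>
  An isotropic vector e1 is completed to a hyperbolic pair e1, e3, and e2 spans the orthogonal complement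
  of the pair. Rescaling e1 adjusts the coefficient of the hyperbolic part to that of e2.
\<close>

lemma conic_normal_form:
  fixes A :: "'a ^ 3 ^ 3"
  assumes sym: "transpose A = A" and det: "det A \<noteq> 0"
  obtains M :: "'a ^ 3 ^ 3" and l where "invertible M" "l \<noteq> 0"
    "\<And>w. bform A (M *v w) (M *v w) = l * ((w $ 2)\<^sup>2 - w $ 1 * w $ 3)"
proof -
  note sy = bform_sym[OF sym]
  have inj: "A *v v \<noteq> 0" if "v \<noteq> 0" for v
    using that det invertible_det_nz[of A] matrix_left_invertible_ker[of A] invertible_left_inverse[of A] by blast
  have nondeg: "\<exists>u. bform A v u \<noteq> 0" if v: "v \<noteq> 0" for v
  proof -
    obtain u where "dot3 (A *v v) u \<noteq> 0" using inj[OF v] by (rule dot3_nondegenerate)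
    then have "bform A u v \<noteq> 0" by (simp add: bform_def dot3_def mult.commute)
    then show ?thesis using sy by metis
  qed
  obtain e1 where e1: "e1 \<noteq> 0" "bform A e1 e1 = 0" using sym by (rule isotropic_vector)
  obtain u where u: "bform A e1 u \<noteq> 0" using nondeg[OF e1(1)] by blast
  define m where "m = bform A e1 u"
  \<comment> \<open>The multiple of e1 makes e3 isotropic.\<close>
  define e3 where "e3 = u + (- bform A u u / (2 * m)) *s e1"
  have m0: "m \<noteq> 0" using u by (simp add: m_def)
  have m13: "bform A e1 e3 = m" "bform A e3 e1 = m" using e1 sy[of u e1] by (simp_all add: e3_def m_def)
  have e3: "bform A e3 e3 = 0"
    using e1 sy[of u e1] m0 two_nonzero
    by (simp add: e3_def flip: m_def)
  obtain e2 where e2: "e2 \<noteq> 0" "bform A e1 e2 = 0" "bform A e3 e2 = 0" by (rule bform_perp)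
  have e2': "bform A e2 e1 = 0" "bform A e2 e3 = 0" using e2 sy by auto
  define N where "N = (\<lambda>s. transpose (vector [s *s e1, e2, e3] :: 'a ^ 3 ^ 3))"
  have N: "N s *v w = (s * w $ 1) *s e1 + w $ 2 *s e2 + w $ 3 *s e3" for s w
    by (simp add: N_def vec_eq_3 matrix_vector_3 transpose_def vector_3 dot3_def algebra_simps)
  have Ninj: "invertible (N s)" if "s \<noteq> 0" for s
  proof -
    have "w = 0" if w: "N s *v w = 0" for w
    proof -
      have "bform A e1 (N s *v w) = w $ 3 * m" "bform A e3 (N s *v w) = (s * w $ 1) * m"
        unfolding N using e1 e2 e3 m13 by simp_all
      then have "w $ 3 = 0" "w $ 1 = 0" using w m0 \<open>s \<noteq> 0\<close> by auto
      then have "w $ 2 *s e2 = 0" using w unfolding N by simp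
      then have "w $ 2 = 0" using e2(1) by simp
      then show "w = 0" using \<open>w $ 3 = 0\<close> \<open>w $ 1 = 0\<close> by (simp add: vec_eq_3)
    qed
    then show ?thesis using matrix_left_invertible_ker[of "N s"] invertible_left_inverse[of "N s"] by blast
  qed
  define l where "l = bform A e2 e2"
  have l0: "l \<noteq> 0"
  proof
    assume "l = 0"
    obtain v where v: "bform A e2 v \<noteq> 0" using nondeg[OF e2(1)] by blast
    obtain w where "v = N 1 *v w" using Ninj[of 1] matrix_right_invertible_surjective[of "N 1"]
      invertible_right_inverse[of "N 1"] by (metis one_neq_zero surjE)
    then have "bform A e2 v = 0" unfolding N using e2' \<open>l = 0\<close> by (simp add: l_def)
    then show False using v by simp
  qed
  define s where "s = - l / (2 * m)"
  have s0: "s \<noteq> 0" using l0 m0 two_nonzero by (simp add: s_def)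
  have sm: "2 * (s * m) = - l" using m0 two_nonzero by (simp add: s_def)
  show ?thesis
  proof (rule that[OF Ninj[OF s0] l0])
    fix w
    have "bform A (N s *v w) (N s *v w) = l * (w $ 2)\<^sup>2 + 2 * (s * m) * (w $ 1 * w $ 3)"
      unfolding N using e1 e2 e2' e3 m13
      by (simp add: l_def[symmetric] power2_eq_square algebra_simps)
    then show "bform A (N s *v w) (N s *v w) = l * ((w $ 2)\<^sup>2 - w $ 1 * w $ 3)"
      unfolding sm by (simp add: algebra_simps)
  qed
qed

end

section \<open>Coordinates in which the conic is y^2 = x z\<close>

context odd_field
begin

text \<open>
  The extra summand counts the root at infinity of the binary form a t^2 + 2 b t + c.
\<close>

lemma card_projective_roots:
  fixes a b c :: 'a
  assumes "(a, b, c) \<noteq> (0, 0, 0)"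
  shows "card {t. a * t\<^sup>2 + 2 * b * t + c = 0} + (if a = 0 then 1 else 0)
    = (if b\<^sup>2 = a * c then 1 else if is_square (b\<^sup>2 - a * c) then 2 else 0)"
proof (cases "a = 0")
  case True
  show ?thesis
  proof (cases "b = 0")
    case True
    then show ?thesis using \<open>a = 0\<close> assms by simp
  next
    case False
    then have nz: "2 * b \<noteq> 0" using two_nonzero by simp
    have "a * t\<^sup>2 + 2 * b * t + c = 0 \<longleftrightarrow> t = - c / (2 * b)" for t
      unfolding nonzero_eq_divide_eq[OF nz] eq_neg_iff_add_eq_0 using \<open>a = 0\<close> by (simp add: mult.commute)
    then show ?thesis using \<open>a = 0\<close> False by simp
  qed
next
  case False
  have "card {t. a * t\<^sup>2 + 2 * b * t + c = 0} = card {v. v\<^sup>2 = b\<^sup>2 - a * c}"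
  proof (rule bij_betw_same_card[of "\<lambda>t. a * t + b"], rule bij_betwI[where g = "\<lambda>v. (v - b) / a"])
    have e: "(a * t + b)\<^sup>2 - (b\<^sup>2 - a * c) = a * (a * t\<^sup>2 + 2 * b * t + c)" for t
      by (simp add: power2_eq_square algebra_simps)
    show "(\<lambda>t. a * t + b) \<in> {t. a * t\<^sup>2 + 2 * b * t + c = 0} \<rightarrow> {v. v\<^sup>2 = b\<^sup>2 - a * c}"
    proof
      fix t assume "t \<in> {t. a * t\<^sup>2 + 2 * b * t + c = 0}"
      then have "(a * t + b)\<^sup>2 - (b\<^sup>2 - a * c) = 0" unfolding e by simp
      then show "a * t + b \<in> {v. v\<^sup>2 = b\<^sup>2 - a * c}" by simp
    qed
    show "(\<lambda>v. (v - b) / a) \<in> {v. v\<^sup>2 = b\<^sup>2 - a * c} \<rightarrow> {t. a * t\<^sup>2 + 2 * b * t + c = 0}"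
    proof
      fix v assume v: "v \<in> {v. v\<^sup>2 = b\<^sup>2 - a * c}"
      have "a * ((v - b) / a) + b = v" using False by simp
      then have "a * (a * ((v - b) / a)\<^sup>2 + 2 * b * ((v - b) / a) + c) = 0"
        using e[of "(v - b) / a"] v by simp
      then show "(v - b) / a \<in> {t. a * t\<^sup>2 + 2 * b * t + c = 0}" using False by simp
    qed
  qed (use False in auto)
  then show ?thesis unfolding roots_of_square using False by auto
qed

end

definition point_at :: "'b::field ^ 3 ^ 3 \<Rightarrow> 'b \<Rightarrow> 'b \<Rightarrow> 'b \<Rightarrow> ('b ^ 3) set" where
  "point_at M x y z = vec.span {M *v vector [x, y, z]}"

text \<open>
  The factor 2 makes b^2 - a c the discriminant of the line.
\<close>

definition line_at :: "'b::field ^ 3 ^ 3 \<Rightarrow> 'b \<Rightarrow> 'b \<Rightarrow> 'b \<Rightarrow> ('b ^ 3) set" where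
  "line_at M a b c = {M *v vector [x, y, z] | x y z. a * x + 2 * b * y + c * z = 0}"

lemma vector_3_eta: "vector [v $ 1, v $ 2, v $ 3] = (v :: 'b::zero ^ 3)"
  by (simp add: vec_eq_3 vector_3)

lemma vector_3_eq_0: "vector [x, y, z] = (0 :: 'b::zero ^ 3) \<longleftrightarrow> (x, y, z) = (0, 0, 0)"
  by (simp add: vec_eq_3 vector_3)

lemma vector_3_scale: "s *s vector [x, y, z] = (vector [s * x, s * y, s * z] :: 'b::field ^ 3)"
  by (simp add: vec_eq_3 vector_3)

lemma card_insert_if_new:
  assumes "finite S" "p \<notin> S"
  shows "card (S \<union> (if b then {p} else {})) = card S + (if b then 1 else 0)"
  using assms by simp

text \<open>
  The columns of M form a projective coordinate system in which the conic is y^2 = x z.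
\<close>

locale frame = odd_field q T for q and T :: "'a::{field,finite} itself" +
  fixes M :: "'a ^ 3 ^ 3" and C :: "('a ^ 3) set set"
  assumes inv: "invertible M"
    and C_points: "C \<subseteq> pg_points"
    and C_iff: "(x, y, z) \<noteq> (0, 0, 0) \<Longrightarrow> point_at M x y z \<in> C \<longleftrightarrow> y\<^sup>2 = x * z"
begin

lemma M_surj: obtains x y z where "v = M *v vector [x, y, z]"
proof -
  obtain N where "M ** N = mat 1" using inv by (auto simp: invertible_def)
  then have "v = M *v (N *v v)" by (simp add: matrix_vector_mul_assoc)
  then show ?thesis using that vector_3_eta by metis
qed

lemma M_zero: "M *v v = 0 \<longleftrightarrow> v = 0"
  using inv matrix_left_invertible_ker[of M] invertible_left_inverse[of M] by auto

lemma M_vector_zero: "M *v vector [x, y, z] = 0 \<longleftrightarrow> (x, y, z) = (0, 0, 0)"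
  by (simp only: M_zero vector_3_eq_0)

lemma pt_point: "(x, y, z) \<noteq> (0, 0, 0) \<Longrightarrow> point_at M x y z \<in> pg_points"
  unfolding pg_points_iff point_at_def using M_vector_zero by blast

lemma point_cases:
  assumes "P \<in> pg_points"
  obtains x y z where "(x, y, z) \<noteq> (0, 0, 0)" "P = point_at M x y z"
proof -
  obtain v where v: "v \<noteq> 0" "P = vec.span {v}" using assms by (auto simp: pg_points_iff)
  obtain x y z where xyz: "v = M *v vector [x, y, z]" by (rule M_surj)
  then have "(x, y, z) \<noteq> (0, 0, 0)" using v(1) M_vector_zero by blast
  then show ?thesis using that v(2) xyz by (simp add: point_at_def)
qed

lemma ln_perp:
  obtains n where "line_at M a b c = {v. dot3 n v = 0}"
    "\<And>x y z. dot3 n (M *v vector [x, y, z]) = a * x + 2 * b * y + c * z"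
proof -
  obtain N where N: "N ** M = mat 1" using inv by (auto simp: invertible_def)
  define n where "n = transpose N *v vector [a, 2 * b, c]"
  have n: "dot3 n (M *v vector [x, y, z]) = a * x + 2 * b * y + c * z" for x y z
    unfolding n_def dot3_transpose[symmetric] matrix_vector_mul_assoc
    by (simp add: N dot3_def vector_3)
  moreover have "line_at M a b c = {v. dot3 n v = 0}"
  proof (rule Set.set_eqI)
    fix v
    obtain x y z where v: "v = M *v vector [x, y, z]" by (rule M_surj)
    show "v \<in> line_at M a b c \<longleftrightarrow> v \<in> {v. dot3 n v = 0}"
      unfolding line_at_def mem_Collect_eq using n v by metis
  qed
  ultimately show ?thesis using that by blast
qed

lemma pt_on_ln: "point_at M x y z \<subseteq> line_at M a b c \<longleftrightarrow> a * x + 2 * b * y + c * z = 0"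
proof -
  obtain n where n: "line_at M a b c = {v. dot3 n v = 0}"
    "\<And>x y z. dot3 n (M *v vector [x, y, z]) = a * x + 2 * b * y + c * z"
    using ln_perp[of a b c] by blast
  show ?thesis unfolding n(1) point_at_def span_subset_perp n(2) ..
qed

lemma ln_line:
  assumes "(a, b, c) \<noteq> (0, 0, 0)" shows "line_at M a b c \<in> pg_lines"
proof -
  obtain n where n: "line_at M a b c = {v. dot3 n v = 0}"
    "\<And>x y z. dot3 n (M *v vector [x, y, z]) = a * x + 2 * b * y + c * z"
    using ln_perp[of a b c] by blast
  have "n \<noteq> 0"
  proof
    assume "n = 0"
    then have "a * x + 2 * b * y + c * z = 0" for x y z using n(2)[of x y z] by simp
    from this[of 1 0 0] this[of 0 1 0] this[of 0 0 1] show False using assms two_nonzero by simp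
  qed
  then show ?thesis unfolding pg_lines_iff using n(1) by blast
qed

lemma line_cases:
  assumes "L \<in> pg_lines"
  obtains a b c where "(a, b, c) \<noteq> (0, 0, 0)" "L = line_at M a b c"
proof -
  obtain n where n: "n \<noteq> 0" "L = {v. dot3 n v = 0}" using assms by (auto simp: pg_lines_iff)
  define m where "m = transpose M *v n"
  have m: "dot3 n (M *v v) = dot3 m v" for v by (simp add: m_def dot3_transpose)
  have "m \<noteq> 0"
  proof
    assume "m = 0"
    obtain v where v: "dot3 n v \<noteq> 0" using n(1) by (rule dot3_nondegenerate)
    obtain x y z where "v = M *v vector [x, y, z]" by (rule M_surj)
    then show False using v m \<open>m = 0\<close> by simp
  qed
  have e: "dot3 m (vector [x, y, z]) = m $ 1 * x + 2 * (m $ 2 / 2) * y + m $ 3 * z" for x y z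
    using two_nonzero by (simp add: dot3_def vector_3)
  show ?thesis
  proof (rule that)
    show "(m $ 1, m $ 2 / 2, m $ 3) \<noteq> (0, 0, 0)" using \<open>m \<noteq> 0\<close> two_nonzero by (simp add: vec_eq_3)
    show "L = line_at M (m $ 1) (m $ 2 / 2) (m $ 3)"
    proof (rule Set.set_eqI)
      fix v
      obtain x y z where v: "v = M *v vector [x, y, z]" by (rule M_surj)
      show "v \<in> L \<longleftrightarrow> v \<in> line_at M (m $ 1) (m $ 2 / 2) (m $ 3)"
        unfolding n(2) line_at_def mem_Collect_eq using m e v by metis
    qed
  qed
qed

lemma ln_scale: "s \<noteq> 0 \<Longrightarrow> line_at M (s * a) (s * b) (s * c) = line_at M a b c"
proof -
  assume "s \<noteq> 0"
  have "s * a * x + 2 * (s * b) * y + s * c * z = s * (a * x + 2 * b * y + c * z)" for x y z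
    by (simp add: algebra_simps)
  then show ?thesis unfolding line_at_def using \<open>s \<noteq> 0\<close> by simp
qed

lemma pt_eqD:
  assumes "point_at M x y z = point_at M x' y' z'"
  shows "\<exists>s. x' = s * x \<and> y' = s * y \<and> z' = s * z"
proof -
  have "M *v vector [x', y', z'] \<in> point_at M x y z" unfolding assms unfolding point_at_def by (rule vec.span_base) simp
  then obtain s where "M *v vector [x', y', z'] = s *s (M *v vector [x, y, z])"
    by (auto simp: point_at_def vec.span_singleton)
  moreover have "M *v (v - s *s w) = M *v v - s *s (M *v w)" for v w
    by (simp add: vec_eq_3 matrix_vector_3 dot3_def algebra_simps)
  ultimately have "M *v (vector [x', y', z'] - s *s vector [x, y, z]) = 0" by simp
  then have "(vector [x', y', z'] :: 'a ^ 3) = s *s vector [x, y, z]" unfolding M_zero by simp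
  then show ?thesis unfolding vector_3_scale by (auto simp: vec_eq_3 vector_3)
qed

lemma pt_scale: "s \<noteq> 0 \<Longrightarrow> point_at M (s * x) (s * y) (s * z) = point_at M x y z"
proof -
  assume s: "s \<noteq> 0"
  have "M *v vector [s * x, s * y, s * z] = s *s (M *v vector [x, y, z])"
    by (simp add: vec_eq_3 matrix_vector_3 dot3_def vector_3 algebra_simps)
  then show ?thesis unfolding point_at_def using vec.span_image_scale[of "{M *v vector [x, y, z]}" "\<lambda>_. s"] s
    by simp
qed

lemma conic_points_on_line:
  assumes "(a, b, c) \<noteq> (0, 0, 0)"
  shows "card (points_on C (line_at M a b c)) =
    (if b\<^sup>2 = a * c then 1 else if is_square (b\<^sup>2 - a * c) then 2 else 0)"
proof -
  let ?R = "{t. a * t\<^sup>2 + 2 * b * t + c = 0}" and ?f = "\<lambda>t. point_at M (t\<^sup>2) t 1"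
  have "points_on C (line_at M a b c) = ?f ` ?R \<union> (if a = 0 then {point_at M 1 0 0} else {})"
  proof (intro equalityI subsetI)
    fix P assume "P \<in> points_on C (line_at M a b c)"
    then have P: "P \<in> C" "P \<subseteq> line_at M a b c" by (auto simp: points_on_def)
    obtain x y z where xyz: "(x, y, z) \<noteq> (0, 0, 0)" "P = point_at M x y z"
      using P(1) C_points point_cases by blast
    have eq: "y\<^sup>2 = x * z" "a * x + 2 * b * y + c * z = 0"
      using P xyz C_iff pt_on_ln by auto
    show "P \<in> ?f ` ?R \<union> (if a = 0 then {point_at M 1 0 0} else {})"
    proof (cases "z = 0")
      case True
      then have "y = 0" "x \<noteq> 0" using eq(1) xyz(1) by auto
      then have "a = 0" "P = point_at M 1 0 0" using eq(2) True xyz(2) pt_scale[of x 1 0 0] by auto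
      then show ?thesis by simp
    next
      case False
      define t where "t = y / z"
      have x: "x = z * t\<^sup>2" "y = z * t" using eq(1) False by (simp_all add: t_def power2_eq_square field_simps)
      have "P = ?f t" unfolding xyz(2) x using pt_scale[OF False, of "t\<^sup>2" t 1] by simp
      moreover have "z * (a * t\<^sup>2 + 2 * b * t + c) = 0" using eq(2) unfolding x by (simp add: algebra_simps)
      then have "t \<in> ?R" using False by simp
      ultimately show ?thesis by blast
    qed
  next
    fix P assume "P \<in> ?f ` ?R \<union> (if a = 0 then {point_at M 1 0 0} else {})"
    then consider t where "a * t\<^sup>2 + 2 * b * t + c = 0" "P = ?f t" | "a = 0" "P = point_at M 1 0 0"
      by (auto split: if_splits)
    then show "P \<in> points_on C (line_at M a b c)"
      by cases (auto simp: points_on_def C_iff pt_on_ln)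
  qed
  moreover have "inj_on ?f ?R"
  proof (rule inj_onI)
    fix t s assume "?f t = ?f s"
    from pt_eqD[OF this] show "t = s" by auto
  qed
  moreover have "point_at M 1 0 0 \<notin> ?f ` ?R" using pt_eqD[of 1 0 0] by fastforce
  ultimately have "card (points_on C (line_at M a b c)) = card ?R + (if a = 0 then 1 else 0)"
    using card_insert_if_new[of "?f ` ?R" "point_at M 1 0 0" "a = 0"] card_image[of ?f ?R]
    by (simp only:) simp
  then show ?thesis using card_projective_roots[OF assms] by simp
qed

lemma tangent_iff:
  assumes "(a, b, c) \<noteq> (0, 0, 0)"
  shows "tangent_line C (line_at M a b c) \<longleftrightarrow> b\<^sup>2 = a * c"
  unfolding tangent_line_def conic_points_on_line[OF assms] using ln_line[OF assms] by simp

text \<open>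
  The tangents are dual to the conic points: the tangent at t has coefficients (1, - t, t^2), so the tangents
  through (x, y, z) are the roots of z t^2 - 2 y t + x.
\<close>

lemma tangents_through_point:
  assumes "(x, y, z) \<noteq> (0, 0, 0)"
  shows "card {L. tangent_line C L \<and> point_at M x y z \<subseteq> L} =
    (if y\<^sup>2 = x * z then 1 else if is_square (y\<^sup>2 - x * z) then 2 else 0)"
proof -
  let ?R = "{t. z * t\<^sup>2 + 2 * (- y) * t + x = 0}" and ?f = "\<lambda>t. line_at M 1 (- t) (t\<^sup>2)"
  have "{L. tangent_line C L \<and> point_at M x y z \<subseteq> L} = ?f ` ?R \<union> (if z = 0 then {line_at M 0 0 1} else {})"
  proof (intro equalityI subsetI)
    fix L assume "L \<in> {L. tangent_line C L \<and> point_at M x y z \<subseteq> L}"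
    then have L: "tangent_line C L" "point_at M x y z \<subseteq> L" by auto
    then have "L \<in> pg_lines" by (simp add: tangent_line_def)
    then obtain a b c where abc: "(a, b, c) \<noteq> (0, 0, 0)" "L = line_at M a b c" by (rule line_cases)
    have eq: "b\<^sup>2 = a * c" "a * x + 2 * b * y + c * z = 0"
      using L abc tangent_iff pt_on_ln by auto
    show "L \<in> ?f ` ?R \<union> (if z = 0 then {line_at M 0 0 1} else {})"
    proof (cases "a = 0")
      case True
      then have "b = 0" "c \<noteq> 0" using eq(1) abc(1) by auto
      then have "z = 0" "L = line_at M 0 0 1" using eq(2) True abc(2) ln_scale[of c 0 0 1] by auto
      then show ?thesis by simp
    next
      case False
      define t where "t = - b / a"
      have c: "c = a * t\<^sup>2" "b = a * - t" using eq(1) False by (simp_all add: t_def power2_eq_square field_simps)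
      have "L = ?f t" unfolding abc(2) c using ln_scale[OF False, of 1 "- t" "t\<^sup>2"] by simp
      moreover have "a * (z * t\<^sup>2 + 2 * (- y) * t + x) = 0" using eq(2) unfolding c by (simp add: algebra_simps)
      then have "t \<in> ?R" using False by simp
      ultimately show ?thesis by blast
    qed
  next
    fix L assume "L \<in> ?f ` ?R \<union> (if z = 0 then {line_at M 0 0 1} else {})"
    then consider t where "z * t\<^sup>2 + 2 * (- y) * t + x = 0" "L = ?f t" | "z = 0" "L = line_at M 0 0 1"
      by (auto split: if_splits)
    then show "L \<in> {L. tangent_line C L \<and> point_at M x y z \<subseteq> L}"
      by cases (auto simp: tangent_iff pt_on_ln algebra_simps)
  qed
  moreover have inc: "point_at M (t\<^sup>2) t 1 \<subseteq> ?f s \<longleftrightarrow> t = s" for t s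
  proof -
    have "1 * t\<^sup>2 + 2 * (- s) * t + s\<^sup>2 * 1 = (t - s)\<^sup>2" by (simp add: power2_eq_square algebra_simps)
    then show ?thesis unfolding pt_on_ln by simp
  qed
  have "inj_on ?f ?R"
  proof (rule inj_onI)
    fix t s assume "?f t = ?f s"
    then show "t = s" using inc[of t t] inc[of t s] by simp
  qed
  moreover have "line_at M 0 0 1 \<notin> ?f ` ?R"
  proof
    assume "line_at M 0 0 1 \<in> ?f ` ?R"
    then obtain t where "line_at M 0 0 1 = ?f t" by blast
    then show False using inc[of t t] pt_on_ln[of "t\<^sup>2" t 1 0 0 1] by simp
  qed
  ultimately have "card {L. tangent_line C L \<and> point_at M x y z \<subseteq> L} = card ?R + (if z = 0 then 1 else 0)"
    using card_insert_if_new[of "?f ` ?R" "line_at M 0 0 1" "z = 0"] card_image[of ?f ?R]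
    by (simp only:) simp
  also have "\<dots> = (if (- y)\<^sup>2 = z * x then 1 else if is_square ((- y)\<^sup>2 - z * x) then 2 else 0)"
    by (rule card_projective_roots) (use assms in auto)
  finally show ?thesis unfolding power2_minus mult.commute[of z x] .
qed

lemma internal_iff:
  assumes "(x, y, z) \<noteq> (0, 0, 0)"
  shows "internal_point C (point_at M x y z) \<longleftrightarrow> \<not> is_square (y\<^sup>2 - x * z)"
proof -
  have sq0: "is_square (0::'a)" by (auto simp: is_nth_power_def)
  have "(\<exists>L. tangent_line C L \<and> point_at M x y z \<subseteq> L) \<longleftrightarrow> card {L. tangent_line C L \<and> point_at M x y z \<subseteq> L} \<noteq> 0"
    by auto
  also have "\<dots> \<longleftrightarrow> is_square (y\<^sup>2 - x * z)"
    unfolding tangents_through_point[OF assms] using sq0 by auto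
  finally show ?thesis
    unfolding internal_point_def using assms pt_point C_iff sq0 by auto
qed

lemma internal_nonzero: "\<not> is_square ((y::'a)\<^sup>2 - x * z) \<Longrightarrow> (x, y, z) \<noteq> (0, 0, 0)"
proof
  assume ns: "\<not> is_square (y\<^sup>2 - x * z)" and "(x, y, z) = (0, 0, 0)"
  then have "y\<^sup>2 - x * z = 0\<^sup>2" by simp
  then show False using ns by (metis is_nth_power_nth_power)
qed

lemma nontangent_has_internal:
  assumes "L \<in> pg_lines" "\<not> tangent_line C L"
  obtains P where "internal_point C P" "P \<subseteq> L"
proof -
  obtain a b c where abc: "(a, b, c) \<noteq> (0, 0, 0)" "L = line_at M a b c" using assms(1) by (rule line_cases)
  have "b\<^sup>2 \<noteq> a * c" using assms(2) abc tangent_iff by simp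
  define K where "K = {(x, y) \<in> J. a * x + 2 * b * y + c = 0}"
  have "2 * card K = (if is_square (b\<^sup>2 - a * c) then q - 1 else q + 1)"
    unfolding K_def by (rule card_internal_on_line) fact
  then have "card K \<noteq> 0" using q_gt_3 by (auto split: if_splits)
  then have "K \<noteq> {}" by auto
  then obtain s where "s \<in> K" by blast
  then obtain x y where xy: "(x, y) \<in> J" "a * x + 2 * b * y + c = 0" by (auto simp: K_def)
  show ?thesis
  proof (rule that)
    show "internal_point C (point_at M x y 1)" using xy(1) by (subst internal_iff) (auto simp: J_def)
    show "point_at M x y 1 \<subseteq> L" using xy(2) unfolding abc(2) pt_on_ln by simp
  qed
qed

lemma partitionD:
  assumes "internal_line_partition C \<L>"
  shows "L \<in> \<L> \<Longrightarrow> L \<in> pg_lines" "internal_point C P \<Longrightarrow> \<exists>!L. L \<in> \<L> \<and> P \<subseteq> L"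
    "L \<in> \<L> \<Longrightarrow> \<exists>P. internal_point C P \<and> P \<subseteq> L"
  using assms[unfolded internal_line_partition_def] by (blast, simp, simp)

lemma partition_nontangent:
  assumes "internal_line_partition C \<L>" "L \<in> \<L>"
  shows "\<not> tangent_line C L"
proof
  assume t: "tangent_line C L"
  obtain P where "internal_point C P" "P \<subseteq> L" using partitionD(3)[OF assms] by blast
  then show False using t unfolding internal_point_def by blast
qed

text \<open>
  A nontangent line L through R has an internal point P. The line of the partition through P also passes
  through R, so it is L.
\<close>

lemma pencil_partition:
  assumes part: "internal_line_partition C \<L>" and R: "R \<in> pg_points" "\<not> internal_point C R"
    and through: "\<And>L. L \<in> \<L> \<Longrightarrow> R \<subseteq> L"
  shows "\<L> = {L \<in> pg_lines. R \<subseteq> L \<and> \<not> tangent_line C L}"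
proof (intro equalityI subsetI)
  fix L assume "L \<in> \<L>"
  then show "L \<in> {L \<in> pg_lines. R \<subseteq> L \<and> \<not> tangent_line C L}"
    using partitionD(1)[OF part] through partition_nontangent[OF part] by simp
next
  fix L assume "L \<in> {L \<in> pg_lines. R \<subseteq> L \<and> \<not> tangent_line C L}"
  then have L: "L \<in> pg_lines" "R \<subseteq> L" "\<not> tangent_line C L" by auto
  obtain P where P: "internal_point C P" "P \<subseteq> L" using L(1,3) by (rule nontangent_has_internal)
  obtain L' where L': "L' \<in> \<L>" "P \<subseteq> L'" using partitionD(2)[OF part P(1)] by blast
  have "P \<noteq> R" using P(1) R(2) by auto
  moreover have "P \<in> pg_points" using P(1) by (simp add: internal_point_def)
  ultimately have "L = L'"
    using line_unique[OF L(1) partitionD(1)[OF part L'(1)] _ R(1) _ P(2) L(2) L'(2) through[OF L'(1)]]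
    by simp
  then show "L \<in> \<L>" using L'(1) by simp
qed

lemma partition_coordinates:
  assumes part: "internal_line_partition C \<L>"
  obtains a b c where "apolar_partition q \<L> a b c" "\<And>L. L \<in> \<L> \<Longrightarrow> L = line_at M (a L) (b L) (c L)"
proof -
  have lines: "\<L> \<subseteq> pg_lines" using part by (simp add: internal_line_partition_def)
  have "\<exists>t. L \<in> pg_lines \<longrightarrow> t \<noteq> (0, 0, 0) \<and> L = line_at M (fst t) (fst (snd t)) (snd (snd t))" for L
  proof (cases "L \<in> pg_lines")
    case True
    then obtain a b c where "(a, b, c) \<noteq> (0, 0, 0)" "L = line_at M a b c" by (rule line_cases)
    then show ?thesis by (intro exI[of _ "(a, b, c)"]) simp
  qed simp
  then obtain f where f: "\<And>L. L \<in> pg_lines \<Longrightarrow> f L \<noteq> (0, 0, 0)"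
    "\<And>L. L \<in> pg_lines \<Longrightarrow> L = line_at M (fst (f L)) (fst (snd (f L))) (snd (snd (f L)))" by metis
  define a b c where "a = (\<lambda>L. fst (f L))" and "b = (\<lambda>L. fst (snd (f L)))" and "c = (\<lambda>L. snd (snd (f L)))"
  have abc: "(a L, b L, c L) \<noteq> (0, 0, 0)" "L = line_at M (a L) (b L) (c L)" if "L \<in> \<L>" for L
    using f(1)[of L] f(2)[of L] lines that by (auto simp: a_def b_def c_def)
  have "apolar_partition q \<L> a b c"
  proof unfold_locales
    show "finite \<L>" by simp
    show "(b L)\<^sup>2 \<noteq> a L * c L" if "L \<in> \<L>" for L
      using partition_nontangent[OF part that] tangent_iff[OF abc(1)[OF that]] abc(2)[OF that] by metis
    fix y x z :: 'a assume ns: "\<not> is_square (y\<^sup>2 - x * z)"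
    have "internal_point C (point_at M x y z)" using ns internal_nonzero internal_iff by blast
    then have ex1: "\<exists>!L. L \<in> \<L> \<and> point_at M x y z \<subseteq> L" by (rule partitionD(2)[OF part])
    moreover have "point_at M x y z \<subseteq> L \<longleftrightarrow> a L * x + 2 * b L * y + c L * z = 0" if "L \<in> \<L>" for L
      using pt_on_ln[of x y z "a L" "b L" "c L"] abc(2)[OF that] by metis
    ultimately show "\<exists>!L. L \<in> \<L> \<and> a L * x + 2 * b L * y + c L * z = 0" by metis
  qed
  then show ?thesis using that abc(2) by blast
qed

end

section \<open>Baer subplanes\<close>

lemma subfield_set_imp_subfield:
  assumes "subfield_set (K :: 'b::field set)"
  shows "subfield K (ring_of_type_algebra :: 'b ring)"
proof -
  note Kc = subfield_setD[OF assms]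
  have inv: "\<exists>y\<in>K. y + x = 0 \<and> x + y = 0" if "x \<in> K" for x using Kc(3)[OF that] by (intro bexI[of _ "- x"]) auto
  have minv: "\<exists>y\<in>K. y * x = 1 \<and> x * y = 1" if "x \<in> K" "x \<noteq> 0" for x
    using Kc(7)[OF that(1)] that(2) by (intro bexI[of _ "inverse x"]) auto
  have "field ((ring_of_type_algebra :: 'b ring)\<lparr>carrier := K\<rparr>)"
    unfolding ring_of_type_algebra_def
    by unfold_locales (use Kc inv minv in \<open>auto simp: algebra_simps Units_def\<close>)
  then show ?thesis
    by (intro ring.subfield_iff(1)[OF ring_from_type_algebra]) (auto simp: ring_of_type_algebra_def)
qed

lemma proportional_3:
  fixes x y z x' y' z' :: "'b::field"
  assumes "y * z' = z * y'" "z * x' = x * z'" "x * y' = y * x'" "(x, y, z) \<noteq> (0, 0, 0)"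
  obtains s where "x' = s * x" "y' = s * y" "z' = s * z"
proof -
  consider "x \<noteq> 0" | "y \<noteq> 0" | "z \<noteq> 0" using assms(4) by auto
  then show ?thesis
  proof cases
    case 1
    show ?thesis by (rule that[of "x' / x"]) (use 1 assms in \<open>auto simp: field_simps\<close>)
  next
    case 2
    show ?thesis by (rule that[of "y' / y"]) (use 2 assms in \<open>auto simp: field_simps\<close>)
  next
    case 3
    show ?thesis by (rule that[of "z' / z"]) (use 3 assms in \<open>auto simp: field_simps\<close>)
  qed
qed

definition subframe :: "'b::field set \<Rightarrow> 'b ^ 3 ^ 3 \<Rightarrow> ('b ^ 3) set set" where
  "subframe K M = {point_at M x y z | x y z. x \<in> K \<and> y \<in> K \<and> z \<in> K \<and> (x, y, z) \<noteq> (0, 0, 0)}"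

context odd_field
begin

text \<open>
  With r = |K|, the exponent (q - 1) / 2 is the multiple (r - 1) (r + 1) / 2 of r - 1, so Euler's criterion gives
  the value 1 for every nonzero element of K.
\<close>

lemma square_root_subfield_square:
  assumes K: "subfield_set (K :: 'a set)" "(card K)\<^sup>2 = q" and s: "s \<in> K"
  shows "is_square s"
proof (rule ccontr)
  note Kc = subfield_setD[OF K(1)]
  define r where "r = card K"
  have r2: "q = r * r" using K(2) by (simp add: r_def power2_eq_square)
  have r_odd: "odd r" using odd_q r2 by simp
  assume ns: "\<not> is_square s"
  then have s0: "s \<noteq> 0" using is_nth_power_nth_power[of 2 "0::'a"] by auto
  have "(\<Prod>y\<in>K - {0}. s * y) = (\<Prod>y\<in>K - {0}. y)"
    by (rule prod.reindex_bij_witness[of _ "\<lambda>y. y / s" "\<lambda>y. s * y"]) (use s s0 Kc in auto)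
  then have "s ^ card (K - {0}) * (\<Prod>y\<in>K - {0}. y) = 1 * (\<Prod>y\<in>K - {0}. y)"
    by (simp add: prod.distrib)
  moreover have "(\<Prod>y\<in>K - {0}. y) \<noteq> 0" by simp
  ultimately have "s ^ card (K - {0}) = 1" by (metis mult_right_cancel)
  then have sr: "s ^ (r - 1) = 1" using Kc(1) by (simp add: r_def card_Diff_singleton)
  obtain m where m: "r = 2 * m + 1" using r_odd oddE by blast
  have "(q - 1) div 2 = (r - 1) * (m + 1)" unfolding r2 m by (simp add: algebra_simps)
  then have "s ^ ((q - 1) div 2) = (s ^ (r - 1)) ^ (m + 1)" by (simp only: power_mult)
  then have "s ^ ((q - 1) div 2) = 1" unfolding sr by simp
  then have "(1::'a) = -1" using euler_nonsquare[OF ns] by simp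
  then have "(2::'a) = 0" by (metis add.left_inverse one_add_one)
  then show False using two_nonzero by simp
qed

end

context frame
begin

text \<open>
  The action of \<open>transform\<close> on the points.
\<close>

lemma frame_transform:
  fixes \<alpha> \<beta> \<gamma> \<delta> :: 'a
  assumes d: "\<alpha> * \<delta> - \<beta> * \<gamma> \<noteq> 0"
  obtains M' where "frame q M' C"
    "\<And>x y z. point_at M' x y z = point_at M (\<alpha>\<^sup>2 * x + 2 * \<alpha> * \<beta> * y + \<beta>\<^sup>2 * z)
       (\<alpha> * \<gamma> * x + (\<alpha> * \<delta> + \<beta> * \<gamma>) * y + \<beta> * \<delta> * z) (\<gamma>\<^sup>2 * x + 2 * \<gamma> * \<delta> * y + \<delta>\<^sup>2 * z)"
proof -
  \<comment> \<open>The symmetric square of the matrix with rows (\<alpha>, \<beta>) and (\<gamma>, \<delta>).\<close>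
  define S :: "'a ^ 3 ^ 3" where "S = vector [vector [\<alpha>\<^sup>2, 2 * \<alpha> * \<beta>, \<beta>\<^sup>2],
    vector [\<alpha> * \<gamma>, \<alpha> * \<delta> + \<beta> * \<gamma>, \<beta> * \<delta>], vector [\<gamma>\<^sup>2, 2 * \<gamma> * \<delta>, \<delta>\<^sup>2]]"
  have S: "S *v vector [x, y, z] = vector [\<alpha>\<^sup>2 * x + 2 * \<alpha> * \<beta> * y + \<beta>\<^sup>2 * z,
     \<alpha> * \<gamma> * x + (\<alpha> * \<delta> + \<beta> * \<gamma>) * y + \<beta> * \<delta> * z, \<gamma>\<^sup>2 * x + 2 * \<gamma> * \<delta> * y + \<delta>\<^sup>2 * z]" for x y z
    by (simp add: vec_eq_3 matrix_vector_3 dot3_def vector_3 S_def)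
  have "det S = (\<alpha> * \<delta> - \<beta> * \<gamma>) ^ 3"
    by (simp add: S_def det_3 vector_3 power2_eq_square power3_eq_cube algebra_simps)
  then have "det S \<noteq> 0" using d by simp
  then have iS: "invertible S" using invertible_det_nz by blast
  have pt: "point_at (M ** S) x y z = point_at M (\<alpha>\<^sup>2 * x + 2 * \<alpha> * \<beta> * y + \<beta>\<^sup>2 * z)
       (\<alpha> * \<gamma> * x + (\<alpha> * \<delta> + \<beta> * \<gamma>) * y + \<beta> * \<delta> * z) (\<gamma>\<^sup>2 * x + 2 * \<gamma> * \<delta> * y + \<delta>\<^sup>2 * z)" for x y z
    unfolding point_at_def matrix_vector_mul_assoc[symmetric] S ..
  have "frame q (M ** S) C"
  proof unfold_locales
    show "invertible (M ** S)" using inv iS by (simp add: invertible_mult)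
    show "C \<subseteq> pg_points" by (rule C_points)
    fix x y z :: 'a assume nz: "(x, y, z) \<noteq> (0, 0, 0)"
    let ?x = "\<alpha>\<^sup>2 * x + 2 * \<alpha> * \<beta> * y + \<beta>\<^sup>2 * z"
      and ?y = "\<alpha> * \<gamma> * x + (\<alpha> * \<delta> + \<beta> * \<gamma>) * y + \<beta> * \<delta> * z"
      and ?z = "\<gamma>\<^sup>2 * x + 2 * \<gamma> * \<delta> * y + \<delta>\<^sup>2 * z"
    have "S *v vector [x, y, z] \<noteq> 0"
      using iS matrix_left_invertible_ker[of S] invertible_left_inverse[of S] nz vector_3_eq_0 by metis
    then have "(?x, ?y, ?z) \<noteq> (0, 0, 0)" unfolding S vector_3_eq_0 .
    then have "point_at (M ** S) x y z \<in> C \<longleftrightarrow> ?y\<^sup>2 = ?x * ?z" unfolding pt by (rule C_iff)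
    also have "\<dots> \<longleftrightarrow> ?y\<^sup>2 - ?x * ?z = 0" by simp
    also have "?y\<^sup>2 - ?x * ?z = (\<alpha> * \<delta> - \<beta> * \<gamma>)\<^sup>2 * (y\<^sup>2 - x * z)"
      by (simp add: power2_eq_square algebra_simps)
    finally show "point_at (M ** S) x y z \<in> C \<longleftrightarrow> y\<^sup>2 = x * z" using d by simp
  qed
  then show ?thesis using that pt by blast
qed

lemma line_eqI:
  assumes "L \<in> pg_lines" "(a, b, c) \<noteq> (0, 0, 0)"
    and "\<And>x y z. point_at M x y z \<subseteq> L \<longleftrightarrow> a * x + 2 * b * y + c * z = 0"
  shows "L = line_at M a b c"
proof -
  obtain a' b' c' where L: "(a', b', c') \<noteq> (0, 0, 0)" "L = line_at M a' b' c'" using assms(1) by (rule line_cases)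
  have "a' * x + 2 * b' * y + c' * z = 0 \<longleftrightarrow> a * x + 2 * b * y + c * z = 0" for x y z
    using assms(3) unfolding L(2) pt_on_ln by blast
  then show ?thesis unfolding L(2) line_at_def by simp
qed

context
  fixes K :: "'a set"
  assumes K: "subfield_set K" "(card K)\<^sup>2 = q"
begin

private lemmas Kc = subfield_setD[OF K(1)]

private lemma two_K: "2 \<in> K" using Kc(4)[OF Kc(2) Kc(2)] by simp

private lemma card_K: "1 < card K"
proof (rule ccontr)
  assume "\<not> 1 < card K"
  then have "card K = 0 \<or> card K = 1" by linarith
  then show False using K(2) q_gt_3 by auto
qed

lemma subframe_cases:
  assumes "P \<in> subframe K M"
  obtains x y z where "x \<in> K" "y \<in> K" "z \<in> K" "(x, y, z) \<noteq> (0, 0, 0)" "P = point_at M x y z"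
  using assms unfolding subframe_def mem_Collect_eq by (elim exE conjE) (rule that)

lemma subframe_point: "P \<in> subframe K M \<Longrightarrow> P \<in> pg_points"
  by (elim subframe_cases) (simp only: pt_point not_False_eq_True)

lemma pt_subframe:
  assumes "x \<in> K" "y \<in> K" "z \<in> K" "(x, y, z) \<noteq> (0, 0, 0)"
  shows "point_at M x y z \<in> subframe K M"
  unfolding subframe_def mem_Collect_eq using assms by blast

lemma subframe_projectivity: "projectivity M ` subfield_points K = subframe K M"
proof (rule Set.set_eqI)
  fix P
  have proj: "projectivity M (vec.span {w}) = vec.span {M *v w}" for w
  proof -
    have "M *v (k *s w) = k *s (M *v w)" for k
      by (simp add: vec_eq_3 matrix_vector_3 dot3_def algebra_simps)
    then show ?thesis by (simp add: projectivity_def vec.span_singleton image_image)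
  qed
  show "P \<in> projectivity M ` subfield_points K \<longleftrightarrow> P \<in> subframe K M"
  proof
    assume "P \<in> projectivity M ` subfield_points K"
    then obtain R and v :: "'a ^ 3" where R: "P = projectivity M R" "R \<in> pg_points" "v \<in> R" "v \<noteq> 0" "\<forall>i. v $ i \<in> K"
      by (auto simp: subfield_points_def)
    obtain u where u: "u \<noteq> 0" "R = vec.span {u}" using R(2) by (auto simp: pg_points_iff)
    obtain k where k: "v = k *s u" using R(3) u(2) by (auto simp: vec.span_singleton)
    then have "k \<noteq> 0" using R(4) by auto
    then have vR: "vec.span {v} = R"
      unfolding u(2) k using vec.span_image_scale[of "{u}" "\<lambda>_. k"] by simp
    have "P = vec.span {M *v v}" using R(1) proj[of v] unfolding vR by simp
    then have "P = point_at M (v $ 1) (v $ 2) (v $ 3)" by (simp add: point_at_def vector_3_eta)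
    moreover have "(v $ 1, v $ 2, v $ 3) \<noteq> (0, 0, 0)" using R(4) by (simp add: vec_eq_3)
    ultimately show "P \<in> subframe K M" using pt_subframe R(5) by simp
  next
    assume "P \<in> subframe K M"
    then obtain x y z where xyz: "x \<in> K" "y \<in> K" "z \<in> K" "(x, y, z) \<noteq> (0, 0, 0)" "P = point_at M x y z"
      by (rule subframe_cases)
    let ?v = "vector [x, y, z] :: 'a ^ 3"
    have v0: "?v \<noteq> 0" using xyz(4) by (simp only: vector_3_eq_0 not_False_eq_True)
    moreover have "\<forall>i. ?v $ i \<in> K" using xyz(1-3) by (simp add: forall_3 vector_3)
    moreover have "?v \<in> vec.span {?v}" by (rule vec.span_base) simp
    moreover have "vec.span {?v} \<in> pg_points" unfolding pg_points_iff using v0 by blast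
    ultimately have "vec.span {?v} \<in> subfield_points K" unfolding subfield_points_def by blast
    then show "P \<in> projectivity M ` subfield_points K"
      unfolding xyz(5) point_at_def proj[symmetric] by (rule imageI)
  qed
qed

lemma card_image_insert:
  fixes f :: "'a \<Rightarrow> ('a ^ 3) set"
  assumes "inj_on f K" "p \<notin> f ` K"
  shows "card (f ` K \<union> {p}) = card K + 1"
  using assms by (simp add: card_image)

lemma card_conic_subframe: "card (subframe K M \<inter> C) = card K + 1"
proof -
  let ?f = "\<lambda>t. point_at M (t\<^sup>2) t 1"
  have "subframe K M \<inter> C = ?f ` K \<union> {point_at M 1 0 0}"
  proof (intro equalityI subsetI)
    fix P assume P: "P \<in> subframe K M \<inter> C"
    from IntD1[OF this] obtain x y z where xyz: "x \<in> K" "y \<in> K" "z \<in> K" "(x, y, z) \<noteq> (0, 0, 0)" "P = point_at M x y z"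
      by (elim subframe_cases)
    then have eq: "y\<^sup>2 = x * z" using P C_iff by auto
    show "P \<in> ?f ` K \<union> {point_at M 1 0 0}"
    proof (cases "z = 0")
      case True
      then have "y = 0" "x \<noteq> 0" using eq xyz(4) by auto
      then show ?thesis using True xyz(5) pt_scale[of x 1 0 0] by auto
    next
      case False
      have "x = z * (y / z)\<^sup>2" "y = z * (y / z)" using eq False by (simp_all add: power2_eq_square field_simps)
      then have "P = ?f (y / z)" using xyz(5) pt_scale[OF False, of "(y / z)\<^sup>2" "y / z" 1] by simp
      then show ?thesis using Kc(8)[OF xyz(2,3)] by blast
    qed
  next
    fix P assume "P \<in> ?f ` K \<union> {point_at M 1 0 0}"
    then show "P \<in> subframe K M \<inter> C"
      using Kc by (auto simp: C_iff power2_eq_square intro!: pt_subframe)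
  qed
  moreover have "inj_on ?f K"
  proof (rule inj_onI)
    fix s t assume "?f s = ?f t"
    from pt_eqD[OF this] show "s = t" by auto
  qed
  moreover have "point_at M 1 0 0 \<notin> ?f ` K"
  proof
    assume "point_at M 1 0 0 \<in> ?f ` K"
    then obtain t where "point_at M 1 0 0 = ?f t" by blast
    from pt_eqD[OF this] show False by auto
  qed
  ultimately show ?thesis using card_image_insert by simp
qed

lemma card_subframe_line:
  assumes abc: "a \<in> K" "b \<in> K" "c \<in> K" "(a, b) \<noteq> (0, 0)"
  shows "card (points_on (subframe K M) (line_at M a b c)) = card K + 1"
proof (cases "a = 0")
  case True
  then have b0: "b \<noteq> 0" using abc(4) by simp
  have tb: "2 * b \<noteq> 0" using b0 two_nonzero by simp
  let ?y = "- c / (2 * b)"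
  let ?f = "\<lambda>t. point_at M t ?y 1"
  have yK: "?y \<in> K" using Kc(8)[OF Kc(3)[OF abc(3)] Kc(6)[OF two_K abc(2)]] .
  have ye: "2 * b * ?y + c = 0" using tb by simp
  have "points_on (subframe K M) (line_at M a b c) = ?f ` K \<union> {point_at M 1 0 0}"
  proof (intro equalityI subsetI)
    fix P assume "P \<in> points_on (subframe K M) (line_at M a b c)"
    then have P: "P \<in> subframe K M" "P \<subseteq> line_at M a b c" by (auto simp: points_on_def)
    then obtain x y z where xyz: "x \<in> K" "y \<in> K" "z \<in> K" "(x, y, z) \<noteq> (0, 0, 0)" "P = point_at M x y z"
      by (elim subframe_cases)
    then have eq: "2 * b * y + c * z = 0" using P(2) pt_on_ln True by simp
    show "P \<in> ?f ` K \<union> {point_at M 1 0 0}"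
    proof (cases "z = 0")
      case True
      then have "y = 0" using eq tb by simp
      then show ?thesis using True xyz(4,5) pt_scale[of x 1 0 0] by auto
    next
      case False
      have "2 * b * y = 2 * b * (z * ?y)" using eq ye by (simp add: add_eq_0_iff2 algebra_simps)
      then have "y = z * ?y" using mult_left_cancel[OF tb] by blast
      then have "P = ?f (x / z)" using xyz(5) False pt_scale[OF False, of "x / z" ?y 1] by simp
      then show ?thesis using Kc(8)[OF xyz(1,3)] by blast
    qed
  next
    fix P assume "P \<in> ?f ` K \<union> {point_at M 1 0 0}"
    then consider t where "t \<in> K" "P = ?f t" | "P = point_at M 1 0 0" by blast
    then show "P \<in> points_on (subframe K M) (line_at M a b c)"
    proof cases
      case 1
      then show ?thesis using pt_subframe[OF 1(1) yK Kc(2)] ye True unfolding points_on_def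
        by (simp add: pt_on_ln)
    next
      case 2
      then show ?thesis using pt_subframe[OF Kc(2) Kc(1) Kc(1)] True unfolding points_on_def
        by (simp add: pt_on_ln)
    qed
  qed
  moreover have "inj_on ?f K"
  proof (rule inj_onI)
    fix s t assume "?f s = ?f t"
    from pt_eqD[OF this] show "s = t" by auto
  qed
  moreover have "point_at M 1 0 0 \<notin> ?f ` K"
  proof
    assume "point_at M 1 0 0 \<in> ?f ` K"
    then obtain t where "point_at M 1 0 0 = ?f t" by blast
    from pt_eqD[OF this] show False by auto
  qed
  ultimately show ?thesis using card_image_insert by simp
next
  case False
  let ?x = "\<lambda>t. - (2 * b * t + c) / a" and ?p = "point_at M (- (2 * b) / a) 1 0"
  let ?f = "\<lambda>t. point_at M (?x t) t 1"
  have xK: "?x t \<in> K" if "t \<in> K" for t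
    using that by (intro Kc(8) Kc(3) Kc(4) Kc(6) two_K abc)
  have pK: "- (2 * b) / a \<in> K" by (intro Kc(8) Kc(3) Kc(6) two_K abc)
  have xe: "a * ?x t + 2 * b * t + c = 0" for t using False by simp
  have "points_on (subframe K M) (line_at M a b c) = ?f ` K \<union> {?p}"
  proof (intro equalityI subsetI)
    fix P assume "P \<in> points_on (subframe K M) (line_at M a b c)"
    then have P: "P \<in> subframe K M" "P \<subseteq> line_at M a b c" by (auto simp: points_on_def)
    then obtain x y z where xyz: "x \<in> K" "y \<in> K" "z \<in> K" "(x, y, z) \<noteq> (0, 0, 0)" "P = point_at M x y z"
      by (elim subframe_cases)
    then have eq: "a * x + 2 * b * y + c * z = 0" using P(2) pt_on_ln by simp
    then have x: "x = - (2 * b * y + c * z) / a" using False by (simp add: field_simps add_eq_0_iff)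
    show "P \<in> ?f ` K \<union> {?p}"
    proof (cases "z = 0")
      case True
      then have y0: "y \<noteq> 0" using xyz(4) x by auto
      have "x = y * (- (2 * b) / a)" using x True by simp
      then have "P = ?p" using xyz(5) True pt_scale[OF y0, of "- (2 * b) / a" 1 0] by simp
      then show ?thesis by simp
    next
      case z0: False
      have "z * (2 * b * (y / z) + c) = 2 * b * y + c * z" using z0 by (simp add: algebra_simps)
      moreover have "z * (- w / a) = - (z * w) / a" for w by simp
      from this[of "2 * b * (y / z) + c"] have "z * ?x (y / z) = - (z * (2 * b * (y / z) + c)) / a" .
      ultimately have "x = z * ?x (y / z)" using x by (simp only:)
      then have "P = ?f (y / z)" using xyz(5) z0 pt_scale[OF z0, of "?x (y / z)" "y / z" 1] by simp
      then show ?thesis using Kc(8)[OF xyz(2,3)] by blast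
    qed
  next
    fix P assume "P \<in> ?f ` K \<union> {?p}"
    then consider t where "t \<in> K" "P = ?f t" | "P = ?p" by blast
    then show "P \<in> points_on (subframe K M) (line_at M a b c)"
    proof cases
      case 1
      then show ?thesis using pt_subframe[OF xK[OF 1(1)] 1(1) Kc(2)] xe[of t] unfolding points_on_def
        by (simp add: pt_on_ln)
    next
      case 2
      then show ?thesis using pt_subframe[OF pK Kc(2) Kc(1)] False unfolding points_on_def
        by (simp add: pt_on_ln)
    qed
  qed
  moreover have "inj_on ?f K"
  proof (rule inj_onI)
    fix s t assume "?f s = ?f t"
    from pt_eqD[OF this] show "s = t" by auto
  qed
  moreover have "?p \<notin> ?f ` K"
  proof
    assume "?p \<in> ?f ` K"
    then obtain t where "?p = ?f t" by blast
    from pt_eqD[OF this] show False by auto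
  qed
  ultimately show ?thesis using card_image_insert by simp
qed

text \<open>
  The line through two points over K has the cross product of their coordinate vectors as coefficients.
\<close>

lemma subframe_line_rational:
  assumes L: "L \<in> pg_lines" "card (points_on (subframe K M) L) = card K + 1"
  shows "\<exists>a\<in>K. \<exists>b\<in>K. \<exists>c\<in>K. (a, b, c) \<noteq> (0, 0, 0) \<and> L = line_at M a b c"
proof -
  have "\<not> card (points_on (subframe K M) L) \<le> 1" using L(2) card_K by linarith
  then obtain P R where PR: "P \<in> points_on (subframe K M) L" "R \<in> points_on (subframe K M) L" "P \<noteq> R"
    using card_le_Suc0_iff_eq[of "points_on (subframe K M) L"] by auto
  have inP: "P \<in> subframe K M" "R \<in> subframe K M" using PR(1,2) by (simp_all add: points_on_def)
  obtain x y z where P: "x \<in> K" "y \<in> K" "z \<in> K" "(x, y, z) \<noteq> (0, 0, 0)" "P = point_at M x y z"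
    using inP(1) by (rule subframe_cases)
  obtain x' y' z' where R: "x' \<in> K" "y' \<in> K" "z' \<in> K" "(x', y', z') \<noteq> (0, 0, 0)" "R = point_at M x' y' z'"
    using inP(2) by (rule subframe_cases)
  define a b c where "a = y * z' - z * y'" and "b = (z * x' - x * z') / 2" and "c = x * y' - y * x'"
  have b2: "2 * b = z * x' - x * z'" using two_nonzero by (simp add: b_def)
  have nz: "(a, b, c) \<noteq> (0, 0, 0)"
  proof
    assume "(a, b, c) = (0, 0, 0)"
    then have "y * z' = z * y'" "z * x' = x * z'" "x * y' = y * x'" using b2 by (auto simp: a_def c_def)
    then obtain s where s: "x' = s * x" "y' = s * y" "z' = s * z" using proportional_3 P(4) by blast
    then have "s \<noteq> 0" using R(4) by auto
    then show False using PR(3) P(5) R(5) s pt_scale by simp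
  qed
  have "P \<subseteq> line_at M a b c" "R \<subseteq> line_at M a b c"
    unfolding P(5) R(5) pt_on_ln b2 by (simp_all add: a_def c_def algebra_simps)
  moreover have "P \<in> pg_points" "R \<in> pg_points" "P \<subseteq> L" "R \<subseteq> L"
    using PR(1,2) subframe_point by (simp_all add: points_on_def)
  ultimately have "L = line_at M a b c"
    using line_unique[OF L(1) ln_line[OF nz] _ _ PR(3)] by simp
  moreover have "a \<in> K" "b \<in> K" "c \<in> K"
    unfolding a_def b_def c_def using P R two_K by (auto intro!: Kc(5) Kc(6) Kc(8))
  ultimately show ?thesis using nz by blast
qed

text \<open>
  Let L be a nontangent line over K, P an internal point of L, and L' the line of the partition
  through P. If L and L' differ, their meet P has coordinates in K, so y^2 - x z lies in K and is a square,
  and P is not internal.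
\<close>

lemma baer_case:
  assumes part: "internal_line_partition C \<L>"
    and rational: "\<And>L. L \<in> \<L> \<Longrightarrow> \<exists>a\<in>K. \<exists>b\<in>K. \<exists>c\<in>K. (a, b, c) \<noteq> (0, 0, 0) \<and> L = line_at M a b c"
  shows "\<exists>B. baer_subplane (card K) B \<and> card (B \<inter> C) = card K + 1
    \<and> \<L> = {L \<in> baer_lines (card K) B. \<not> tangent_line C L}"
proof -
  have "\<L> = {L \<in> baer_lines (card K) (subframe K M). \<not> tangent_line C L}"
  proof (intro equalityI subsetI)
    fix L assume L: "L \<in> \<L>"
    obtain a b c where abc: "a \<in> K" "b \<in> K" "c \<in> K" "(a, b, c) \<noteq> (0, 0, 0)" "L = line_at M a b c"
      using rational[OF L] by blast
    have nt: "\<not> tangent_line C L" by (rule partition_nontangent[OF part L])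
    then have "(a, b) \<noteq> (0, 0)" using tangent_iff[OF abc(4)] abc(5) by auto
    then show "L \<in> {L \<in> baer_lines (card K) (subframe K M). \<not> tangent_line C L}"
      using card_subframe_line[OF abc(1-3)] abc(5) nt partitionD(1)[OF part L] by (simp add: baer_lines_def)
  next
    fix L assume "L \<in> {L \<in> baer_lines (card K) (subframe K M). \<not> tangent_line C L}"
    then have L: "L \<in> pg_lines" "card (points_on (subframe K M) L) = card K + 1" "\<not> tangent_line C L"
      by (auto simp: baer_lines_def)
    obtain a b c where abc: "a \<in> K" "b \<in> K" "c \<in> K" "(a, b, c) \<noteq> (0, 0, 0)" "L = line_at M a b c"
      using subframe_line_rational[OF L(1,2)] by blast
    obtain P where P: "internal_point C P" "P \<subseteq> L" using L(1,3) by (rule nontangent_has_internal)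
    obtain L' where L': "L' \<in> \<L>" "P \<subseteq> L'" using partitionD(2)[OF part P(1)] by blast
    obtain a' b' c' where abc': "a' \<in> K" "b' \<in> K" "c' \<in> K" "(a', b', c') \<noteq> (0, 0, 0)" "L' = line_at M a' b' c'"
      using rational[OF L'(1)] by blast
    have "L = L'"
    proof (rule ccontr)
      assume ne: "L \<noteq> L'"
      \<comment> \<open>The meet of two lines is the cross product of their coefficient vectors (a, 2 b, c).\<close>
      define x y z where "x = 2 * b * c' - c * (2 * b')" and "y = c * a' - a * c'"
        and "z = a * (2 * b') - 2 * b * a'"
      have xyzK: "x \<in> K" "y \<in> K" "z \<in> K"
        unfolding x_def y_def z_def using abc abc' two_K by (auto intro!: Kc(5) Kc(6))
      have nz: "(x, y, z) \<noteq> (0, 0, 0)"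
      proof
        assume "(x, y, z) = (0, 0, 0)"
        then have "2 * b * c' = c * (2 * b')" "c * a' = a * c'" "a * (2 * b') = 2 * b * a'"
          by (auto simp: x_def y_def z_def)
        moreover have "(a, 2 * b, c) \<noteq> (0, 0, 0)" using abc(4) two_nonzero by simp
        ultimately obtain s where s: "a' = s * a" "2 * b' = s * (2 * b)" "c' = s * c"
          using proportional_3[of "2 * b" c' c "2 * b'" a' a] by metis
        have "2 * b' = 2 * (s * b)" using s(2) by (simp add: mult.left_commute)
        then have b': "b' = s * b" using mult_left_cancel[OF two_nonzero] by blast
        then have "s \<noteq> 0" using abc'(4) s by auto
        then show False using ne abc(5) abc'(5) s b' ln_scale by simp
      qed
      have "point_at M x y z \<subseteq> L" "point_at M x y z \<subseteq> L'"
        unfolding abc(5) abc'(5) pt_on_ln by (simp_all add: x_def y_def z_def algebra_simps)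
      moreover have "P \<in> pg_points" using P(1) by (simp add: internal_point_def)
      ultimately have "P = point_at M x y z"
        using line_unique[OF L(1) partitionD(1)[OF part L'(1)] _ pt_point[OF nz] _ P(2) _ L'(2)] ne by blast
      then have "\<not> is_square (y\<^sup>2 - x * z)" using P(1) internal_iff[OF nz] by simp
      moreover have "y\<^sup>2 - x * z \<in> K" unfolding power2_eq_square using xyzK by (intro Kc(5) Kc(6))
      ultimately show False using square_root_subfield_square[OF K] by blast
    qed
    then show "L \<in> \<L>" using L'(1) by simp
  qed
  moreover have "baer_subplane (card K) (subframe K M)"
    unfolding baer_subplane_def
  proof (intro conjI exI)
    show "(card K)\<^sup>2 = CARD('a)" using K(2) q_card by simp
    show "subfield K (ring_of_type_algebra :: 'a ring)" by (rule subfield_set_imp_subfield[OF K(1)])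
    show "subframe K M = projectivity M ` subfield_points K" by (rule subframe_projectivity[symmetric])
  qed (rule refl inv)+
  ultimately show ?thesis using card_conic_subframe by blast
qed

end

end

section \<open>Irreducible conics are nondegenerate quadratic forms\<close>

abbreviation var :: "3 \<Rightarrow> (3 \<Rightarrow>\<^sub>0 nat)" where "var i \<equiv> Poly_Mapping.single i (Suc 0)"

lemma poly_mapping_eq_3:
  fixes m m' :: "3 \<Rightarrow>\<^sub>0 nat"
  assumes "Poly_Mapping.lookup m 1 = Poly_Mapping.lookup m' 1" "Poly_Mapping.lookup m 2 = Poly_Mapping.lookup m' 2"
    "Poly_Mapping.lookup m 3 = Poly_Mapping.lookup m' 3"
  shows "m = m'"
proof (rule poly_mapping_eqI)
  fix i show "Poly_Mapping.lookup m i = Poly_Mapping.lookup m' i" using exhaust_3[of i] assms by auto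
qed

lemma nat_triples_sum_two:
  fixes a b c :: nat
  assumes "a + b + c = 2"
  shows "(a, b, c) \<in> {(2, 0, 0), (0, 2, 0), (0, 0, 2), (1, 1, 0), (1, 0, 1), (0, 1, 1)}"
proof -
  have "a = 0 \<or> a = 1 \<or> a = 2" "b = 0 \<or> b = 1 \<or> b = 2" using assms by arith+
  then show ?thesis using assms by (elim disjE) simp_all
qed

lemma degree_two_monomial:
  assumes "(\<Sum>i\<in>UNIV. Poly_Mapping.lookup m i) = 2"
  obtains i j where "m = var i + var j"
proof -
  have "Poly_Mapping.lookup m 1 + Poly_Mapping.lookup m 2 + Poly_Mapping.lookup m 3 = 2"
    using assms by (simp add: sum_3)
  then have "(Poly_Mapping.lookup m 1, Poly_Mapping.lookup m 2, Poly_Mapping.lookup m 3)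
      \<in> {(2, 0, 0), (0, 2, 0), (0, 0, 2), (1, 1, 0), (1, 0, 1), (0, 1, 1)}"
    by (rule nat_triples_sum_two)
  then show ?thesis
    unfolding insert_iff prod.inject empty_iff
  proof (elim disjE conjE FalseE)
    assume "Poly_Mapping.lookup m 1 = 2" "Poly_Mapping.lookup m 2 = 0" "Poly_Mapping.lookup m 3 = 0"
    then have "m = var 1 + var 1" by (intro poly_mapping_eq_3) (simp_all add: lookup_add lookup_single)
    then show ?thesis by (rule that)
  next
    assume "Poly_Mapping.lookup m 1 = 0" "Poly_Mapping.lookup m 2 = 2" "Poly_Mapping.lookup m 3 = 0"
    then have "m = var 2 + var 2" by (intro poly_mapping_eq_3) (simp_all add: lookup_add lookup_single)
    then show ?thesis by (rule that)
  next
    assume "Poly_Mapping.lookup m 1 = 0" "Poly_Mapping.lookup m 2 = 0" "Poly_Mapping.lookup m 3 = 2"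
    then have "m = var 3 + var 3" by (intro poly_mapping_eq_3) (simp_all add: lookup_add lookup_single)
    then show ?thesis by (rule that)
  next
    assume "Poly_Mapping.lookup m 1 = 1" "Poly_Mapping.lookup m 2 = 1" "Poly_Mapping.lookup m 3 = 0"
    then have "m = var 1 + var 2" by (intro poly_mapping_eq_3) (simp_all add: lookup_add lookup_single)
    then show ?thesis by (rule that)
  next
    assume "Poly_Mapping.lookup m 1 = 1" "Poly_Mapping.lookup m 2 = 0" "Poly_Mapping.lookup m 3 = 1"
    then have "m = var 1 + var 3" by (intro poly_mapping_eq_3) (simp_all add: lookup_add lookup_single)
    then show ?thesis by (rule that)
  next
    assume "Poly_Mapping.lookup m 1 = 0" "Poly_Mapping.lookup m 2 = 1" "Poly_Mapping.lookup m 3 = 1"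
    then have "m = var 2 + var 3" by (intro poly_mapping_eq_3) (simp_all add: lookup_add lookup_single)
    then show ?thesis by (rule that)
  qed
qed

lemma monomial_eq_iff: "var i + var j = var k + var l \<longleftrightarrow> i = k \<and> j = l \<or> i = l \<and> j = k"
proof
  assume e: "var i + var j = var k + var l"
  have "i = k \<or> i = l"
  proof (rule ccontr)
    assume "\<not> ?thesis"
    moreover have "Poly_Mapping.lookup (var i + var j) i = Poly_Mapping.lookup (var k + var l) i" using e by simp
    ultimately show False by (simp add: lookup_add lookup_single when_def split: if_splits)
  qed
  then show "i = k \<and> j = l \<or> i = l \<and> j = k"
  proof
    assume i: "i = k"
    then have "var j = var l" using e by simp
    then have "Poly_Mapping.lookup (var j) j = Poly_Mapping.lookup (var l) j" by simp
    then show ?thesis using i by (simp add: lookup_single when_def split: if_splits)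
  next
    assume i: "i = l"
    then have "var j = var k" using e by (simp add: add.commute)
    then have "Poly_Mapping.lookup (var j) j = Poly_Mapping.lookup (var k) j" by simp
    then show ?thesis using i by (simp add: lookup_single when_def split: if_splits)
  qed
qed (auto simp: add.commute)

definition gram_poly :: "'b::comm_ring_1 ^ 3 ^ 3 \<Rightarrow> 'b poly3" where
  "gram_poly A = (\<Sum>i\<in>UNIV. \<Sum>j\<in>UNIV. Poly_Mapping.single (var i + var j) (A $ i $ j))"

lemma lookup_gram_poly:
  assumes "transpose A = A"
  shows "Poly_Mapping.lookup (gram_poly A) (var k + var l) = (if k = l then A $ k $ k else 2 * A $ k $ l)"
proof -
  have sym: "A $ j $ i = A $ i $ j" for i j
    using assms by (metis (no_types, lifting) transpose_def vec_lambda_beta)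
  have delta: "(\<Sum>i\<in>UNIV. \<Sum>j\<in>UNIV. if i = m \<and> j = n then A $ i $ j else 0) = A $ m $ n" for m n
  proof -
    have "(\<Sum>j\<in>UNIV. if i = m \<and> j = n then A $ i $ j else 0) = (if i = m then A $ i $ n else 0)" for i
      by (cases "i = m") simp_all
    then show ?thesis by simp
  qed
  have "Poly_Mapping.lookup (gram_poly A) (var k + var l)
    = (\<Sum>i\<in>UNIV. \<Sum>j\<in>UNIV. if i = k \<and> j = l \<or> i = l \<and> j = k then A $ i $ j else 0)"
    unfolding gram_poly_def lookup_sum lookup_single when_def monomial_eq_iff ..
  also have "\<dots> = (if k = l then A $ k $ k else 2 * A $ k $ l)"
  proof (cases "k = l")
    case True
    then show ?thesis using delta[of k l] by (simp only: disj_absorb simp_thms if_True)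
  next
    case False
    have eq: "(if i = k \<and> j = l \<or> i = l \<and> j = k then A $ i $ j else 0)
      = (if i = k \<and> j = l then A $ i $ j else 0) + (if i = l \<and> j = k then A $ i $ j else 0)" for i j
      using False by (cases "i = k \<and> j = l"; cases "i = l \<and> j = k") (simp_all only: simp_thms if_True if_False add_0 add_0_right)
    have "(\<Sum>i\<in>UNIV. \<Sum>j\<in>UNIV. if i = k \<and> j = l \<or> i = l \<and> j = k then A $ i $ j else 0) = A $ k $ l + A $ l $ k"
      unfolding eq sum.distrib delta ..
    then show ?thesis unfolding sym[of k l] using False by (simp only: mult_2 if_False)
  qed
  finally show ?thesis .
qed

lemma lookup_gram_poly_other:
  assumes "\<And>i j. m \<noteq> var i + var j"
  shows "Poly_Mapping.lookup (gram_poly A) m = 0"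
  unfolding gram_poly_def lookup_sum lookup_single when_def by (simp add: assms[symmetric])

lemma eval3_superset:
  assumes "finite S" "Poly_Mapping.keys F \<subseteq> S"
  shows "eval3 F v = (\<Sum>m\<in>S. Poly_Mapping.lookup F m * (\<Prod>i\<in>UNIV. (v $ i) ^ Poly_Mapping.lookup m i))"
  unfolding eval3_def by (rule sum.mono_neutral_left) (use assms in \<open>auto simp: in_keys_iff\<close>)

lemma eval3_add: "eval3 (F + H) v = eval3 F v + eval3 H v"
proof -
  let ?S = "Poly_Mapping.keys F \<union> Poly_Mapping.keys H"
  have "Poly_Mapping.keys (F + H) \<subseteq> ?S" by (rule keys_add)
  then show ?thesis
    by (simp add: eval3_superset[of ?S F] eval3_superset[of ?S H] eval3_superset[of ?S "F + H"]
        lookup_add distrib_right sum.distrib)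
qed

lemma eval3_sum: "finite S \<Longrightarrow> eval3 (\<Sum>x\<in>S. f x) v = (\<Sum>x\<in>S. eval3 (f x) v)"
  by (induction S rule: finite_induct) (simp_all add: eval3_add, simp add: eval3_def)

lemma eval3_single: "eval3 (Poly_Mapping.single (var i + var j) x) v = x * (v $ i * v $ j)"
proof -
  have one: "(\<Prod>k\<in>UNIV. (v $ k) ^ Poly_Mapping.lookup (var i) k) = v $ i" for i :: 3
  proof -
    have "(\<Prod>k\<in>UNIV. (v $ k) ^ Poly_Mapping.lookup (var i) k) = (\<Prod>k\<in>UNIV. if k = i then v $ k else 1)"
      by (rule prod.cong) (auto simp: lookup_single when_def)
    then show ?thesis by simp
  qed
  show ?thesis
    by (subst eval3_superset[of "{var i + var j}"])
      (auto simp: lookup_add power_add prod.distrib one)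
qed

lemma eval3_gram_poly: "eval3 (gram_poly A) v = bform A v v"
  unfolding gram_poly_def eval3_sum[OF finite] eval3_single
  by (simp add: bform_def dot3_def matrix_vector_3 sum_3 algebra_simps)

context odd_field
begin

text \<open>
  Halving the mixed coefficients is possible since 2 is not 0.
\<close>

lemma homogeneous_gram:
  assumes "homogeneous3 2 (F :: 'a poly3)"
  obtains A :: "'a ^ 3 ^ 3" where "transpose A = A" "F = gram_poly A"
    "Poly_Mapping.map to_ac F = gram_poly ((\<chi> i j. to_ac (A $ i $ j)) :: 'a alg_closure ^ 3 ^ 3)"
proof -
  define A :: "'a ^ 3 ^ 3" where "A = (\<chi> i j. if i = j then Poly_Mapping.lookup F (var i + var i)
    else Poly_Mapping.lookup F (var i + var j) / 2)"
  have sym: "transpose A = A" by (simp add: A_def transpose_def vec_eq_iff add.commute)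
  let ?A' = "(\<chi> i j. to_ac (A $ i $ j)) :: 'a alg_closure ^ 3 ^ 3"
  have sym': "transpose ?A' = ?A'"
    using sym by (simp add: transpose_def vec_eq_iff)
  have look: "Poly_Mapping.lookup F m = Poly_Mapping.lookup (gram_poly A) m" for m
  proof (cases "\<exists>i j. m = var i + var j")
    case True
    then obtain i j where m: "m = var i + var j" by blast
    show ?thesis unfolding m lookup_gram_poly[OF sym] using two_nonzero by (simp add: A_def)
  next
    case False
    then have "m \<notin> Poly_Mapping.keys F"
      using assms degree_two_monomial[of m] unfolding homogeneous3_def by blast
    then show ?thesis using False by (simp add: lookup_gram_poly_other in_keys_iff)
  qed
  have "F = gram_poly A" by (rule poly_mapping_eqI) (rule look)
  moreover have "Poly_Mapping.map to_ac F = gram_poly ?A'"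
  proof (rule poly_mapping_eqI)
    fix m
    have "Poly_Mapping.lookup (Poly_Mapping.map to_ac F) m = to_ac (Poly_Mapping.lookup F m)"
      by (simp add: Poly_Mapping.map.rep_eq when_def)
    also have "\<dots> = Poly_Mapping.lookup (gram_poly ?A') m"
    proof (cases "\<exists>i j. m = var i + var j")
      case True
      then obtain i j where m: "m = var i + var j" by blast
      show ?thesis unfolding look unfolding m lookup_gram_poly[OF sym] lookup_gram_poly[OF sym'] by simp
    next
      case False
      then show ?thesis unfolding look by (simp add: lookup_gram_poly_other)
    qed
    finally show "Poly_Mapping.lookup (Poly_Mapping.map to_ac F) m = Poly_Mapping.lookup (gram_poly ?A') m" .
  qed
  ultimately show ?thesis using that sym by blast
qed

end

lemma lookup_times_zero:
  fixes f g :: "'b::comm_ring_1 poly3"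
  assumes "Poly_Mapping.lookup g 0 = 0"
  shows "Poly_Mapping.lookup (f * g) 0 = 0"
proof (rule ccontr)
  assume "Poly_Mapping.lookup (f * g) 0 \<noteq> 0"
  then have "0 \<in> Poly_Mapping.keys (f * g)" by (simp add: in_keys_iff)
  then obtain s t where st: "0 = s + t" "t \<in> Poly_Mapping.keys g" using keys_mult[of f g] by blast
  have "t = 0"
  proof (rule poly_mapping_eqI)
    fix i
    have "Poly_Mapping.lookup (s + t) i = 0" using st(1) by (metis lookup_zero)
    then show "Poly_Mapping.lookup t i = Poly_Mapping.lookup 0 i" by (simp add: lookup_add)
  qed
  then show False using st(2) assms by (simp add: in_keys_iff)
qed

lemma nonunit_no_constant:
  fixes f :: "'b::comm_ring_1 poly3"
  assumes "Poly_Mapping.lookup f 0 = 0"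
  shows "\<not> f dvd 1"
proof
  assume "f dvd 1"
  then obtain g where "1 = f * g" ..
  then have "Poly_Mapping.lookup (1 :: 'b poly3) 0 = Poly_Mapping.lookup (g * f) 0" by (simp add: mult.commute)
  then show False using lookup_times_zero[OF assms, of g] by simp
qed

lemma binary_form_splits:
  fixes f g h :: "'b::alg_closed_field"
  obtains r s t u where "f = r * t" "2 * g = r * u + s * t" "h = s * u"
proof (cases "f = 0")
  case True
  show ?thesis by (rule that[where r = "2 * g" and s = h and t = 0 and u = 1]) (use True in simp_all)
next
  case False
  then have "degree [:h, 2 * g, f:] > 0" by simp
  then obtain z where "poly [:h, 2 * g, f:] z = 0" using alg_closed_imp_poly_has_root by blast
  then have h: "h = - (2 * g * z + f * z * z)" by (simp add: algebra_simps eq_neg_iff_add_eq_0)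
  show ?thesis by (rule that[where r = 1 and s = "- z" and t = f and u = "2 * g + f * z"]) (simp_all add: h algebra_simps)
qed

text \<open>
  In coordinates adapted to a vector v of the radical, the form depends on two variables only, and a
  binary form over an algebraically closed field splits into linear factors. The adapted variables are
  y i = x i - (v i / v k) x k with v k nonzero, so that y k = 0. Polynomials without constant term are not
  units.
\<close>

lemma degenerate_gram_poly_reducible:
  fixes A :: "'b::alg_closed_field ^ 3 ^ 3"
  assumes sym: "\<And>i j. A $ i $ j = A $ j $ i" and v: "v \<noteq> 0" "A *v v = 0"
  shows "\<not> Factorial_Ring.irreducible (gram_poly A)"
proof
  assume irr: "Factorial_Ring.irreducible (gram_poly A)"
  obtain k where k: "v $ k \<noteq> 0" using v(1) by (auto simp: vec_eq_iff)
  define cst :: "'b \<Rightarrow> 'b poly3" where "cst = Poly_Mapping.single 0"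
  define x :: "3 \<Rightarrow> 'b poly3" where "x = (\<lambda>i. Poly_Mapping.single (var i) 1)"
  define m where "m = (\<lambda>i. v $ i / v $ k)"
  define y where "y = (\<lambda>i. x i - cst (m i) * x k)"
  have cst: "cst (s + t) = cst s + cst t" "cst (s * t) = cst s * cst t" "cst 0 = 0" "cst 1 = 1" for s t
    by (simp_all add: cst_def single_add mult_single)
  have cst_sum: "cst (\<Sum>j\<in>UNIV. f j) = (\<Sum>j\<in>UNIV. cst (f j))" for f :: "3 \<Rightarrow> 'b"
    by (simp add: sum_3 cst)
  have xy: "x i = y i + cst (m i) * x k" for i by (simp add: y_def)
  have yk: "y k = 0" using k by (simp add: y_def m_def cst)
  define z where "z = (\<lambda>i. \<Sum>j\<in>UNIV. cst (A $ i $ j) * y j)"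
  have zx: "(\<Sum>j\<in>UNIV. cst (A $ i $ j) * x j) = z i" for i
  proof -
    have "(\<Sum>j\<in>UNIV. A $ i $ j * m j) = (A *v v) $ i / v $ k"
      by (simp add: matrix_vector_mult_def m_def sum_divide_distrib)
    also have "\<dots> = 0" using v(2) by simp
    finally have 0: "(\<Sum>j\<in>UNIV. cst (A $ i $ j * m j)) = 0" by (simp only: cst_sum[symmetric] cst(3))
    have "(\<Sum>j\<in>UNIV. cst (A $ i $ j) * x j) = z i + (\<Sum>j\<in>UNIV. cst (A $ i $ j * m j)) * x k"
      unfolding z_def by (subst xy) (simp add: distrib_left sum.distrib sum_distrib_right cst mult.assoc)
    then show ?thesis unfolding 0 by simp
  qed
  have "gram_poly A = (\<Sum>i\<in>UNIV. \<Sum>j\<in>UNIV. x i * (cst (A $ i $ j) * x j))"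
    unfolding gram_poly_def by (simp add: x_def cst_def mult_single add.commute)
  also have "\<dots> = (\<Sum>i\<in>UNIV. x i * z i)" by (simp add: zx flip: sum_distrib_left)
  also have "\<dots> = (\<Sum>i\<in>UNIV. \<Sum>j\<in>UNIV. y j * (cst (A $ j $ i) * x i))"
    unfolding z_def sum_distrib_left by (intro sum.cong refl) (simp add: sym mult_ac)
  also have "\<dots> = (\<Sum>j\<in>UNIV. \<Sum>i\<in>UNIV. y j * (cst (A $ j $ i) * x i))" by (rule sum.swap)
  also have "\<dots> = (\<Sum>j\<in>UNIV. y j * z j)" by (simp add: zx flip: sum_distrib_left)
  finally have gram: "gram_poly A = (\<Sum>j\<in>UNIV. \<Sum>i\<in>UNIV. y j * (cst (A $ j $ i) * y i))"
    unfolding z_def by (simp add: sum_distrib_left)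
  obtain i j where ij: "(UNIV :: 3 set) = {i, j, k}" "i \<noteq> j" "i \<noteq> k" "j \<noteq> k"
  proof -
    have d: "(1::3) \<noteq> 2" "(1::3) \<noteq> 3" "(2::3) \<noteq> 3" by simp_all
    consider "k = 1" | "k = 2" | "k = 3" using exhaust_3[of k] by blast
    then show ?thesis
    proof cases
      case 1
      have "(UNIV :: 3 set) = {2, 3, 1}" unfolding UNIV_3 by blast
      then show ?thesis by (rule that[of 2 3, unfolded 1]) (use d in \<open>simp_all only: not_sym simp_thms\<close>)
    next
      case 2
      have "(UNIV :: 3 set) = {1, 3, 2}" unfolding UNIV_3 by blast
      then show ?thesis by (rule that[of 1 3, unfolded 2]) (use d in \<open>simp_all only: not_sym simp_thms\<close>)
    next
      case 3
      show ?thesis by (rule that[of 1 2, unfolded 3, OF UNIV_3]) (use d in \<open>simp_all only: not_sym simp_thms\<close>)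
    qed
  qed
  have two: "gram_poly A = cst (A $ i $ i) * (y i * y i) + cst (2 * A $ i $ j) * (y i * y j) + cst (A $ j $ j) * (y j * y j)"
  proof -
    have c2: "cst (2 * A $ i $ j) = cst (A $ i $ j) + cst (A $ i $ j)" unfolding mult_2 cst(1) ..
    have sum3: "(\<Sum>l\<in>UNIV. f l) = f i + f j + f k" for f :: "3 \<Rightarrow> 'b poly3"
      unfolding ij(1) using ij(2-4) by (simp add: add.assoc)
    show ?thesis unfolding gram sum3 c2 yk sym[of j i] mult_zero_left mult_zero_right add_0_right
      by (simp only: distrib_left distrib_right mult_ac add_ac)
  qed
  obtain r s t u where f: "A $ i $ i = r * t" "2 * A $ i $ j = r * u + s * t" "A $ j $ j = s * u"
    by (rule binary_form_splits)
  have "gram_poly A = (cst r * y i + cst s * y j) * (cst t * y i + cst u * y j)"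
    unfolding two f cst by (simp only: distrib_left distrib_right mult_ac add_ac)
  with irr have "(cst r * y i + cst s * y j) dvd 1 \<or> (cst t * y i + cst u * y j) dvd 1"
    by (rule irreducibleD)
  moreover have "Poly_Mapping.lookup (y l) 0 = 0" for l
  proof -
    have x0: "Poly_Mapping.lookup (x n) 0 = 0" for n
    proof -
      have "Poly_Mapping.lookup (var n) n \<noteq> Poly_Mapping.lookup 0 n" by simp
      then have "var n \<noteq> 0" by (rule contrapos_nn) (rule arg_cong)
      then show ?thesis by (simp add: x_def lookup_single when_def)
    qed
    then show ?thesis unfolding y_def lookup_minus by (simp add: lookup_times_zero)
  qed
  then have "Poly_Mapping.lookup (cst s' * y i + cst t' * y j) 0 = 0" for s' t'
    by (simp add: lookup_add lookup_times_zero)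
  ultimately show False using nonunit_no_constant by blast
qed

context odd_field
begin

text \<open>
  A singular Gram matrix remains singular over the algebraic closure, where the form would be reducible.
  So the form is nondegenerate and has the normal form y^2 - x z up to a factor.
\<close>

lemma irreducible_conic_frame:
  assumes "irreducible_conic (C :: ('a ^ 3) set set)"
  obtains M where "frame q M C"
proof -
  obtain F :: "'a poly3" where F: "homogeneous3 2 F"
    "Factorial_Ring.irreducible (Poly_Mapping.map to_ac F :: 'a alg_closure poly3)"
    "C = {P \<in> pg_points. \<forall>v\<in>P. eval3 F v = 0}"
    using assms unfolding irreducible_conic_def by blast
  obtain A :: "'a ^ 3 ^ 3" where A: "transpose A = A" "F = gram_poly A"
    "Poly_Mapping.map to_ac F = gram_poly ((\<chi> i j. to_ac (A $ i $ j)) :: 'a alg_closure ^ 3 ^ 3)"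
    using F(1) by (rule homogeneous_gram)
  have det: "det A \<noteq> 0"
  proof
    assume "det A = 0"
    then obtain v :: "'a ^ 3" where v: "v \<noteq> 0" "A *v v = 0" by (rule singular_kernel)
    let ?A = "(\<chi> i j. to_ac (A $ i $ j)) :: 'a alg_closure ^ 3 ^ 3"
      and ?v = "(\<chi> i. to_ac (v $ i)) :: 'a alg_closure ^ 3"
    have "A $ i $ j = A $ j $ i" for i j
      using A(1) by (metis (no_types, lifting) transpose_def vec_lambda_beta)
    then have "?A $ i $ j = ?A $ j $ i" for i j by simp
    moreover have "?v \<noteq> 0" using v(1) by (simp add: vec_eq_iff)
    moreover have "(?A *v ?v) $ i = to_ac ((A *v v) $ i)" for i
      by (simp add: matrix_vector_mult_def to_ac_sum)
    then have "?A *v ?v = 0" using v(2) by (simp add: vec_eq_iff)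
    ultimately have "\<not> Factorial_Ring.irreducible (gram_poly ?A)" by (rule degenerate_gram_poly_reducible)
    then show False using F(2) A(3) by simp
  qed
  obtain M :: "'a ^ 3 ^ 3" and l where M: "invertible M" "l \<noteq> 0"
    "\<And>w. bform A (M *v w) (M *v w) = l * ((w $ 2)\<^sup>2 - w $ 1 * w $ 3)"
    using conic_normal_form[OF A(1) det] by blast
  have "frame q M C"
  proof unfold_locales
    show "invertible M" by (rule M(1))
    show "C \<subseteq> pg_points" using F(3) by blast
    fix x y z :: 'a assume nz: "(x, y, z) \<noteq> (0, 0, 0)"
    let ?w = "vector [x, y, z] :: 'a ^ 3"
    have "?w \<noteq> 0" using nz by (simp only: vector_3_eq_0 not_False_eq_True)
    then have "M *v ?w \<noteq> 0"
      using M(1) matrix_left_invertible_ker[of M] invertible_left_inverse[of M] by blast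
    then have pt: "point_at M x y z \<in> pg_points" unfolding point_at_def pg_points_iff by blast
    have scale: "bform A (s *s (M *v ?w)) (s *s (M *v ?w)) = s * s * (l * (y\<^sup>2 - x * z))" for s
      using M(3)[of ?w] by (simp add: vector_3)
    have "(\<forall>v\<in>point_at M x y z. eval3 F v = 0) \<longleftrightarrow> (\<forall>s. s * s * (l * (y\<^sup>2 - x * z)) = 0)"
      unfolding A(2) eval3_gram_poly point_at_def vec.span_singleton Set.ball_simps(9) ball_UNIV scale ..
    also have "\<dots> \<longleftrightarrow> y\<^sup>2 = x * z" using M(2) by (auto dest: spec[of _ 1])
    finally show "point_at M x y z \<in> C \<longleftrightarrow> y\<^sup>2 = x * z" using F(3) pt by simp
  qed
  then show ?thesis by (rule that)
qed

end

section \<open>Classification of the line partitions\<close>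

theorem theorem1p2:
  fixes C \<L> :: "('a::{field,finite} ^ 3) set set"
    and p h q :: nat
  assumes "CARD('a) = q" and "prime p" and "odd p" and "h \<ge> 1" and "q = p ^ h"
    and "q \<noteq> 3"
    and "irreducible_conic C"
    and "internal_line_partition C \<L>"
  shows
    "(card \<L> = q - 1 \<and>
        (\<exists>P. external_point C P \<and> \<L> = {L \<in> pg_lines. P \<subseteq> L \<and> \<not> tangent_line C L}))
     \<or> (card \<L> = q \<and>
        (\<exists>P\<in>C. \<L> = {L \<in> pg_lines. P \<subseteq> L \<and> L \<noteq> tangent_at C P}))
     \<or> (\<exists>r. q = r\<^sup>2 \<and> card \<L> = q \<and>
        (\<exists>B. baer_subplane r B \<and> card (B \<inter> C) = r + 1
             \<and> \<L> = {L \<in> baer_lines r B. \<not> tangent_line C L}))"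
proof -
  have p3: "p \<ge> 3" using assms(2,3) prime_ge_2_nat[of p] by (cases "p = 2") auto
  have "p ^ 1 \<le> p ^ h" using assms(4) p3 by (intro power_increasing) auto
  then have q4: "q > 3" using p3 assms(5,6) by simp
  \<comment> \<open>Adding 1 permutes the field, so |F| times 1 cancels from the sum of its elements.\<close>
  have "(of_nat CARD('a) :: 'a) = 0"
  proof -
    have "(\<Sum>x\<in>(UNIV :: 'a set). x + 1) = (\<Sum>x\<in>UNIV. x)"
      by (rule sum.reindex_bij_witness[of _ "\<lambda>x. x - 1" "\<lambda>x. x + 1"]) auto
    then show ?thesis by (simp add: sum.distrib)
  qed
  then have "CHAR('a) dvd CARD('a)" by (simp only: of_nat_eq_0_iff_char_dvd)
  then have "CHAR('a) dvd p ^ h" by (simp only: assms(1,5))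
  moreover have pc: "prime CHAR('a)" by (rule prime_CHAR_semidom) (simp add: finite_imp_CHAR_pos)
  ultimately have "CHAR('a) dvd p" using prime_dvd_power by blast
  then have char: "CHAR('a) = p" using primes_dvd_imp_eq[OF pc assms(2)] by simp
  interpret odd_field q "TYPE('a)"
  proof
    show "q = CARD('a)" using assms(1) by simp
    show "\<exists>n. q = CHAR('a) ^ n" using assms(5) char by blast
    show "(2::'a) \<noteq> 0"
    proof
      assume "(2::'a) = 0"
      then have "(of_nat 2 :: 'a) = 0" by simp
      then have "p dvd 2" using char of_nat_eq_0_iff_char_dvd by blast
      then show False using p3 by (auto dest: dvd_imp_le)
    qed
    show "q > 3" by (rule q4)
  qed
  note part = assms(8)
  obtain M where "frame q M C" using assms(7) by (rule irreducible_conic_frame)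
  then interpret frame q "TYPE('a)" M C .
  obtain a b c where cf: "apolar_partition q \<L> a b c" and coords: "\<And>L. L \<in> \<L> \<Longrightarrow> L = line_at M (a L) (b L) (c L)"
    using partition_coordinates[OF part] by blast
  interpret apolar_partition q "TYPE('a)" \<L> a b c by (rule cf)
  have through: "point_at M x y z \<subseteq> L \<longleftrightarrow> a L * x + 2 * b L * y + c L * z = 0" if "L \<in> \<L>" for L x y z
    by (subst coords[OF that]) (rule pt_on_ln)
  show ?thesis
  proof (cases rule: hyperbolic_count_cases)
    case half
    obtain x y z w where w: "w \<noteq> 0" "y\<^sup>2 - x * z = w\<^sup>2"
      "\<And>L. L \<in> \<L> \<Longrightarrow> a L * x + 2 * b L * y + c L * z = 0"
      using half_case[OF half(2)] by blast
    let ?P = "point_at M x y z"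
    have nz: "(x, y, z) \<noteq> (0, 0, 0)" using w(1,2) by auto
    have ne: "y\<^sup>2 \<noteq> x * z" using w(1,2) by auto
    have sq: "is_square (y\<^sup>2 - x * z)" unfolding w(2) by simp
    have "external_point C ?P"
      unfolding external_point_def tangents_through_point[OF nz] using pt_point[OF nz] C_iff[OF nz] ne sq by simp
    moreover have "\<L> = {L \<in> pg_lines. ?P \<subseteq> L \<and> \<not> tangent_line C L}"
      by (rule pencil_partition[OF part pt_point[OF nz]]) (use internal_iff[OF nz] sq through w(3) in auto)
    ultimately show ?thesis using half(2) by blast
  next
    case full
    from full_case[OF full(2)] show ?thesis
    proof
      assume "\<exists>x y z. (x, y, z) \<noteq> (0, 0, 0) \<and> y\<^sup>2 = x * z \<and> (\<forall>L\<in>\<L>. a L * x + 2 * b L * y + c L * z = 0)"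
      then obtain x y z where w: "(x, y, z) \<noteq> (0, 0, 0)" "y\<^sup>2 = x * z"
        "\<And>L. L \<in> \<L> \<Longrightarrow> a L * x + 2 * b L * y + c L * z = 0" by blast
      let ?P = "point_at M x y z"
      have PC: "?P \<in> C" using C_iff[OF w(1)] w(2) by simp
      have "card {L. tangent_line C L \<and> ?P \<subseteq> L} = 1" unfolding tangents_through_point[OF w(1)] using w(2) by simp
      then obtain L0 where L0: "{L. tangent_line C L \<and> ?P \<subseteq> L} = {L0}" by (auto simp: card_1_singleton_iff)
      then have "tangent_at C ?P = L0" unfolding tangent_at_def by (intro the_equality) auto
      then have tan: "tangent_line C L \<longleftrightarrow> L = tangent_at C ?P" if "?P \<subseteq> L" for L using L0 that by auto
      have "\<not> internal_point C ?P" using PC by (simp add: internal_point_def)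
      then have "\<L> = {L \<in> pg_lines. ?P \<subseteq> L \<and> \<not> tangent_line C L}"
        by (intro pencil_partition[OF part pt_point[OF w(1)]]) (use through w(3) in auto)
      also have "\<dots> = {L \<in> pg_lines. ?P \<subseteq> L \<and> L \<noteq> tangent_at C ?P}" using tan by auto
      finally show ?thesis using full(2) PC by blast
    next
      assume "\<exists>K \<alpha> \<beta> \<gamma> \<delta>. \<alpha> * \<delta> - \<beta> * \<gamma> \<noteq> 0 \<and> subfield_set K \<and> (card K)\<^sup>2 = q \<and>
        (\<forall>L\<in>\<L>. \<exists>l. l \<noteq> 0 \<and> l * (a L * \<alpha>\<^sup>2 + 2 * b L * \<alpha> * \<gamma> + c L * \<gamma>\<^sup>2) \<in> K
         \<and> l * (a L * \<alpha> * \<beta> + b L * (\<alpha> * \<delta> + \<beta> * \<gamma>) + c L * \<gamma> * \<delta>) \<in> K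
         \<and> l * (a L * \<beta>\<^sup>2 + 2 * b L * \<beta> * \<delta> + c L * \<delta>\<^sup>2) \<in> K)"
      then obtain K \<alpha> \<beta> \<gamma> \<delta> where d: "\<alpha> * \<delta> - \<beta> * \<gamma> \<noteq> 0" and K: "subfield_set K" "(card K)\<^sup>2 = q"
        and rat: "\<And>L. L \<in> \<L> \<Longrightarrow> \<exists>l. l \<noteq> 0 \<and> l * (a L * \<alpha>\<^sup>2 + 2 * b L * \<alpha> * \<gamma> + c L * \<gamma>\<^sup>2) \<in> K
         \<and> l * (a L * \<alpha> * \<beta> + b L * (\<alpha> * \<delta> + \<beta> * \<gamma>) + c L * \<gamma> * \<delta>) \<in> K
         \<and> l * (a L * \<beta>\<^sup>2 + 2 * b L * \<beta> * \<delta> + c L * \<delta>\<^sup>2) \<in> K" by blast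
      obtain M' where M': "frame q M' C"
        and pt: "\<And>x y z. point_at M' x y z = point_at M (\<alpha>\<^sup>2 * x + 2 * \<alpha> * \<beta> * y + \<beta>\<^sup>2 * z)
         (\<alpha> * \<gamma> * x + (\<alpha> * \<delta> + \<beta> * \<gamma>) * y + \<beta> * \<delta> * z) (\<gamma>\<^sup>2 * x + 2 * \<gamma> * \<delta> * y + \<delta>\<^sup>2 * z)"
        using frame_transform[OF d] by blast
      interpret f: frame q "TYPE('a)" M' C by (rule M')
      \<comment> \<open>The coefficients of the lines in the new frame, which are proportional to triples over K.\<close>
      define a' b' c' where "a' = (\<lambda>L. a L * \<alpha>\<^sup>2 + 2 * b L * \<alpha> * \<gamma> + c L * \<gamma>\<^sup>2)"
        and "b' = (\<lambda>L. a L * \<alpha> * \<beta> + b L * (\<alpha> * \<delta> + \<beta> * \<gamma>) + c L * \<gamma> * \<delta>)"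
        and "c' = (\<lambda>L. a L * \<beta>\<^sup>2 + 2 * b L * \<beta> * \<delta> + c L * \<delta>\<^sup>2)"
      interpret t: apolar_partition q "TYPE('a)" \<L> a' b' c'
        unfolding a'_def b'_def c'_def by (rule transform[OF d])
      have "\<exists>x\<in>K. \<exists>y\<in>K. \<exists>z\<in>K. (x, y, z) \<noteq> (0, 0, 0) \<and> L = line_at M' x y z" if L: "L \<in> \<L>" for L
      proof -
        obtain l where l: "l \<noteq> 0" "l * a' L \<in> K" "l * b' L \<in> K" "l * c' L \<in> K"
          using rat[OF L] unfolding a'_def b'_def c'_def by blast
        have nz: "(l * a' L, l * b' L, l * c' L) \<noteq> (0, 0, 0)"
          using t.nontangent[OF L] l(1) by auto
        have "L = line_at M' (l * a' L) (l * b' L) (l * c' L)"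
        proof (rule f.line_eqI[OF partitionD(1)[OF part L] nz])
          fix x y z
          have "point_at M' x y z \<subseteq> L \<longleftrightarrow> a' L * x + 2 * b' L * y + c' L * z = 0"
            unfolding pt through[OF L] by (simp add: a'_def b'_def c'_def algebra_simps)
          also have "\<dots> \<longleftrightarrow> l * (a' L * x + 2 * b' L * y + c' L * z) = 0" using l(1) by simp
          also have "l * (a' L * x + 2 * b' L * y + c' L * z) = l * a' L * x + 2 * (l * b' L) * y + l * c' L * z"
            by (simp add: algebra_simps)
          finally show "point_at M' x y z \<subseteq> L \<longleftrightarrow> l * a' L * x + 2 * (l * b' L) * y + l * c' L * z = 0" .
        qed
        then show ?thesis using l nz by blast
      qed
      from f.baer_case[OF K part this]
      have "q = (card K)\<^sup>2 \<and> card \<L> = q \<and> (\<exists>B. baer_subplane (card K) B \<and> card (B \<inter> C) = card K + 1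
        \<and> \<L> = {L \<in> baer_lines (card K) B. \<not> tangent_line C L})"
        using K(2)[symmetric] full(2) by (intro conjI)
      then show ?thesis by (intro disjI2 exI)
    qed
  qed
qed

end
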